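(* Fix $t\ge1$ and a linear order $\prec$ on $T=\{1,\dots,t\}$. There is a bijection $\theta$ from the vertex set of $\mathcal G(\mathbf c)$ onto $H(\mathbf c)$ which preserves vertex labels and induces a bijection from the edges of $\mathcal G(\mathbf c)$ onto the edges of $\mathcal G_{H(\mathbf c)}$ preserving edge labels; i.e. $\theta$ is an isomorphism of labelled graphs $\mathcal G(\mathbf c)\cong\mathcal G_{H(\mathbf c)}$.
   Context: Put $T=\{1,\dots,t\}$, $\hat T=\{1,\dots,t+1\}$. Diagrams. A diagram (of order $t+1$) is a tuple $(h_1,\dots,h_{t+1})$ of non-negative integers, pictured as columns $C_1,\dots,C_{t+1}$ of unit blocks on the $x$-axis; $\mathrm{ht}\,C_i=h_i$, $B(i,j)$ ($1\le j\le h_i$) is the block of $C_i$ at level (row) $j$, $R_j$ the set of blocks at level $j$, and the height of the diagram is $\max_i h_i$. Two distinct columns of height $\ge s$ are neighbours at level $s$ if every column strictly between them has height $<s$. A column $C$ is left (resp. right) extremal if it has no neighbour to its left (resp. right) at level $\mathrm{ht}\,C$. Boundary conditions (always imposed): every left extremal column has even height or maximal height, every right extremal column has odd height or maximal height. Moves. (1) Domino adjunction: adding two blocks on top of a column of height $i$; even/odd as $i$ is even/odd; left (resp. right) if in the new diagram the enlarged column is the left (resp. right) neighbour at levels $i+1,i+2$ of some column of height $\ge i+2$. Only left even and right odd dominoes may be adjoined or removed. (2) The strongly extremal column of a non-empty diagram of height $r$ is the leftmost column of height $r$ if $r$ is odd, the rightmost if $r$ is even; for the empty diagram it is $C_{t+1}$.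 Half-domino adjunction adds one block on top of it (inverse: removal). (3) Row cancellation: if adjacent rows $R_{i+1},R_{i+2}$ ($i\ge0$) have equal numbers of blocks, delete levels $i+1,i+2$ from every column of height $\ge i+2$; and the inverse. Equivalence is generated by these moves. A diagram is complete if no left even or right odd domino can be adjoined, reduced if no two adjacent rows have equal numbers of blocks. The strongly extremal column's $x$-coordinate is constant on classes; $H$ is the set of classes, $H_j$ those with strongly extremal column $C_j$. Tableaux. Entries in $T$: at each non-empty level $j$ the extremal block is the rightmost block of $R_j$ if $j$ is odd, the leftmost if $j$ even; it gets no entry. $b(i,1)=i$ for non-extremal $B(i,1)$; for $j\ge1$ and non-extremal $B(i,j+1)$, $b(i,j+1)=b(k,j)$ with $C_k$ the left (if $j$ odd) resp. right (if $j$ even) neighbour of $C_i$ at level $j$. Convention $b(i,0)=i-1$. Functions. Indeterminates $c_1,\dots,c_t,m^1,\dots,m^{t+1}$; for $i<j$, $r^i-r^j:=m^i+2m^{i+1}+\dots+2m^{j-1}+m^j$, $r^j-r^i:=-(r^i-r^j)$. $h=-\sum_{i\in T}c_im^i$. For level $s$ with columns of height $\ge s$ indexed $u_1<\dots<u_k$: $f_{R_s}=\sum_{i=1}^{k-1}c_{b(u_i,s)}(r^{u_i}-r^{u_{i+1}})$ ($s$ odd), $\sum_{i=2}^{k}c_{b(u_i,s)}(r^{u_i}-r^{u_{i-1}})$ ($s$ even); $f_{\mathcal T}=h+\sum_s f_{R_s}$. Order and $H(\mathbf c)$. $P(\mathcal T)$: for each level $j\ge1$: (a) $j$ even: for each column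 $C_q$ with left neighbour $C_p$ at level $j$, with $C_{q'}$ the left neighbour of $C_q$ at level $j-1$: $b(q,j)<b(l,j-1)$ for all $l\ne q'$ with $l=p$ or ($p<l<q$, $h_l=j-1$). (b) $j$ odd: for each $C_p$ with right neighbour $C_q$ at level $j$, with $C_{p'}$ the right neighbour of $C_p$ at level $j-1$: $b(p,j)<b(l,j-1)$ for all $l\ne p'$ with $l=q$ or ($p<l<q$, $h_l=j-1$). $\prec$ is compatible with $\mathcal T$ if $a\prec b$ for every relation $a<b$ in $P(\mathcal T)$; $H(\mathbf c)$ is the set of classes containing a complete tableau compatible with $\prec$. Graph of links $\mathcal G_H$: vertices are the elements of $H$, a vertex in $H_j$ labelled $j$; for $j\ne k$, $x\in H_j$ and $y\in H_k$ are joined by an undirected edge if some complete reduced tableau in $x$ yields, on adding one block on top of its column $C_k$, a diagram (satisfying the boundary conditions) in $y$; the edge is labelled by the entry (in $T$) of the added block in the new tableau. $\mathcal G_{H(\mathbf c)}$ is the induced subgraph on $H(\mathbf c)$. The graph $\mathcal G(\mathbf c)$ (vertex labels in $\hat T$, edge labels in $T$), by induction on $t$: for $t=1$, two vertices labelled $1$ and $2$ joined by an edge labelled $1$. For $t\ge2$, let $s$ be the $\prec$-largest element of $T$; define $\psi_s:\{1,\dots,t-1\}\to T$ and $\psi^s:\{1,\dots,t\}\to\hat T$ by $j\mapsto j$ if $j<s$, $j\mapsto j+1$ if $j\ge s$; let $\prec^-$ be the order on $\{1,\dots,t-1\}$ with $a\prec^-b$ iff $\psi_s(a)\prec\psi_s(b)$,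 and let $\mathcal G(\mathbf c^-)$ be the graph constructed for $\prec^-$. Take two copies $\mathcal G^+,\mathcal G^-$ of $\mathcal G(\mathbf c^-)$, relabel edges by $\psi_s$ in both, vertices by $\psi^s$ in $\mathcal G^+$ and by $\psi^{s+1}$ in $\mathcal G^-$, and let $\varphi:\mathcal G^+\to\mathcal G^-$ be the identity correspondence. $\mathcal G(\mathbf c)$ is $\mathcal G^+\sqcup\mathcal G^-$ together with, for every vertex $v$ of $\mathcal G^+$ with label $s+1$, an edge labelled $s$ joining $v$ and $\varphi(v)$. *)

theory Defs
  imports Main
begin

section \<open>Diagrams\<close>

text \<open>A diagram of order \<open>t + 1\<close> is represented by its height function \<open>h\<close>, with
  \<open>h i = 0\<close> for \<open>i\<close> outside \<open>{1..t + 1}\<close>.  The parameter \<open>t\<close> is passed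
  explicitly because at level 0 the columns of height 0 count as well.\<close>

type_synonym diagram = "nat \<Rightarrow> nat"

abbreviation cols :: "nat \<Rightarrow> nat set" where
  "cols t \<equiv> {1..t + 1}"

text \<open>\<open>nbr t h s p q\<close>: column \<open>p\<close> is the left neighbour of column \<open>q\<close> at level \<open>s\<close>
  (equivalently, \<open>q\<close> is the right neighbour of \<open>p\<close>).\<close>

definition nbr :: "nat \<Rightarrow> diagram \<Rightarrow> nat \<Rightarrow> nat \<Rightarrow> nat \<Rightarrow> bool" where
  "nbr t h s p q \<longleftrightarrow> p \<in> cols t \<and> q \<in> cols t \<and> p < q \<and> s \<le> h p \<and> s \<le> h q \<and>
     (\<forall>l. p < l \<and> l < q \<longrightarrow> h l < s)"

definition left_extremal :: "nat \<Rightarrow> diagram \<Rightarrow> nat \<Rightarrow> bool" where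
  "left_extremal t h i \<longleftrightarrow> \<not> (\<exists>k. nbr t h (h i) k i)"

definition right_extremal :: "nat \<Rightarrow> diagram \<Rightarrow> nat \<Rightarrow> bool" where
  "right_extremal t h i \<longleftrightarrow> \<not> (\<exists>k. nbr t h (h i) i k)"

definition height :: "nat \<Rightarrow> diagram \<Rightarrow> nat" where
  "height t h = Max (h ` cols t)"

definition diagrams :: "nat \<Rightarrow> diagram set" where
  "diagrams t = {h. (\<forall>i. i \<notin> cols t \<longrightarrow> h i = 0) \<and>
     (\<forall>i\<in>cols t. left_extremal t h i \<longrightarrow> even (h i) \<or> h i = height t h) \<and>
     (\<forall>i\<in>cols t. right_extremal t h i \<longrightarrow> odd (h i) \<or> h i = height t h)}"

definition row :: "nat \<Rightarrow> diagram \<Rightarrow> nat \<Rightarrow> nat set" where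
  "row t h j = {i \<in> cols t. j \<le> h i}"

text \<open>For the empty diagram (all heights 0, so the second branch applies) this gives
  column \<open>t + 1\<close>, as it should.\<close>

definition strongly_extremal :: "nat \<Rightarrow> diagram \<Rightarrow> nat" where
  "strongly_extremal t h =
     (if odd (height t h) then Min {i \<in> cols t. h i = height t h}
      else Max {i \<in> cols t. h i = height t h})"


section \<open>Moves and equivalence\<close>

definition left_even_domino :: "nat \<Rightarrow> diagram \<Rightarrow> diagram \<Rightarrow> bool" where
  "left_even_domino t g h \<longleftrightarrow> (\<exists>i\<in>cols t. h = g(i := g i + 2) \<and> even (g i) \<and>
     (\<exists>k. g i + 2 \<le> h k \<and> nbr t h (g i + 1) i k \<and> nbr t h (g i + 2) i k))"

definition right_odd_domino :: "nat \<Rightarrow> diagram \<Rightarrow> diagram \<Rightarrow> bool" where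
  "right_odd_domino t g h \<longleftrightarrow> (\<exists>i\<in>cols t. h = g(i := g i + 2) \<and> odd (g i) \<and>
     (\<exists>k. g i + 2 \<le> h k \<and> nbr t h (g i + 1) k i \<and> nbr t h (g i + 2) k i))"

definition half_domino :: "nat \<Rightarrow> diagram \<Rightarrow> diagram \<Rightarrow> bool" where
  "half_domino t g h \<longleftrightarrow>
     h = g(strongly_extremal t g := g (strongly_extremal t g) + 1)"

definition row_cancel :: "nat \<Rightarrow> diagram \<Rightarrow> diagram \<Rightarrow> bool" where
  "row_cancel t g h \<longleftrightarrow> (\<exists>i. card (row t g (i + 1)) = card (row t g (i + 2)) \<and>
     h = (\<lambda>k. if i + 2 \<le> g k then g k - 2 else g k))"

definition move :: "nat \<Rightarrow> diagram \<Rightarrow> diagram \<Rightarrow> bool" where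
  "move t g h \<longleftrightarrow> g \<in> diagrams t \<and> h \<in> diagrams t \<and>
     (left_even_domino t g h \<or> right_odd_domino t g h \<or> half_domino t g h \<or> row_cancel t g h)"

definition diagram_equiv :: "nat \<Rightarrow> diagram rel" where
  "diagram_equiv t = {(g, h). g \<in> diagrams t \<and> h \<in> diagrams t \<and> equivclp (move t) g h}"

definition H :: "nat \<Rightarrow> diagram set set" where
  "H t = diagrams t // diagram_equiv t"

text \<open>The strongly extremal column is invariant under every move, so the sets
  \<open>H_col t j\<close> for \<open>j \<in> cols t\<close> partition \<open>H t\<close>; hence the definite description
  used for the vertex labels of \<open>link_graph\<close> below is well defined.\<close>

definition H_col :: "nat \<Rightarrow> nat \<Rightarrow> diagram set set" where
  "H_col t j = {x \<in> H t. \<forall>h\<in>x. strongly_extremal t h = j}"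

definition complete :: "nat \<Rightarrow> diagram \<Rightarrow> bool" where
  "complete t h \<longleftrightarrow>
     \<not> (\<exists>h'\<in>diagrams t. left_even_domino t h h' \<or> right_odd_domino t h h')"

text \<open>Only the rows \<open>1, \<dots>, height t h\<close> belong to the diagram; the empty rows above them,
  which trivially have equal numbers of blocks, are not considered.\<close>

definition reduced :: "nat \<Rightarrow> diagram \<Rightarrow> bool" where
  "reduced t h \<longleftrightarrow>
     (\<forall>j. 1 \<le> j \<and> j < height t h \<longrightarrow> card (row t h j) \<noteq> card (row t h (j + 1)))"


section \<open>Tableaux\<close>

definition extremal_block :: "nat \<Rightarrow> diagram \<Rightarrow> nat \<Rightarrow> nat \<Rightarrow> bool" where
  "extremal_block t h i j \<longleftrightarrow> i = (if odd j then Max (row t h j) else Min (row t h j))"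

text \<open>\<open>entry t h i j\<close> is the entry \<open>b(i,j)\<close>.  For \<open>j \<ge> 1\<close> the value 0 encodes the absence of
  an entry: the block \<open>B(i,j)\<close> does not exist or is extremal.  (Genuine entries lie in
  \<open>{1..t}\<close>.)  A tableau is determined by its diagram, so tableaux are not given a type of
  their own.\<close>

fun entry :: "nat \<Rightarrow> diagram \<Rightarrow> nat \<Rightarrow> nat \<Rightarrow> nat" where
  "entry t h i 0 = i - 1"
| "entry t h i (Suc 0) =
     (if i \<notin> row t h 1 \<or> extremal_block t h i 1 then 0 else i)"
| "entry t h i (Suc (Suc n)) =
     (let j = Suc n in
      if i \<notin> row t h (j + 1) \<or> extremal_block t h i (j + 1) then 0
      else if odd j then entry t h (THE k. nbr t h j k i) (Suc n)
      else entry t h (THE k. nbr t h j i k) (Suc n))"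

definition order_relations :: "nat \<Rightarrow> diagram \<Rightarrow> nat rel" where
  "order_relations t h =
     {(entry t h q j, entry t h l (j - 1)) | j p q q' l.
        1 \<le> j \<and> even j \<and> nbr t h j p q \<and> nbr t h (j - 1) q' q \<and>
        l \<noteq> q' \<and> (l = p \<or> p < l \<and> l < q \<and> h l = j - 1)} \<union>
     {(entry t h p j, entry t h l (j - 1)) | j p p' q l.
        1 \<le> j \<and> odd j \<and> nbr t h j p q \<and> nbr t h (j - 1) p p' \<and>
        l \<noteq> p' \<and> (l = q \<or> p < l \<and> l < q \<and> h l = j - 1)}"

definition compatible :: "nat \<Rightarrow> nat rel \<Rightarrow> diagram \<Rightarrow> bool" where
  "compatible t prec h \<longleftrightarrow> order_relations t h \<subseteq> prec"

definition H_of :: "nat \<Rightarrow> nat rel \<Rightarrow> diagram set set" where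
  "H_of t prec = {x \<in> H t. \<exists>h\<in>x. complete t h \<and> compatible t prec h}"


section \<open>Labelled graphs\<close>

text \<open>Undirected graphs with labelled vertices and edges; an edge labelled \<open>a\<close> joining
  \<open>u\<close> and \<open>v\<close> is the pair \<open>({u, v}, a)\<close>.\<close>

record 'v lgraph =
  verts :: "'v set"
  vlabel :: "'v \<Rightarrow> nat"
  edges :: "('v set \<times> nat) set"

definition induced :: "'v set \<Rightarrow> 'v lgraph \<Rightarrow> 'v lgraph" where
  "induced V G = \<lparr>verts = verts G \<inter> V, vlabel = vlabel G,
     edges = {(e, a) \<in> edges G. e \<subseteq> V}\<rparr>"

definition link_graph :: "nat \<Rightarrow> diagram set lgraph" where
  "link_graph t =
     \<lparr>verts = H t,
      vlabel = (\<lambda>x. THE j. x \<in> H_col t j),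
      edges = {({x, y}, a) | x y a. \<exists>j\<in>cols t. \<exists>k\<in>cols t. j \<noteq> k \<and> x \<in> H_col t j \<and> y \<in> H_col t k \<and>
         (\<exists>h\<in>x. complete t h \<and> reduced t h \<and>
            (let h' = h(k := h k + 1) in
               h' \<in> y \<and> a = entry t h' k (h' k) \<and> a \<in> {1..t}))}\<rparr>"

definition link_graph_of :: "nat \<Rightarrow> nat rel \<Rightarrow> diagram set lgraph" where
  "link_graph_of t prec = induced (H_of t prec) (link_graph t)"


section \<open>The inductively constructed graph\<close>

text \<open>Used both as \<open>\<psi>\<^sub>s\<close> (on edge labels) and as \<open>\<psi>\<^sup>s\<close> (on vertex labels).\<close>

definition psi :: "nat \<Rightarrow> nat \<Rightarrow> nat" where
  "psi s j = (if j < s then j else j + 1)"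

definition largest :: "nat set \<Rightarrow> nat rel \<Rightarrow> nat" where
  "largest T prec = (THE s. s \<in> T \<and> (\<forall>a\<in>T. a \<noteq> s \<longrightarrow> (a, s) \<in> prec))"

text \<open>The vertices of the graph for \<open>t\<close> are the Boolean lists of length \<open>t\<close>: prefixing
  \<open>True\<close> resp. \<open>False\<close> gives the copy \<open>\<G>\<^sup>+\<close> resp. \<open>\<G>\<^sup>-\<close> of the graph for
  \<open>t - 1\<close>.  The value at \<open>t = 0\<close> is irrelevant.\<close>

fun ind_graph :: "nat \<Rightarrow> nat rel \<Rightarrow> bool list lgraph" where
  "ind_graph 0 prec = \<lparr>verts = {}, vlabel = (\<lambda>_. 0), edges = {}\<rparr>"
| "ind_graph (Suc 0) prec =
     \<lparr>verts = {[False], [True]},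
      vlabel = (\<lambda>v. if v = [False] then 1 else 2),
      edges = {({[False], [True]}, 1)}\<rparr>"
| "ind_graph (Suc (Suc n)) prec =
     (let t = Suc (Suc n);
          s = largest {1..t} prec;
          G = ind_graph (Suc n)
                {(a, b). a \<in> {1..t - 1} \<and> b \<in> {1..t - 1} \<and> (psi s a, psi s b) \<in> prec}
      in \<lparr>verts = Cons True ` verts G \<union> Cons False ` verts G,
          vlabel = (\<lambda>w. if hd w then psi s (vlabel G (tl w)) else psi (s + 1) (vlabel G (tl w))),
          edges = {(Cons True ` e, psi s a) | e a. (e, a) \<in> edges G} \<union>
                  {(Cons False ` e, psi s a) | e a. (e, a) \<in> edges G} \<union>
                  {({True # v, False # v}, s) | v. v \<in> verts G \<and> psi s (vlabel G v) = s + 1}\<rparr>)"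

end

theory Submission
  imports Defs
begin

text \<open>A label \<open>a\<close> is the gap between the columns \<open>a\<close> and \<open>a + 1\<close>, and the entry of a block is the label
  of a gap between neighbouring columns that has survived all lower levels: when passing to the next
  level, gaps merge and the leftmost (to an odd level) or rightmost (to an even level) label survives.
  A label \<open>a\<close> dies exactly at the height of a column \<open>\<beta>(a)\<close>, which is the lowest column among those of
  even height seen from the gap on its left and those of odd height seen on its right.  Up to a
  constant, the coefficient of \<open>c\<^sub>a\<close> in \<open>f\<close> telescopes to \<open>r\<^sup>a\<^sup>+\<^sup>1 - r\<^sup>\<beta>\<close> with \<open>\<beta> = \<beta>(a)\<close>, so \<open>\<beta>\<close> plays the role of the
  functions \<open>f\<close>; it is invariant under all moves.

  A tableau is compatible iff every label precedes all labels that no column of height at least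
  \<open>h(\<beta>(a))\<close> separates from it.  For the largest label \<open>s\<close> this forces \<open>\<beta>(s) \<in> {s, s + 1}\<close>; deleting the
  column \<open>\<beta>(s)\<close> leaves a compatible diagram of smaller order, and conversely a column of suitable
  parity may be inserted at \<open>s\<close> or \<open>s + 1\<close>.  The two choices are the two copies of the smaller graph.
  Along an edge labelled \<open>a\<close> only \<open>\<beta>(a)\<close> changes, and its value at either end is the vertex label of
  the other end; this characterizes the edges of both graphs.\<close>

text \<open>Equivalence is generated by zigzags of moves, so membership in a class cannot be tested
  directly. Two devices replace such a test. The map \<open>stop\<close>, which encodes \<beta>, is
  constant on classes and distinguishes the classes built from different Boolean lists, which gives
  injectivity. For the induction, insertion of a column has to act on classes, but a new column may
  block a domino or prevent a row cancellation; adding two full rows beforehand repairs this. The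
  edges between the two copies come from a coincidence. Let column s of g be strongly extremal of
  odd height. A column one block lower, placed on its left and then topped by one block, gives the
  same diagram as a column of equal height placed on its right. Placing it on the left turns column
  s of g into column s + 1, hence the condition that the vertex label in the first copy is s + 1.
  The boundary conditions make \<beta>(a) exist: the highest columns on the two sides of a gap
  cannot both fail to be candidates.\<close>

section \<open>Diagrams and moves\<close>

text \<open>Boundary conditions, dominoes and strongly extremal columns for odd heights mirror those for
  even heights; \<open>side n\<close> is the direction that matters at height \<open>n\<close>.\<close>

definition side :: "nat \<Rightarrow> nat \<Rightarrow> nat \<Rightarrow> bool" where
  "side n k i \<longleftrightarrow> (if odd n then k < i else i < k)"

definition strictly_between :: "nat \<Rightarrow> nat \<Rightarrow> nat \<Rightarrow> bool" where
  "strictly_between l i k \<longleftrightarrow> i < l \<and> l < k \<or> k < l \<and> l < i"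

definition domino :: "nat \<Rightarrow> diagram \<Rightarrow> nat \<Rightarrow> nat \<Rightarrow> bool" where
  "domino t g i k \<longleftrightarrow> i \<in> cols t \<and> k \<in> cols t \<and> side (g i) k i \<and> g i + 2 \<le> g k \<and>
     (\<forall>l. strictly_between l i k \<longrightarrow> g l \<le> g i)"

definition is_se :: "nat \<Rightarrow> diagram \<Rightarrow> nat \<Rightarrow> bool" where
  "is_se t h j \<longleftrightarrow> j \<in> cols t \<and> (\<forall>k\<in>cols t. h k \<le> h j) \<and> (\<forall>k\<in>cols t. side (h j) k j \<longrightarrow> h k < h j)"

lemma nbr_left_exists:
  assumes "p \<in> cols t" "q \<in> cols t" "p < q" "n \<le> h p" "n \<le> h q"
  shows "\<exists>k. nbr t h n k q \<and> p \<le> k"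
proof -
  let ?S = "{k. p \<le> k \<and> k < q \<and> n \<le> h k}"
  have f: "finite ?S" and ne: "?S \<noteq> {}" using assms by auto
  let ?k = "Max ?S"
  have k: "?k \<in> ?S" using f ne Max_in by blast
  have "\<forall>l. ?k < l \<and> l < q \<longrightarrow> h l < n"
  proof (intro allI impI, rule ccontr)
    fix l assume l: "?k < l \<and> l < q" "\<not> h l < n"
    with k have "l \<in> ?S" by auto
    then have "l \<le> ?k" using f by (rule Max_ge[rotated])
    with l show False by simp
  qed
  moreover from k have "p \<le> ?k" "?k < q" "n \<le> h ?k" by auto
  ultimately have "nbr t h n ?k q" using assms unfolding nbr_def atLeastAtMost_iff by (intro conjI) (assumption | linarith)+
  with k show ?thesis by blast
qed

lemma nbr_right_exists:
  assumes "p \<in> cols t" "q \<in> cols t" "p < q" "n \<le> h p" "n \<le> h q"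
  shows "\<exists>k. nbr t h n p k \<and> k \<le> q"
proof -
  let ?S = "{k. p < k \<and> k \<le> q \<and> n \<le> h k}"
  have f: "finite ?S" and ne: "?S \<noteq> {}" using assms by auto
  let ?k = "Min ?S"
  have k: "?k \<in> ?S" using f ne Min_in by blast
  have "\<forall>l. p < l \<and> l < ?k \<longrightarrow> h l < n"
  proof (intro allI impI, rule ccontr)
    fix l assume l: "p < l \<and> l < ?k" "\<not> h l < n"
    with k have "l \<in> ?S" by auto
    then have "?k \<le> l" using f by (rule Min_le[rotated])
    with l show False by simp
  qed
  moreover from k have "p < ?k" "?k \<le> q" "n \<le> h ?k" by auto
  ultimately have "nbr t h n p ?k" using assms unfolding nbr_def atLeastAtMost_iff by (intro conjI) (assumption | linarith)+
  with k show ?thesis by blast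
qed

lemma nbr_unique_right: "nbr t h n p q \<Longrightarrow> nbr t h n p q' \<Longrightarrow> q = q'"
  unfolding nbr_def by (metis linorder_neqE_nat not_le)

lemma nbr_unique_left: "nbr t h n p q \<Longrightarrow> nbr t h n p' q \<Longrightarrow> p = p'"
  unfolding nbr_def by (metis linorder_neqE_nat not_le)

lemma left_extremal_iff:
  assumes "i \<in> cols t"
  shows "left_extremal t h i \<longleftrightarrow> (\<forall>k\<in>cols t. k < i \<longrightarrow> h k < h i)"
proof
  assume le: "left_extremal t h i"
  show "\<forall>k\<in>cols t. k < i \<longrightarrow> h k < h i"
  proof (intro ballI impI, rule ccontr)
    fix k assume "k \<in> cols t" "k < i" "\<not> h k < h i"
    then show False using nbr_left_exists[of k t i "h i" h] assms le unfolding left_extremal_def by auto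
  qed
qed (auto simp: left_extremal_def nbr_def)

lemma right_extremal_iff:
  assumes "i \<in> cols t"
  shows "right_extremal t h i \<longleftrightarrow> (\<forall>k\<in>cols t. i < k \<longrightarrow> h k < h i)"
proof
  assume le: "right_extremal t h i"
  show "\<forall>k\<in>cols t. i < k \<longrightarrow> h k < h i"
  proof (intro ballI impI, rule ccontr)
    fix k assume "k \<in> cols t" "i < k" "\<not> h k < h i"
    then show False using nbr_right_exists[of i t k "h i" h] assms le unfolding right_extremal_def by auto
  qed
qed (auto simp: right_extremal_def nbr_def)

lemma height_eq_iff:
  assumes "i \<in> cols t"
  shows "h i = height t h \<longleftrightarrow> (\<forall>k\<in>cols t. h k \<le> h i)"
proof -
  have "finite (h ` cols t)" "h i \<in> h ` cols t" using assms by auto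
  then show ?thesis unfolding height_def by (auto simp: eq_Max_iff)
qed

lemma height_eqI: "i \<in> cols t \<Longrightarrow> \<forall>k\<in>cols t. h k \<le> h i \<Longrightarrow> height t h = h i"
  using height_eq_iff by metis

text \<open>For a column of given parity one of the two boundary conditions is vacuous, so only
  extremality on the side selected by \<open>side\<close>, the decisive side, can force maximal
  height.\<close>

lemma diagrams_iff:
  "h \<in> diagrams t \<longleftrightarrow> (\<forall>i. i \<notin> cols t \<longrightarrow> h i = 0) \<and>
     (\<forall>i\<in>cols t. (\<forall>k\<in>cols t. side (h i) k i \<longrightarrow> h k < h i) \<longrightarrow> (\<forall>k\<in>cols t. h k \<le> h i))"
proof -
  have "(left_extremal t h i \<longrightarrow> even (h i) \<or> h i = height t h) \<and>
        (right_extremal t h i \<longrightarrow> odd (h i) \<or> h i = height t h) \<longleftrightarrow>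
        ((\<forall>k\<in>cols t. side (h i) k i \<longrightarrow> h k < h i) \<longrightarrow> (\<forall>k\<in>cols t. h k \<le> h i))" if "i \<in> cols t" for i
    unfolding left_extremal_iff[OF that] right_extremal_iff[OF that] height_eq_iff[OF that] side_def by auto
  then show ?thesis unfolding diagrams_def mem_Collect_eq by blast
qed

lemma diagrams_extremal:
  "h \<in> diagrams t \<Longrightarrow> i \<in> cols t \<Longrightarrow> (\<And>k. k \<in> cols t \<Longrightarrow> side (h i) k i \<Longrightarrow> h k < h i)
    \<Longrightarrow> k \<in> cols t \<Longrightarrow> h k \<le> h i"
  by (simp add: diagrams_iff)

text \<open>Both columns reach level \<open>g i + 2\<close>, and passing to a higher level only
  removes columns between them; so being neighbours at level \<open>g i + 1\<close> settles both
  levels.\<close>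

lemma domino_iff:
  "left_even_domino t g h \<or> right_odd_domino t g h \<longleftrightarrow> (\<exists>i k. domino t g i k \<and> h = g(i := g i + 2))"
proof
  assume "left_even_domino t g h \<or> right_odd_domino t g h"
  then show "\<exists>i k. domino t g i k \<and> h = g(i := g i + 2)"
  proof
    assume "left_even_domino t g h"
    then obtain i k where *: "i \<in> cols t" "h = g(i := g i + 2)" "even (g i)" "g i + 2 \<le> h k"
      "nbr t h (g i + 1) i k" unfolding left_even_domino_def by blast
    then have "domino t g i k" unfolding domino_def nbr_def side_def strictly_between_def by (auto simp: less_Suc_eq_le)
    with * show ?thesis by blast
  next
    assume "right_odd_domino t g h"
    then obtain i k where *: "i \<in> cols t" "h = g(i := g i + 2)" "odd (g i)" "g i + 2 \<le> h k"
      "nbr t h (g i + 1) k i" unfolding right_odd_domino_def by blast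
    then have "domino t g i k" unfolding domino_def nbr_def side_def strictly_between_def by (auto simp: less_Suc_eq_le)
    with * show ?thesis by blast
  qed
next
  assume "\<exists>i k. domino t g i k \<and> h = g(i := g i + 2)"
  then obtain i k where d: "domino t g i k" and h: "h = g(i := g i + 2)" by blast
  show "left_even_domino t g h \<or> right_odd_domino t g h"
  proof (cases "even (g i)")
    case True
    with d have "nbr t h (g i + 1) i k" "nbr t h (g i + 2) i k" "g i + 2 \<le> h k"
      unfolding h domino_def nbr_def side_def strictly_between_def by (fastforce simp: less_Suc_eq_le)+
    with True d h show ?thesis unfolding left_even_domino_def domino_def by blast
  next
    case False
    with d have "nbr t h (g i + 1) k i" "nbr t h (g i + 2) k i" "g i + 2 \<le> h k"
      unfolding h domino_def nbr_def side_def strictly_between_def by (fastforce simp: less_Suc_eq_le)+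
    with False d h show ?thesis unfolding right_odd_domino_def domino_def by blast
  qed
qed

lemma is_se_unique: "is_se t h j \<Longrightarrow> is_se t h k \<Longrightarrow> j = k"
  unfolding is_se_def side_def by (metis le_antisym less_irrefl linorder_neqE_nat)

lemma is_se_strongly_extremal: "is_se t h (strongly_extremal t h)"
proof -
  let ?S = "{i \<in> cols t. h i = height t h}"
  have f: "finite ?S" by simp
  have "height t h \<in> h ` cols t" unfolding height_def by (rule Max_in) auto
  then have ne: "?S \<noteq> {}" by auto
  have le: "h k \<le> height t h" if "k \<in> cols t" for k unfolding height_def using that by (intro Max_ge) auto
  show ?thesis
  proof (cases "odd (height t h)")
    case True
    then have e: "strongly_extremal t h = Min ?S" by (simp add: strongly_extremal_def)
    have m: "Min ?S \<in> ?S" using f ne Min_in by blast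
    have "\<And>k. k \<in> ?S \<Longrightarrow> Min ?S \<le> k" using f by simp
    then have "h k < h (Min ?S)" if "k \<in> cols t" "k < Min ?S" for k
      using m le[OF that(1)] that by (smt (verit) le_neq_implies_less leD mem_Collect_eq)
    moreover have "Min ?S \<in> cols t" "h (Min ?S) = height t h" using m by blast+
    ultimately show ?thesis using le True unfolding e is_se_def side_def by simp
  next
    case False
    then have e: "strongly_extremal t h = Max ?S" by (simp add: strongly_extremal_def)
    have m: "Max ?S \<in> ?S" using f ne Max_in by blast
    have "\<And>k. k \<in> ?S \<Longrightarrow> k \<le> Max ?S" using f by simp
    then have "h k < h (Max ?S)" if "k \<in> cols t" "Max ?S < k" for k
      using m le[OF that(1)] that by (smt (verit) le_neq_implies_less leD mem_Collect_eq)
    moreover have "Max ?S \<in> cols t" "h (Max ?S) = height t h" using m by blast+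
    ultimately show ?thesis using le False unfolding e is_se_def side_def by simp
  qed
qed

lemma strongly_extremal_eq_iff: "strongly_extremal t h = j \<longleftrightarrow> is_se t h j"
  using is_se_strongly_extremal is_se_unique by blast

lemma height_strongly_extremal: "height t h = h (strongly_extremal t h)"
  using is_se_strongly_extremal[of t h] by (auto simp: is_se_def intro!: height_eqI)

text \<open>Rows are nested, so equal cardinality means equality, and a column that lies in only the
  lower of two adjacent rows ends there.\<close>

lemma row_eq_iff:
  "card (row t g (i + 1)) = card (row t g (i + 2)) \<longleftrightarrow> (\<forall>k\<in>cols t. g k \<noteq> i + 1)"
proof -
  have fin: "finite (row t g (i + 1))" and sub: "row t g (i + 2) \<subseteq> row t g (i + 1)"
    unfolding row_def by auto
  have "card (row t g (i + 1)) = card (row t g (i + 2)) \<longleftrightarrow> row t g (i + 1) = row t g (i + 2)"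
    using card_subset_eq[OF fin sub] by auto
  also have "\<dots> \<longleftrightarrow> (\<forall>k\<in>cols t. g k \<noteq> i + 1)"
  proof
    assume e: "row t g (i + 1) = row t g (i + 2)"
    show "\<forall>k\<in>cols t. g k \<noteq> i + 1"
    proof
      fix k assume "k \<in> cols t"
      then have "i + 1 \<le> g k \<longleftrightarrow> i + 2 \<le> g k" using e unfolding row_def by blast
      then show "g k \<noteq> i + 1" by auto
    qed
  next
    assume *: "\<forall>k\<in>cols t. g k \<noteq> i + 1"
    have "i + 1 \<le> g k \<longleftrightarrow> i + 2 \<le> g k" if "k \<in> cols t" for k using * that by force
    then show "row t g (i + 1) = row t g (i + 2)" unfolding row_def by blast
  qed
  finally show ?thesis .
qed

definition cancel :: "nat \<Rightarrow> diagram \<Rightarrow> diagram" where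
  "cancel i g = (\<lambda>k. if i + 2 \<le> g k then g k - 2 else g k)"

lemma row_cancel_iff: "row_cancel t g h \<longleftrightarrow> (\<exists>i. (\<forall>k\<in>cols t. g k \<noteq> i + 1) \<and> h = cancel i g)"
  unfolding row_cancel_def row_eq_iff cancel_def ..

lemma half_domino_iff: "half_domino t g h \<longleftrightarrow> (\<exists>j. is_se t g j \<and> h = g(j := g j + 1))"
  unfolding half_domino_def using strongly_extremal_eq_iff[of t g] is_se_strongly_extremal by metis

lemma move_cases:
  assumes "move t g h"
  obtains (dom) i k where "domino t g i k" "h = g(i := g i + 2)"
  | (half) j where "is_se t g j" "h = g(j := g j + 1)"
  | (cancel) i where "\<forall>k\<in>cols t. g k \<noteq> i + 1" "h = cancel i g"
  using assms unfolding move_def row_cancel_iff half_domino_iff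
  using domino_iff[of t g h] by blast

text \<open>An extremal column of the new diagram is not \<open>i\<close>, since \<open>k\<close> on
  the decisive side is at least as high. It was therefore extremal in \<open>g\<close>, hence
  maximal there, and dominates \<open>k\<close> and with it the raised column.\<close>

lemma diagrams_domino:
  assumes g: "g \<in> diagrams t" and d: "domino t g i k"
  shows "g(i := g i + 2) \<in> diagrams t" (is "?h \<in> _")
  unfolding diagrams_iff
proof (intro conjI ballI allI impI)
  fix l assume "l \<notin> cols t" then show "?h l = 0" using g d by (auto simp: diagrams_iff domino_def)
next
  fix l m assume l: "l \<in> cols t" and ext: "\<forall>k\<in>cols t. side (?h l) k l \<longrightarrow> ?h k < ?h l" and m: "m \<in> cols t"
  have ki: "k \<noteq> i" using d unfolding domino_def by auto
  have "l \<noteq> i"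
  proof
    assume "l = i"
    then have "side (?h l) k l" using d unfolding domino_def side_def by auto
    with ext d \<open>l = i\<close> ki show False unfolding domino_def by auto
  qed
  then have "\<And>k. k \<in> cols t \<Longrightarrow> side (g l) k l \<Longrightarrow> g k < g l" using ext by (auto split: if_splits)
  then have *: "\<And>k. k \<in> cols t \<Longrightarrow> g k \<le> g l" using diagrams_extremal[OF g l] by blast
  from *[OF m] *[of k] d \<open>l \<noteq> i\<close> show "?h m \<le> ?h l" unfolding domino_def by auto
qed

text \<open>Heights \<open>i\<close> and \<open>i + 2\<close> collapse, but no order is reversed
  because height \<open>i + 1\<close> is absent, and parities are kept. So extremality after the
  cancellation implies extremality before.\<close>

lemma diagrams_cancel:
  assumes g: "g \<in> diagrams t" and d: "\<forall>k\<in>cols t. g k \<noteq> i + 1"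
  shows "cancel i g \<in> diagrams t"
  unfolding diagrams_iff
proof (intro conjI ballI allI impI)
  fix l assume "l \<notin> cols t" then show "cancel i g l = 0" using g by (auto simp: diagrams_iff cancel_def)
next
  fix l m assume l: "l \<in> cols t" and ext: "\<forall>k\<in>cols t. side (cancel i g l) k l \<longrightarrow> cancel i g k < cancel i g l"
    and m: "m \<in> cols t"
  have par: "side (cancel i g l) = side (g l)" unfolding side_def cancel_def by (auto simp: fun_eq_iff)
  have mono: "g k < g l" if "k \<in> cols t" "cancel i g k < cancel i g l" for k
  proof -
    have "g l \<noteq> i + 1" using d l by blast
    with that show ?thesis unfolding cancel_def by (auto split: if_splits)
  qed
  have "\<And>k. k \<in> cols t \<Longrightarrow> side (g l) k l \<Longrightarrow> g k < g l" using ext mono unfolding par by blast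
  then have "g m \<le> g l" using diagrams_extremal[OF g l] m by blast
  moreover have "g m \<noteq> i + 1" "g l \<noteq> i + 1" using d l m by auto
  ultimately show "cancel i g m \<le> cancel i g l" unfolding cancel_def by auto
qed

section \<open>Invariance of the strongly extremal column\<close>

lemma is_se_domino:
  assumes se: "is_se t g j" and d: "domino t g i k"
  shows "is_se t (g(i := g i + 2)) j"
proof -
  have ij: "i \<noteq> j" using assms unfolding is_se_def domino_def by force
  have max: "\<forall>l\<in>cols t. g l \<le> g j" using se unfolding is_se_def by blast
  have k: "k \<in> cols t" "g i + 2 \<le> g k" "side (g i) k i" using d unfolding domino_def by auto
  \<comment> \<open>Otherwise \<open>i\<close> is raised to the height of \<open>j\<close>; then
    \<open>k\<close> has that height too and, as \<open>g i\<close> and \<open>g j\<close> have the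
    same parity, lies on the decisive side of \<open>j\<close>.\<close>
  have "g i + 2 < g j" if "side (g j) i j"
  proof (rule ccontr)
    assume "\<not> g i + 2 < g j"
    with max k have e: "g j = g i + 2" "g k = g j" by force+
    then have "side (g j) k j" using k(3) that unfolding side_def by (auto split: if_splits)
    with se k(1) e show False unfolding is_se_def by auto
  qed
  moreover have "g i + 2 \<le> g j" using max k by force
  ultimately show ?thesis using se ij unfolding is_se_def by auto
qed

lemma is_se_half: "is_se t g j \<Longrightarrow> is_se t (g(j := g j + 1)) j"
  unfolding is_se_def side_def by (auto simp: le_Suc_eq less_Suc_eq_le)

text \<open>The danger is that \<open>j\<close> drops from \<open>i + 2\<close> to \<open>i\<close>
  and ties with a column of height \<open>i\<close> on its decisive side. The outermost such column
  would be extremal in \<open>g\<close> without being maximal, against the boundary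
  conditions.\<close>

lemma is_se_cancel:
  assumes g: "g \<in> diagrams t" and d: "\<forall>k\<in>cols t. g k \<noteq> i + 1" and se: "is_se t g j"
  shows "is_se t (cancel i g) j"
proof -
  have j: "j \<in> cols t" and max: "\<forall>l\<in>cols t. g l \<le> g j"
    and sd: "\<forall>l\<in>cols t. side (g j) l j \<longrightarrow> g l < g j" using se unfolding is_se_def by auto
  have le: "cancel i g l \<le> cancel i g j" if "l \<in> cols t" for l
    using max d j that unfolding cancel_def by force
  have lt: "cancel i g k < cancel i g j" if k: "k \<in> cols t" "side (g j) k j" for k
  proof (rule ccontr)
    assume n: "\<not> cancel i g k < cancel i g j"
    have "g k < g j" "g k \<noteq> i + 1" using k sd d by auto
    with n have gk: "g k = i" and gj: "g j = i + 2" unfolding cancel_def by (auto split: if_splits)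
    let ?S = "{l \<in> cols t. side (g j) l j \<and> g l = i}"
    have f: "finite ?S" and ne: "?S \<noteq> {}" using k gk by auto
    obtain m where m: "m \<in> ?S" "\<And>l. l \<in> ?S \<Longrightarrow> \<not> side i l m"
    proof (cases "odd i")
      case True
      have "\<not> side i l (Min ?S)" if "l \<in> ?S" for l
        using Min_le[OF f that] True unfolding side_def by simp
      with Min_in[OF f ne] show ?thesis by (rule that)
    next
      case False
      have "\<not> side i l (Max ?S)" if "l \<in> ?S" for l
        using Max_ge[OF f that] False unfolding side_def by simp
      with Max_in[OF f ne] show ?thesis by (rule that)
    qed
    have "g l < g m" if "l \<in> cols t" "side (g m) l m" for l
    proof -
      have "side (g j) l j" using m(1) that gj unfolding side_def by (auto split: if_splits)
      then have "g l < i + 2" "l \<in> ?S \<or> g l \<noteq> i" "g l \<noteq> i + 1" using sd that gj d by auto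
      moreover have "g m = i" "l \<notin> ?S" using m that by auto
      ultimately show ?thesis by linarith
    qed
    then have "g j \<le> g m" using diagrams_extremal[OF g, of m] m(1) j by blast
    with m gj show False by auto
  qed
  have "side (cancel i g j) = side (g j)" unfolding side_def cancel_def by (auto simp: fun_eq_iff)
  with j le lt show ?thesis unfolding is_se_def by auto
qed

lemma move_is_se:
  assumes m: "move t g h" and se: "is_se t g j"
  shows "is_se t h j"
  using m
proof (cases rule: move_cases)
  case (dom i k)
  then show ?thesis using is_se_domino[OF se] by simp
next
  case (half j')
  then show ?thesis using is_se_half is_se_unique se by blast
next
  case (cancel i)
  then show ?thesis using is_se_cancel se m unfolding move_def by blast
qed

lemma equiv_diagram_equiv: "equiv (diagrams t) (diagram_equiv t)"
  by (auto simp: diagram_equiv_def equiv_def refl_on_def sym_on_def trans_on_def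
      intro: equivclp_sym equivclp_trans)

lemma equivclp_invariant:
  assumes "equivclp r x y" and "\<And>x y. r x y \<Longrightarrow> P x \<longleftrightarrow> P y"
  shows "P x \<longleftrightarrow> P y"
  using assms(1) by (induction rule: equivclp_induct) (use assms(2) in auto)

lemma move_strongly_extremal: "move t g h \<Longrightarrow> strongly_extremal t g = strongly_extremal t h"
  using move_is_se strongly_extremal_eq_iff by metis

lemma diagram_equiv_strongly_extremal:
  assumes "(g, h) \<in> diagram_equiv t" shows "strongly_extremal t g = strongly_extremal t h"
proof -
  have "(strongly_extremal t g = j) \<longleftrightarrow> (strongly_extremal t h = j)" for j
    using assms unfolding diagram_equiv_def
    by (auto intro!: equivclp_invariant[of "move t" g h "\<lambda>g. strongly_extremal t g = j"] simp: move_strongly_extremal)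
  then show ?thesis by blast
qed

lemma move_equiv: "move t g h \<Longrightarrow> (g, h) \<in> diagram_equiv t"
  by (auto simp: diagram_equiv_def move_def r_into_equivclp)

section \<open>The column at which a label dies\<close>

text \<open>Gap \<open>a\<close> lies between columns \<open>a\<close> and \<open>a + 1\<close>; the
  two ranges for \<open>l\<close> list the columns in front of \<open>b\<close>, that is, between
  \<open>b\<close> and the gap. Ties with \<open>b\<close> are allowed here but not in
  \<open>candidate\<close>, so that the maximum of an interval qualifies without a choice among
  ties.\<close>

definition weak_candidate :: "nat \<Rightarrow> diagram \<Rightarrow> nat \<Rightarrow> nat \<Rightarrow> bool" where
  "weak_candidate t h a b \<longleftrightarrow> b \<in> cols t \<and> (if odd (h b) then a < b else b \<le> a) \<and>
     (\<forall>l. b < l \<and> l \<le> a \<or> a < l \<and> l < b \<longrightarrow> h l \<le> h b)"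

definition candidate :: "nat \<Rightarrow> diagram \<Rightarrow> nat \<Rightarrow> nat \<Rightarrow> bool" where
  "candidate t h a b \<longleftrightarrow> b \<in> cols t \<and> (if odd (h b) then a < b else b \<le> a) \<and>
     (\<forall>l. b < l \<and> l \<le> a \<or> a < l \<and> l < b \<longrightarrow> h l < h b)"

text \<open>\<open>stop t h a b\<close> says that \<open>b\<close> is the column \<open>\<beta>(a)\<close> at which the label \<open>a\<close> dies.\<close>

definition stop :: "nat \<Rightarrow> diagram \<Rightarrow> nat \<Rightarrow> nat \<Rightarrow> bool" where
  "stop t h a b \<longleftrightarrow> candidate t h a b \<and> (\<forall>b'. candidate t h a b' \<longrightarrow> h b \<le> h b')"

text \<open>Survival up to level \<open>n\<close> is phrased over all candidates, so that it can be
  used before a stop is known to exist.\<close>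

definition alive :: "nat \<Rightarrow> diagram \<Rightarrow> nat \<Rightarrow> nat \<Rightarrow> bool" where
  "alive t h a n \<longleftrightarrow> (\<forall>b. candidate t h a b \<longrightarrow> n \<le> h b)"

lemma candidate_weak_candidate: "candidate t h a b \<Longrightarrow> weak_candidate t h a b"
  unfolding candidate_def weak_candidate_def by (meson less_imp_le)

text \<open>Moving from \<open>b\<close> to a tied column in front of it keeps parity and side and
  comes closer to the gap; the process ends at a strict candidate.\<close>

lemma weak_candidate_candidate:
  assumes "weak_candidate t h a b" and a: "a \<le> t"
  shows "\<exists>b'. candidate t h a b' \<and> h b' = h b"
  using assms(1)
proof (induction "(b - a) + (a - b)" arbitrary: b rule: less_induct)
  case less
  show ?case
  proof (cases "candidate t h a b")
    case False
    with less.prems obtain l where l: "b < l \<and> l \<le> a \<or> a < l \<and> l < b" "h l = h b"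
      unfolding candidate_def weak_candidate_def by (metis le_neq_implies_less)
    have "weak_candidate t h a l" using less.prems l a unfolding weak_candidate_def by (auto split: if_splits)
    moreover have "(l - a) + (a - l) < (b - a) + (a - b)" using l(1) by auto
    ultimately show ?thesis using less.hyps[of l] l(2) by auto
  qed auto
qed

lemma candidate_same_height:
  assumes "candidate t h a b" "candidate t h a b'" "h b = h b'"
  shows "b = b'"
proof (rule ccontr)
  assume "b \<noteq> b'"
  then have "b < b' \<or> b' < b" by auto
  with assms show False unfolding candidate_def by (metis less_irrefl)
qed

lemma stop_unique: "stop t h a b \<Longrightarrow> stop t h a b' \<Longrightarrow> b = b'"
  unfolding stop_def using candidate_same_height by (metis le_antisym)

lemma stop_cols: "stop t h a b \<Longrightarrow> b \<in> cols t"
  unfolding stop_def candidate_def by blast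

lemma stop_weak_candidate: "stop t h a b \<Longrightarrow> a \<le> t \<Longrightarrow> weak_candidate t h a b' \<Longrightarrow> h b \<le> h b'"
  unfolding stop_def using weak_candidate_candidate by metis

lemma alive_iff: "stop t h a b \<Longrightarrow> alive t h a n \<longleftrightarrow> n \<le> h b"
  unfolding stop_def alive_def using order_trans by blast

lemma alive_mono: "alive t h a n \<Longrightarrow> m \<le> n \<Longrightarrow> alive t h a m"
  unfolding alive_def using order_trans by blast

lemma interval_max_left:
  fixes h :: "nat \<Rightarrow> nat"
  assumes "m \<le> n"
  obtains i where "m \<le> i" "i \<le> n" "\<And>k. m \<le> k \<Longrightarrow> k < i \<Longrightarrow> h k < h i" "\<And>k. m \<le> k \<Longrightarrow> k \<le> n \<Longrightarrow> h k \<le> h i"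
proof -
  let ?M = "Max (h ` {m..n})"
  have ge: "h k \<le> ?M" if "m \<le> k" "k \<le> n" for k using that by (intro Max_ge) auto
  have "?M \<in> h ` {m..n}" using assms by (intro Max_in) auto
  then obtain k where k: "m \<le> k \<and> k \<le> n \<and> h k = ?M" by (metis atLeastAtMost_iff imageE)
  define i where "i = (LEAST k. m \<le> k \<and> k \<le> n \<and> h k = ?M)"
  have i: "m \<le> i \<and> i \<le> n \<and> h i = ?M" unfolding i_def by (rule LeastI[of _ k]) (rule k)
  have least: "i \<le> l" if "m \<le> l \<and> l \<le> n \<and> h l = ?M" for l unfolding i_def by (rule Least_le) (rule that)
  show ?thesis
  proof (rule that[of i])
    fix l assume "m \<le> l" "l < i"
    then show "h l < h i" using ge[of l] least[of l] i by (metis le_neq_implies_less leD less_imp_le order_trans)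
  qed (use i ge in auto)
qed

lemma interval_max_right:
  fixes h :: "nat \<Rightarrow> nat"
  assumes "m \<le> n"
  obtains i where "m \<le> i" "i \<le> n" "\<And>k. k \<le> n \<Longrightarrow> i < k \<Longrightarrow> h k < h i" "\<And>k. m \<le> k \<Longrightarrow> k \<le> n \<Longrightarrow> h k \<le> h i"
proof -
  let ?M = "Max (h ` {m..n})"
  have ge: "h k \<le> ?M" if "m \<le> k" "k \<le> n" for k using that by (intro Max_ge) auto
  have "?M \<in> h ` {m..n}" using assms by (intro Max_in) auto
  then obtain k where k: "m \<le> k \<and> k \<le> n \<and> h k = ?M" by (metis atLeastAtMost_iff imageE)
  define P where "P = (\<lambda>k. m \<le> k \<and> k \<le> n \<and> h k = ?M)"
  define i where "i = Greatest P"
  have b: "\<And>y. P y \<Longrightarrow> y \<le> n" and Pk: "P k" using k unfolding P_def by auto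
  have i: "P i" unfolding i_def by (rule GreatestI_nat[where b = n]) (use Pk b in auto)
  have grt: "l \<le> i" if "P l" for l unfolding i_def by (rule Greatest_le_nat[where b = n]) (use that b in auto)
  show ?thesis
  proof (rule that[of i])
    fix l assume "l \<le> n" "i < l"
    moreover then have "m \<le> l" using i unfolding P_def by auto
    ultimately show "h l < h i" using ge[of l] grt[of l] i unfolding P_def by (metis le_neq_implies_less leD)
  qed (use i ge in \<open>auto simp: P_def\<close>)
qed

text \<open>The highest column on either side of the gap between columns \<open>a\<close> and \<open>a + 1\<close> is a
  candidate unless it is a global maximum; this is where the boundary conditions enter.\<close>

lemma left_maximum:
  assumes h: "h \<in> diagrams t" and a: "1 \<le> a" "a \<le> t"
  obtains i where "1 \<le> i" "i \<le> a" "\<forall>k. 1 \<le> k \<and> k \<le> a \<longrightarrow> h k \<le> h i"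
    "weak_candidate t h a i \<or> odd (h i) \<and> (\<forall>k\<in>cols t. h k \<le> h i)"
proof -
  obtain i where i: "1 \<le> i" "i \<le> a" "\<And>k. 1 \<le> k \<Longrightarrow> k < i \<Longrightarrow> h k < h i" "\<And>k. 1 \<le> k \<Longrightarrow> k \<le> a \<Longrightarrow> h k \<le> h i"
    using interval_max_left[OF a(1)] by metis
  have "weak_candidate t h a i \<or> odd (h i) \<and> (\<forall>k\<in>cols t. h k \<le> h i)"
  proof (cases "odd (h i)")
    case True
    then have "\<forall>k\<in>cols t. h k \<le> h i" using diagrams_extremal[OF h, of i] i a unfolding side_def by auto
    with True show ?thesis by blast
  next
    case False
    with i a show ?thesis unfolding weak_candidate_def by auto
  qed
  with i show ?thesis using that by blast
qed

lemma right_maximum: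
  assumes h: "h \<in> diagrams t" and a: "1 \<le> a" "a \<le> t"
  obtains i where "a < i" "i \<le> t + 1" "\<forall>k. a < k \<and> k \<le> t + 1 \<longrightarrow> h k \<le> h i"
    "weak_candidate t h a i \<or> even (h i) \<and> (\<forall>k\<in>cols t. h k \<le> h i)"
proof -
  have "a + 1 \<le> t + 1" using a by simp
  then obtain i where i: "a + 1 \<le> i" "i \<le> t + 1" "\<And>k. k \<le> t + 1 \<Longrightarrow> i < k \<Longrightarrow> h k < h i"
    "\<And>k. a + 1 \<le> k \<Longrightarrow> k \<le> t + 1 \<Longrightarrow> h k \<le> h i" using interval_max_right by metis
  have "weak_candidate t h a i \<or> even (h i) \<and> (\<forall>k\<in>cols t. h k \<le> h i)"
  proof (cases "even (h i)")
    case True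
    then have "\<forall>k\<in>cols t. h k \<le> h i" using diagrams_extremal[OF h, of i] i a unfolding side_def by auto
    with True show ?thesis by blast
  next
    case False
    with i a show ?thesis unfolding weak_candidate_def by auto
  qed
  with i show ?thesis using that[of i] by auto
qed

text \<open>If neither maximum were a candidate, both would be globally maximal and so of equal
  height, yet one odd and the other even.\<close>

lemma stop_exists:
  assumes h: "h \<in> diagrams t" and a: "1 \<le> a" "a \<le> t"
  shows "\<exists>b. stop t h a b"
proof -
  obtain i where i: "1 \<le> i" "i \<le> a" "weak_candidate t h a i \<or> odd (h i) \<and> (\<forall>k\<in>cols t. h k \<le> h i)"
    using left_maximum[OF assms] by metis
  obtain j where j: "a < j" "j \<le> t + 1" "weak_candidate t h a j \<or> even (h j) \<and> (\<forall>k\<in>cols t. h k \<le> h j)"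
    using right_maximum[OF assms] by metis
  have "i \<in> cols t" "j \<in> cols t" using i j a by auto
  with i j have "weak_candidate t h a i \<or> weak_candidate t h a j" by (metis le_antisym)
  then obtain b where b: "candidate t h a b" using weak_candidate_candidate a(2) by blast
  obtain b' where "candidate t h a b'" "\<forall>y. candidate t h a y \<longrightarrow> h b' \<le> h y"
    using ex_has_least_nat[of "candidate t h a" b h] b by blast
  then show ?thesis unfolding stop_def by blast
qed

text \<open>The left maximum is a weak candidate, hence not below the lowest one, or a global
  maximum. With its mirror image this shows that gap \<open>a\<close> still lies between two columns
  at level \<open>h c\<close>.\<close>

lemma stop_wall_left:
  assumes h: "h \<in> diagrams t" and a: "1 \<le> a" "a \<le> t" and s: "stop t h a c"
  shows "\<exists>p. 1 \<le> p \<and> p \<le> a \<and> h c \<le> h p"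
proof -
  obtain i where i: "1 \<le> i" "i \<le> a" "weak_candidate t h a i \<or> odd (h i) \<and> (\<forall>k\<in>cols t. h k \<le> h i)"
    using left_maximum[OF h a] by metis
  then show ?thesis using stop_weak_candidate[OF s a(2)] stop_cols[OF s] by blast
qed

lemma stop_wall_right:
  assumes h: "h \<in> diagrams t" and a: "1 \<le> a" "a \<le> t" and s: "stop t h a c"
  shows "\<exists>p. a < p \<and> p \<le> t + 1 \<and> h c \<le> h p"
proof -
  obtain i where i: "a < i" "i \<le> t + 1" "weak_candidate t h a i \<or> even (h i) \<and> (\<forall>k\<in>cols t. h k \<le> h i)"
    using right_maximum[OF h a] by metis
  then show ?thesis using stop_weak_candidate[OF s a(2)] stop_cols[OF s] by blast
qed

section \<open>Invariance of the stop under the moves\<close>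

text \<open>Nothing between \<open>i\<close> and the higher column \<open>k\<close> exceeds
  \<open>i\<close>. Hence if \<open>i\<close> becomes visible from the gap with the right parity, it
  was a weak candidate already (\<open>wi\<close>); and a rival of height \<open>g i + 1\<close>
  would have to stand strictly between \<open>i\<close> and \<open>k\<close>, where it is too
  high.\<close>

lemma stop_domino:
  assumes d: "domino t g i k" and a: "a \<le> t" and s: "stop t g a c"
  shows "stop t (g(i := g i + 2)) a c" (is "stop t ?h a c")
proof -
  have d': "i \<in> cols t" "k \<in> cols t" "side (g i) k i" "g i + 2 \<le> g k" "\<And>l. strictly_between l i k \<Longrightarrow> g l \<le> g i"
    using d unfolding domino_def by auto
  have c: "candidate t g a c" and min: "\<And>b. weak_candidate t g a b \<Longrightarrow> g c \<le> g b"
    using s stop_weak_candidate[OF s a] unfolding stop_def by auto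
  have odd_h: "odd (?h l) \<longleftrightarrow> odd (g l)" for l by simp
  have ge: "g l \<le> ?h l" for l by simp
  \<comment> \<open>Parity puts \<open>k\<close> and the gap on the same side of \<open>i\<close>,
    and \<open>k\<close> is too high to stand in front of \<open>i\<close>; so the columns from
    \<open>i\<close> to the gap lie strictly between \<open>i\<close> and \<open>k\<close>.\<close>
  have wi: "g c \<le> g i" if v: "\<And>l. i < l \<and> l \<le> a \<or> a < l \<and> l < i \<Longrightarrow> g l < g i + 2"
    and p: "if odd (g i) then a < i else i \<le> a"
  proof -
    have "\<not> (i < k \<and> k \<le> a \<or> a < k \<and> k < i)" using v[of k] d'(4) by auto
    then have "strictly_between l i k" if "i < l \<and> l \<le> a \<or> a < l \<and> l < i" for l
      using that d'(3) p unfolding strictly_between_def side_def by (cases "odd (g i)") (simp_all, linarith+)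
    then have "weak_candidate t g a i" using d' p unfolding weak_candidate_def by auto
    then show ?thesis by (rule min)
  qed
  have "candidate t ?h a c"
  proof (cases "c = i")
    case True
    then show ?thesis using c unfolding candidate_def by (auto simp: less_SucI)
  next
    case False
    have "g i + 2 < g c" if l: "c < i \<and> i \<le> a \<or> a < i \<and> i < c"
    proof (rule ccontr)
      assume n: "\<not> g i + 2 < g c"
      have gi: "g i < g c" using c l unfolding candidate_def by blast
      have nk: "\<not> (c < k \<and> k \<le> a \<or> a < k \<and> k < c)" using c d'(4) n unfolding candidate_def by force
      show False
      proof (cases "odd (g c) = odd (g i)")
        case True
        then have "if odd (g i) then a < i else i \<le> a" using l c unfolding candidate_def by (auto split: if_splits)
        moreover have "g l < g i + 2" if "i < l \<and> l \<le> a \<or> a < l \<and> l < i" for l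
        proof -
          have "c < l \<and> l \<le> a \<or> a < l \<and> l < c" using that l by auto
          then show ?thesis using c n unfolding candidate_def by force
        qed
        ultimately have "g c \<le> g i" by (intro wi)
        with gi show False by simp
      next
        case False
        \<comment> \<open>Opposite parity together with \<open>g i < g c\<close> and
          \<open>g c \<le> g i + 2\<close> leaves only this height.\<close>
        then have "g c = g i + 1" using gi n by presburger
        then have "k \<noteq> c" using d'(4) by auto
        have "strictly_between c i k" using False l c nk d'(3) \<open>k \<noteq> c\<close> unfolding candidate_def side_def strictly_between_def by (auto split: if_splits)
        then show False using d'(5) gi by force
      qed
    qed
    with c False show ?thesis unfolding candidate_def by auto
  qed
  moreover have "?h c \<le> ?h b" if b: "candidate t ?h a b" for b
  proof (cases "b = i")
    case True
    have "g c \<le> g i"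
    proof (rule wi)
      show "if odd (g i) then a < i else i \<le> a" using b True unfolding candidate_def by (auto split: if_splits)
      fix l assume "i < l \<and> l \<le> a \<or> a < l \<and> l < i"
      then show "g l < g i + 2" using b True unfolding candidate_def by (metis fun_upd_apply less_irrefl)
    qed
    with True show ?thesis by auto
  next
    case False
    then have cb: "candidate t g a b" using b ge unfolding candidate_def odd_h
      by (metis fun_upd_apply le_less_trans)
    then have le: "g c \<le> g b" by (intro min candidate_weak_candidate)
    show ?thesis
    proof (cases "c = i")
      case True
      have "g b \<noteq> g i" using candidate_same_height[OF cb c] True False by auto
      moreover have "g b \<noteq> g i + 1"
      proof
        assume gb: "g b = g i + 1"
        then have "k \<noteq> b" using d'(4) by auto
        have "\<not> (b < k \<and> k \<le> a \<or> a < k \<and> k < b)" using cb d'(4) gb unfolding candidate_def by force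
        moreover have "\<not> (i < k \<and> k \<le> a \<or> a < k \<and> k < i)" using c True d'(4) unfolding candidate_def by force
        moreover have "odd (g b) \<noteq> odd (g i)" using gb by simp
        ultimately have "strictly_between b i k" using cb c True \<open>k \<noteq> b\<close> d'(3)
          unfolding candidate_def side_def strictly_between_def by (auto split: if_splits)
        then show False using d'(5) gb by force
      qed
      ultimately show ?thesis using le True False by auto
    next
      case False
      with \<open>b \<noteq> i\<close> le show ?thesis by simp
    qed
  qed
  ultimately show ?thesis unfolding stop_def by blast
qed

text \<open>Beyond the gap, as seen from \<open>c\<close>, stands a column at least as high, and
  this is the side on which a strongly extremal column of that parity must dominate
  strictly.\<close>

lemma stop_not_se:
  assumes g: "g \<in> diagrams t" and a: "1 \<le> a" "a \<le> t" and s: "stop t g a c"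
  shows "\<not> is_se t g c"
proof
  assume se: "is_se t g c"
  have c: "if odd (g c) then a < c else c \<le> a" using s unfolding stop_def candidate_def by auto
  show False
  proof (cases "odd (g c)")
    case True
    obtain p where "1 \<le> p" "p \<le> a" "g c \<le> g p" using stop_wall_left[OF assms] by blast
    moreover from this have "p \<in> cols t" "side (g c) p c" using True c a unfolding side_def by auto
    ultimately show False using se unfolding is_se_def by force
  next
    case False
    obtain p where "a < p" "p \<le> t + 1" "g c \<le> g p" using stop_wall_right[OF assms] by blast
    moreover from this have "p \<in> cols t" "side (g c) p c" using False c a unfolding side_def by auto
    ultimately show False using se unfolding is_se_def by force
  qed
qed

text \<open>The raised column is a global maximum different from \<open>c\<close>, so it neither
  stands in front of \<open>c\<close> nor undercuts it as a candidate.\<close>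

lemma stop_half:
  assumes g: "g \<in> diagrams t" and a: "1 \<le> a" "a \<le> t" and se: "is_se t g j" and s: "stop t g a c"
  shows "stop t (g(j := g j + 1)) a c" (is "stop t ?h a c")
proof -
  have cj: "c \<noteq> j" using stop_not_se[OF g a s] se by blast
  have c: "candidate t g a c" and min: "\<And>b. candidate t g a b \<Longrightarrow> g c \<le> g b" using s unfolding stop_def by auto
  have max: "\<And>k. k \<in> cols t \<Longrightarrow> g k \<le> g j" using se unfolding is_se_def by blast
  have "g c \<le> g j" using max c unfolding candidate_def by blast
  then have "\<not> (c < j \<and> j \<le> a \<or> a < j \<and> j < c)" using c unfolding candidate_def by force
  then have "candidate t ?h a c" using c cj unfolding candidate_def by auto
  moreover have "?h c \<le> ?h b" if b: "candidate t ?h a b" for b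
  proof (cases "b = j")
    case True
    then show ?thesis using \<open>g c \<le> g j\<close> cj by auto
  next
    case False
    then have e: "?h b = g b" by simp
    have lt: "g l < g b" if "?h l < ?h b" for l using that e by (cases "l = j") auto
    have "candidate t g a b" using b lt unfolding candidate_def e by blast
    then show ?thesis using min False cj by auto
  qed
  ultimately show ?thesis unfolding stop_def by blast
qed

text \<open>Only heights \<open>i\<close> and \<open>i + 2\<close> merge. If \<open>c\<close> had
  height \<open>i + 2\<close> and a column of height \<open>i\<close> stood in front of it, that
  column would have the same parity and side and would be a lower weak candidate.\<close>

lemma stop_cancel:
  assumes a: "1 \<le> a" "a \<le> t" and d: "\<forall>k\<in>cols t. g k \<noteq> i + 1" and s: "stop t g a c"
  shows "stop t (cancel i g) a c" (is "stop t ?h a c")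
proof -
  have c: "candidate t g a c" and min: "\<And>b. weak_candidate t g a b \<Longrightarrow> g c \<le> g b"
    using s stop_weak_candidate[OF s a(2)] unfolding stop_def by auto
  have odd_h: "odd (?h l) \<longleftrightarrow> odd (g l)" for l unfolding cancel_def by auto
  have lt: "g l < g m" if "?h l < ?h m" "m \<in> cols t" for l m
  proof -
    have "g m \<noteq> i + 1" using d that(2) by blast
    with that(1) show ?thesis unfolding cancel_def by (auto split: if_splits)
  qed
  have le: "?h l \<le> ?h m" if "g l \<le> g m" "l \<in> cols t" for l m
  proof -
    have "g l \<noteq> i + 1" using d that(2) by blast
    with that(1) show ?thesis unfolding cancel_def by (auto split: if_splits)
  qed
  have cc: "c \<in> cols t" using c unfolding candidate_def by blast
  have "candidate t ?h a c" unfolding candidate_def odd_h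
  proof (intro conjI allI impI)
    show "c \<in> cols t" "if odd (g c) then a < c else c \<le> a" using c unfolding candidate_def by auto
    fix l assume l: "c < l \<and> l \<le> a \<or> a < l \<and> l < c"
    then have lc: "l \<in> cols t" using cc a by auto
    have gl: "g l < g c" using c l unfolding candidate_def by blast
    show "?h l < ?h c"
    proof (rule ccontr)
      assume "\<not> ?h l < ?h c"
      then have e: "g l = i" "g c = i + 2" using gl d lc cc unfolding cancel_def by (force split: if_splits)+
      have "g m \<le> g l" if m: "l < m \<and> m \<le> a \<or> a < m \<and> m < l" for m
      proof -
        have m': "c < m \<and> m \<le> a \<or> a < m \<and> m < c" using m l by auto
        then have "m \<in> cols t" "g m < g c" using cc a c unfolding candidate_def by auto
        with d e show ?thesis by force
      qed
      moreover have "odd (g l) \<longleftrightarrow> odd (g c)" using e by simp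
      then have "if odd (g l) then a < l else l \<le> a" using l c unfolding candidate_def by (auto split: if_splits)
      ultimately have "weak_candidate t g a l" using lc unfolding weak_candidate_def by blast
      with min gl show False by force
    qed
  qed
  moreover have "?h c \<le> ?h b" if b: "candidate t ?h a b" for b
  proof -
    have "b \<in> cols t" using b unfolding candidate_def by blast
    then have "candidate t g a b" using b lt unfolding candidate_def odd_h by blast
    then show ?thesis using le[OF min[OF candidate_weak_candidate] cc] by blast
  qed
  ultimately show ?thesis unfolding stop_def by blast
qed

lemma stop_move_imp:
  assumes m: "move t g h" and a: "1 \<le> a" "a \<le> t" and s: "stop t g a c"
  shows "stop t h a c"
  using m
proof (cases rule: move_cases)
  case (dom i k)
  then show ?thesis using stop_domino[OF _ a(2) s] by simp
next
  case (half j)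
  then show ?thesis using stop_half[OF _ a _ s] m unfolding move_def by blast
next
  case (cancel i)
  then show ?thesis using stop_cancel[OF a _ s] by blast
qed

text \<open>Moves are directed; the converse follows from existence of the stop before the move and
  its uniqueness afterwards.\<close>

lemma stop_move:
  assumes m: "move t g h" and a: "1 \<le> a" "a \<le> t"
  shows "stop t g a c \<longleftrightarrow> stop t h a c"
  using stop_move_imp[OF assms] stop_exists[of g t a] stop_unique m a unfolding move_def by metis

lemma stop_equiv:
  assumes "(g, h) \<in> diagram_equiv t" and a: "1 \<le> a" "a \<le> t"
  shows "stop t g a c \<longleftrightarrow> stop t h a c"
  using assms(1) unfolding diagram_equiv_def
  by (auto intro!: equivclp_invariant[of "move t" g h "\<lambda>g. stop t g a c"] simp: stop_move[OF _ a])

section \<open>Entries and compatibility\<close>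

text \<open>Labels are attached to gaps between neighbours instead of blocks, so that the block
  carrying the entry, left for odd and right for even levels, matters only in
  \<open>entry_gap_label\<close>.\<close>

definition gap_label :: "nat \<Rightarrow> diagram \<Rightarrow> nat \<Rightarrow> nat \<Rightarrow> nat \<Rightarrow> nat \<Rightarrow> bool" where
  "gap_label t h n p q a \<longleftrightarrow> nbr t h n p q \<and> p \<le> a \<and> a < q \<and> alive t h a n"

lemma alive_weak_candidate: "alive t h a n \<Longrightarrow> a \<le> t \<Longrightarrow> weak_candidate t h a b \<Longrightarrow> n \<le> h b"
  unfolding alive_def using weak_candidate_candidate by metis

lemma gap_label_le: "gap_label t h n p q a \<Longrightarrow> 1 \<le> a \<and> a \<le> t"
  unfolding gap_label_def nbr_def by auto

lemma nbr_descend_even: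
  assumes "nbr t h (Suc n) p q" "nbr t h n p p'"
  shows "p' \<le> q \<and> (\<forall>l. p < l \<and> l < q \<longrightarrow> h l \<le> n)"
  using assms unfolding nbr_def by (metis Suc_leD less_Suc_eq_le not_le)

text \<open>A label dying at an even level \<open>n\<close> needs a column of height
  \<open>n\<close> on its left. In the leftmost of the merging gaps there is none, and
  \<open>p\<close>, being higher than \<open>n\<close>, hides those further left.\<close>

lemma gap_label_up_even:
  assumes n: "even n" and pq: "nbr t h (Suc n) p q" and l: "gap_label t h n p p' a"
  shows "gap_label t h (Suc n) p q a"
proof -
  have l': "nbr t h n p p'" "p \<le> a" "a < p'" "alive t h a n" using l unfolding gap_label_def by auto
  have p': "p' \<le> q" using nbr_descend_even[OF pq l'(1)] by blast
  have "Suc n \<le> h b" if b: "candidate t h a b" for b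
  proof (rule ccontr)
    assume "\<not> Suc n \<le> h b"
    with l'(4) b have hb: "h b = n" unfolding alive_def by force
    then have "b \<le> a" using b n unfolding candidate_def by auto
    have "Suc n \<le> h p" using pq unfolding nbr_def by blast
    have "\<not> (b < p \<and> p \<le> a)" using b hb \<open>Suc n \<le> h p\<close> unfolding candidate_def by force
    then have "p < b" using l'(2) \<open>b \<le> a\<close> hb \<open>Suc n \<le> h p\<close> by (cases "b = p") auto
    moreover have "b < p'" using l'(3) \<open>b \<le> a\<close> by simp
    ultimately have "h b < n" using l'(1) unfolding nbr_def by blast
    with hb show False by simp
  qed
  with pq l' p' show ?thesis unfolding gap_label_def alive_def by auto
qed

lemma gap_label_up_odd:
  assumes n: "odd n" and pq: "nbr t h (Suc n) p q" and l: "gap_label t h n q' q a"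
  shows "gap_label t h (Suc n) p q a"
proof -
  have l': "nbr t h n q' q" "q' \<le> a" "a < q" "alive t h a n" using l unfolding gap_label_def by auto
  have p': "p \<le> q'"
  proof (rule ccontr)
    assume "\<not> p \<le> q'"
    with pq l'(1) show False unfolding nbr_def by (meson Suc_leD not_le)
  qed
  have "Suc n \<le> h b" if b: "candidate t h a b" for b
  proof (rule ccontr)
    assume "\<not> Suc n \<le> h b"
    with l'(4) b have hb: "h b = n" unfolding alive_def by force
    then have "a < b" using b n unfolding candidate_def by auto
    have hq: "Suc n \<le> h q" using pq unfolding nbr_def by blast
    have "\<not> (a < q \<and> q < b)" using b hb hq unfolding candidate_def by force
    then have "b < q" using l'(3) hb hq by (cases "b = q") auto
    moreover have "q' < b" using l'(2) \<open>a < b\<close> by simp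
    ultimately have "h b < n" using l'(1) unfolding nbr_def by blast
    with hb show False by simp
  qed
  with pq l' p' show ?thesis unfolding gap_label_def alive_def by auto
qed

text \<open>If \<open>a\<close> lay beyond \<open>p'\<close>, then \<open>p'\<close> would have
  height exactly \<open>n\<close> and be a weak candidate of even height on the left of
  \<open>a\<close>, so \<open>a\<close> would have died at level \<open>n\<close>.\<close>

lemma gap_label_down_even:
  assumes n: "even n" and l: "gap_label t h (Suc n) p q a" and p': "nbr t h n p p'"
  shows "gap_label t h n p p' a"
proof -
  have l': "nbr t h (Suc n) p q" "p \<le> a" "a < q" "alive t h a (Suc n)" using l unfolding gap_label_def by auto
  note d = nbr_descend_even[OF l'(1) p']
  have "a < p'"
  proof (rule ccontr)
    assume a: "\<not> a < p'"
    have hp: "h p' = n" using d a l' p' unfolding nbr_def by (metis le_antisym le_less_trans not_le)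
    have "h l \<le> h p'" if "p' < l \<and> l \<le> a" for l
      using d that l'(3) p' hp unfolding nbr_def by auto
    then have "weak_candidate t h a p'" using a n hp p' unfolding weak_candidate_def nbr_def by auto
    then show False using alive_weak_candidate[OF l'(4)] gap_label_le[OF l] hp by force
  qed
  with l' p' show ?thesis unfolding gap_label_def by (auto intro: alive_mono)
qed

lemma gap_label_down_odd:
  assumes n: "odd n" and l: "gap_label t h (Suc n) p q a" and q': "nbr t h n q' q"
  shows "gap_label t h n q' q a"
proof -
  have l': "nbr t h (Suc n) p q" "p \<le> a" "a < q" "alive t h a (Suc n)" using l unfolding gap_label_def by auto
  have pq': "p \<le> q'"
  proof (rule ccontr)
    assume "\<not> p \<le> q'"
    with q' l'(1) show False unfolding nbr_def by (meson Suc_leD not_le)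
  qed
  have d: "\<forall>l. p < l \<and> l < q \<longrightarrow> h l \<le> n" using l'(1) unfolding nbr_def by (simp add: less_Suc_eq_le)
  have "q' \<le> a"
  proof (rule ccontr)
    assume a: "\<not> q' \<le> a"
    have hp: "h q' = n" using d a l' q' unfolding nbr_def by (metis le_antisym le_less_trans not_le)
    have "h l \<le> h q'" if "a < l \<and> l < q'" for l
      using d that l'(2) q' hp unfolding nbr_def by auto
    then have "weak_candidate t h a q'" using a n hp q' unfolding weak_candidate_def nbr_def by auto
    then show False using alive_weak_candidate[OF l'(4)] gap_label_le[OF l] hp by force
  qed
  with l' q' show ?thesis unfolding gap_label_def by (auto intro: alive_mono)
qed

lemma nbr_mono_right:
  assumes "nbr t h (Suc n) p q" obtains p' where "nbr t h n p p'" "p' \<le> q"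
  using nbr_right_exists[of p t q n h] assms unfolding nbr_def by (metis Suc_leD)

lemma nbr_mono_left:
  assumes "nbr t h (Suc n) p q" obtains q' where "nbr t h n q' q" "p \<le> q'"
  using nbr_left_exists[of p t q n h] assms unfolding nbr_def by (metis Suc_leD)

lemma gap_label_exists: "nbr t h n p q \<Longrightarrow> \<exists>a. gap_label t h n p q a"
proof (induction n arbitrary: p q)
  case 0
  then have "gap_label t h 0 p q p" unfolding gap_label_def alive_def nbr_def by auto
  then show ?case by blast
next
  case (Suc n)
  show ?case
  proof (cases "even n")
    case True
    obtain p' where "nbr t h n p p'" using nbr_mono_right[OF Suc.prems] by blast
    then show ?thesis using Suc gap_label_up_even[OF True Suc.prems] by blast
  next
    case False
    obtain q' where "nbr t h n q' q" using nbr_mono_left[OF Suc.prems] by blast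
    then show ?thesis using Suc gap_label_up_odd[OF False Suc.prems] by blast
  qed
qed

lemma not_extremal_block:
  assumes "nbr t h n p q"
  shows "\<not> extremal_block t h (if odd n then p else q) n" "(if odd n then p else q) \<in> row t h n"
proof -
  have r: "p \<in> row t h n" "q \<in> row t h n" "p < q" "finite (row t h n)" using assms unfolding nbr_def row_def by auto
  have "q \<le> Max (row t h n)" "Min (row t h n) \<le> p" using r Max_ge Min_le by blast+
  with r(3) have "p \<noteq> Max (row t h n)" "q \<noteq> Min (row t h n)" by linarith+
  with r show "\<not> extremal_block t h (if odd n then p else q) n" "(if odd n then p else q) \<in> row t h n"
    unfolding extremal_block_def by presburger+
qed

text \<open>The recursion for entries descends into the subgap whose label survives: the leftmost
  one below an odd level, the rightmost one below an even level.\<close>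

lemma entry_gap_label: "gap_label t h n p q a \<Longrightarrow> entry t h (if odd n then p else q) n = a"
proof (induction n arbitrary: p q)
  case 0
  then have *: "nbr t h 0 p q" "p \<le> a" "a < q" unfolding gap_label_def by auto
  then have "q = Suc p" unfolding nbr_def by (metis Suc_lessI lessI not_less0)
  with * show ?case by auto
next
  case (Suc n)
  have pq: "nbr t h (Suc n) p q" using Suc.prems unfolding gap_label_def by blast
  note ne = not_extremal_block[OF pq]
  show ?case
  proof (cases n)
    \<comment> \<open>Level 1 has its own clause in \<open>entry\<close>; the value
      \<open>i - 1\<close> at level 0 makes it agree with the general recursion.\<close>
    case 0
    obtain p' where p': "nbr t h n p p'" using nbr_mono_right[OF pq] by blast
    have "gap_label t h n p p' a" using gap_label_down_even[OF _ Suc.prems p'] 0 by simp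
    from Suc.IH[OF this] 0 have "p' - 1 = a" by simp
    moreover have "p' = Suc p" using p' 0 unfolding nbr_def by (metis Suc_lessI lessI not_less0)
    ultimately show ?thesis using ne 0 by simp
  next
    case (Suc m)
    show ?thesis
    proof (cases "even n")
      case True
      obtain p' where p': "nbr t h n p p'" using nbr_mono_right[OF pq] by blast
      then have "(THE k. nbr t h n p k) = p'" using nbr_unique_right by blast
      moreover have "entry t h p' n = a" using Suc.IH[OF gap_label_down_even[OF True Suc.prems p']] True by simp
      ultimately show ?thesis using ne True Suc by (simp add: Let_def)
    next
      case False
      obtain q' where q': "nbr t h n q' q" using nbr_mono_left[OF pq] by blast
      then have "(THE k. nbr t h n k q) = q'" using nbr_unique_left by blast
      moreover have "entry t h q' n = a" using Suc.IH[OF gap_label_down_odd[OF False Suc.prems q']] False by simp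
      ultimately show ?thesis using ne False Suc by (simp add: Let_def)
    qed
  qed
qed

text \<open>All labels of a gap are values of \<open>entry\<close> at the same block.\<close>

lemma gap_label_unique: "gap_label t h n p q a \<Longrightarrow> gap_label t h n p q b \<Longrightarrow> a = b"
  using entry_gap_label by metis

section \<open>Compatibility as a condition on stops\<close>

text \<open>The range for \<open>l\<close> lists the columns between gaps \<open>a\<close> and
  \<open>b\<close>. No levels occur in this form, only the height of a stop, which is what allows it
  to be carried through the insertion of a column.\<close>

definition min_prop :: "nat \<Rightarrow> nat rel \<Rightarrow> diagram \<Rightarrow> bool" where
  "min_prop t prec h \<longleftrightarrow> (\<forall>a b c. 1 \<le> a \<and> a \<le> t \<and> 1 \<le> b \<and> b \<le> t \<and> a \<noteq> b \<and> stop t h a c \<and>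
     (\<forall>l. min a b < l \<and> l \<le> max a b \<longrightarrow> h l < h c) \<longrightarrow> (a, b) \<in> prec)"

lemma gap_exists:
  assumes "p \<in> cols t" "q \<in> cols t" "n \<le> h p" "n \<le> h q" "p \<le> b" "b < q"
  obtains p' q' where "nbr t h n p' q'" "p' \<le> b" "b < q'" "p \<le> p'" "q' \<le> q"
proof -
  let ?L = "{l. p \<le> l \<and> l \<le> b \<and> n \<le> h l}" and ?R = "{l. b < l \<and> l \<le> q \<and> n \<le> h l}"
  have f: "finite ?L" "finite ?R" by auto
  have ne: "?L \<noteq> {}" "?R \<noteq> {}" using assms by auto
  have L: "Max ?L \<in> ?L" "\<And>l. l \<in> ?L \<Longrightarrow> l \<le> Max ?L" using Max_in[OF f(1) ne(1)] Max_ge[OF f(1)] by blast+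
  have R: "Min ?R \<in> ?R" "\<And>l. l \<in> ?R \<Longrightarrow> Min ?R \<le> l" using Min_in[OF f(2) ne(2)] Min_le[OF f(2)] by blast+
  have "h l < n" if "Max ?L < l" "l < Min ?R" for l
  proof (rule ccontr)
    assume n: "\<not> h l < n"
    have "l \<in> ?L \<or> l \<in> ?R" using that L(1) R(1) n by auto
    with L(2)[of l] R(2)[of l] that show False by (meson leD)
  qed
  moreover have "Max ?L \<in> cols t" "Min ?R \<in> cols t" "Max ?L < Min ?R" using L(1) R(1) assms(1,2) by auto
  ultimately have "nbr t h n (Max ?L) (Min ?R)" using L(1) R(1) unfolding nbr_def by blast
  with that[of "Max ?L" "Min ?R"] L(1) R(1) show ?thesis by blast
qed

text \<open>The generating relations compare adjacent levels only. One level down, \<open>b\<close>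
  lies in a subgap with some label \<open>c'\<close>; \<open>a\<close> equals or precedes
  \<open>c'\<close> by such a relation, \<open>c'\<close> equals or precedes \<open>b\<close> by
  induction, and transitivity joins the two.\<close>

lemma compatible_gap_label:
  assumes tr: "trans prec" and c: "compatible t prec h"
  shows "gap_label t h n p q a \<Longrightarrow> p \<le> b \<Longrightarrow> b < q \<Longrightarrow> b \<noteq> a \<Longrightarrow> (a, b) \<in> prec"
proof (induction n arbitrary: p q a b)
  case 0
  then have "nbr t h 0 p q" "p \<le> a" "a < q" unfolding gap_label_def by auto
  then have "q = Suc p" unfolding nbr_def by (metis Suc_lessI lessI not_less0)
  with 0 \<open>p \<le> a\<close> \<open>a < q\<close> show ?case by auto
next
  case (Suc n)
  have pq: "nbr t h (Suc n) p q" using Suc.prems unfolding gap_label_def by blast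
  have between: "h l = n" if "n \<le> h l" "p < l" "l < q" for l using pq that unfolding nbr_def by fastforce
  obtain l' l where l: "nbr t h n l' l" "l' \<le> b" "b < l" "p \<le> l'" "l \<le> q"
    using gap_exists[OF _ _ _ _ Suc.prems(2,3), of t n h] pq unfolding nbr_def by auto
  obtain c' where c': "gap_label t h n l' l c'" using gap_label_exists[OF l(1)] by blast
  have fin: "(a, b) \<in> prec" if "(a, c') \<in> prec"
  proof (cases "c' = b")
    case False
    then have "(c', b) \<in> prec" using Suc.IH[OF c' l(2,3)] by simp
    with that tr show ?thesis by (meson transD)
  qed (use that in simp)
  show ?case
  proof (cases "even n")
    case True
    obtain p' where p': "nbr t h n p p'" using nbr_mono_right[OF pq] by blast
    have lp: "gap_label t h n p p' a" by (rule gap_label_down_even[OF True Suc.prems(1) p'])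
    show ?thesis
    proof (cases "l = p'")
      case True
      then have "l' = p" using l(1) p' nbr_unique_left by blast
      then show ?thesis using Suc.IH[OF lp] True l Suc.prems by blast
    next
      case False
      have e: "entry t h p (Suc n) = a" "entry t h l n = c'"
        using entry_gap_label[OF Suc.prems(1)] entry_gap_label[OF c'] True by auto
      have "l = q \<or> p < l \<and> l < q \<and> h l = n" using between l unfolding nbr_def by auto
      then have "(entry t h p (Suc n), entry t h l (Suc n - 1)) \<in> order_relations t h"
        unfolding order_relations_def using pq p' False True
        by (intro UnI2 CollectI exI[of _ "Suc n"] exI[of _ p] exI[of _ p'] exI[of _ q] exI[of _ l]) auto
      then show ?thesis using c fin e unfolding compatible_def by auto
    qed
  next
    case False
    obtain q' where q': "nbr t h n q' q" using nbr_mono_left[OF pq] by blast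
    have lq: "gap_label t h n q' q a" by (rule gap_label_down_odd[OF False Suc.prems(1) q'])
    show ?thesis
    proof (cases "l' = q'")
      case True
      then have "l = q" using l(1) q' nbr_unique_right by blast
      then show ?thesis using Suc.IH[OF lq] True l Suc.prems by blast
    next
      case ne: False
      have e: "entry t h q (Suc n) = a" "entry t h l' n = c'"
        using entry_gap_label[OF Suc.prems(1)] entry_gap_label[OF c'] False by auto
      have "l' = p \<or> p < l' \<and> l' < q \<and> h l' = n" using between l unfolding nbr_def by auto
      then have "(entry t h q (Suc n), entry t h l' (Suc n - 1)) \<in> order_relations t h"
        unfolding order_relations_def using pq q' False ne
        by (intro UnI1 CollectI exI[of _ "Suc n"] exI[of _ p] exI[of _ q'] exI[of _ q] exI[of _ l']) auto
      then show ?thesis using c fin e unfolding compatible_def by auto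
    qed
  qed
qed

text \<open>The walls place \<open>a\<close> in a gap at level \<open>h c\<close>, where it is still
  alive. No column of that height separates \<open>b\<close> from \<open>a\<close>, so
  \<open>b\<close> lies in the same gap.\<close>

lemma compatible_min_prop:
  assumes h: "h \<in> diagrams t" and tr: "trans prec" and c: "compatible t prec h"
  shows "min_prop t prec h"
  unfolding min_prop_def
proof (intro allI impI, elim conjE)
  fix a b c
  assume a: "1 \<le> a" "a \<le> t" and b: "1 \<le> b" "b \<le> t" "a \<noteq> b" and s: "stop t h a c"
    and sep: "\<forall>l. min a b < l \<and> l \<le> max a b \<longrightarrow> h l < h c"
  obtain p where p: "1 \<le> p" "p \<le> a" "h c \<le> h p" using stop_wall_left[OF h a s] by blast
  obtain q where q: "a < q" "q \<le> t + 1" "h c \<le> h q" using stop_wall_right[OF h a s] by blast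
  obtain p' q' where n: "nbr t h (h c) p' q'" "p' \<le> a" "a < q'"
    by (rule gap_exists[of p t q "h c" h a]) (use p q a in auto)
  have "gap_label t h (h c) p' q' a" using n alive_iff[OF s] unfolding gap_label_def by simp
  moreover have "p' \<le> b"
  proof (rule ccontr)
    assume "\<not> p' \<le> b"
    then have "h p' < h c" using sep n by simp
    with n show False unfolding nbr_def by simp
  qed
  moreover have "b < q'"
  proof (rule ccontr)
    assume "\<not> b < q'"
    then have "h q' < h c" using sep n by simp
    with n show False unfolding nbr_def by simp
  qed
  ultimately show "(a, b) \<in> prec" using compatible_gap_label[OF tr c] b by blast
qed

text \<open>Both labels of a generating relation lie in one gap at level \<open>j\<close>, in
  different subgaps, and the first is alive there. Columns inside the gap are lower than
  \<open>j\<close>, hence lower than the stop of the first label.\<close>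

lemma min_prop_compatible:
  assumes h: "h \<in> diagrams t" and m: "min_prop t prec h"
  shows "compatible t prec h"
proof -
  have *: "(a, b) \<in> prec" if l: "gap_label t h n p q a" and b: "p \<le> b" "b < q" "a \<noteq> b" for n p q a b
  proof -
    have a: "1 \<le> a" "a \<le> t" using gap_label_le[OF l] by auto
    obtain c where c: "stop t h a c" using stop_exists[OF h a] by blast
    have l': "nbr t h n p q" "p \<le> a" "a < q" "n \<le> h c" using l alive_iff[OF c] unfolding gap_label_def by auto
    have "h l < h c" if "min a b < l \<and> l \<le> max a b" for l
    proof -
      have "p < l" "l < q" using that l' b by auto
      then show ?thesis using l' unfolding nbr_def by force
    qed
    moreover have "1 \<le> b" "b \<le> t" using b l'(1) unfolding nbr_def by auto
    ultimately show ?thesis using m a b c unfolding min_prop_def by blast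
  qed
  have even: "(entry t h q j, entry t h l (j - 1)) \<in> prec"
    if j: "1 \<le> j" "even j" and pq: "nbr t h j p q" and q': "nbr t h (j - 1) q' q" and l: "l \<noteq> q'"
      "l = p \<or> p < l \<and> l < q \<and> h l = j - 1" for j p q q' l
  proof -
    obtain n where n: "j = Suc n" using j(1) by (cases j) auto
    have lq: "l < q" "p \<le> l" using l pq unfolding nbr_def by auto
    have "l \<in> cols t" "n \<le> h l" "q \<in> cols t" "n \<le> h q" using l pq n unfolding nbr_def by auto
    then obtain r where r: "nbr t h n l r" "r \<le> q" using nbr_right_exists[of l t q n h] lq(1) by blast
    obtain a where a: "gap_label t h j p q a" using gap_label_exists[OF pq] by blast
    obtain c where c: "gap_label t h n l r c" using gap_label_exists[OF r(1)] by blast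
    have e: "entry t h q j = a" "entry t h l n = c" using entry_gap_label[OF a] entry_gap_label[OF c] j n by auto
    have "gap_label t h n q' q a" using gap_label_down_odd[of n t h p q a q'] a q' n j by simp
    then have "q' \<le> a" "a < q" unfolding gap_label_def by auto
    moreover have "l \<le> c" "c < r" using c unfolding gap_label_def by auto
    moreover have "r \<noteq> q" using r q' l n nbr_unique_left by auto
    then have "r \<le> q'" using r q' n unfolding nbr_def by (metis diff_Suc_1 le_neq_implies_less not_le)
    ultimately have "(a, c) \<in> prec" using *[OF a, of c] lq by auto
    with e n show ?thesis by simp
  qed
  have odd: "(entry t h p j, entry t h l (j - 1)) \<in> prec"
    if j: "1 \<le> j" "odd j" and pq: "nbr t h j p q" and p': "nbr t h (j - 1) p p'" and l: "l \<noteq> p'"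
      "l = q \<or> p < l \<and> l < q \<and> h l = j - 1" for j p q p' l
  proof -
    obtain n where n: "j = Suc n" using j(1) by (cases j) auto
    have lq: "l \<le> q" "p < l" using l pq unfolding nbr_def by auto
    have "l \<in> cols t" "n \<le> h l" "p \<in> cols t" "n \<le> h p" using l pq n unfolding nbr_def by auto
    then obtain r where r: "nbr t h n r l" "p \<le> r" using nbr_left_exists[of p t l n h] lq(2) by blast
    obtain a where a: "gap_label t h j p q a" using gap_label_exists[OF pq] by blast
    obtain c where c: "gap_label t h n r l c" using gap_label_exists[OF r(1)] by blast
    have e: "entry t h p j = a" "entry t h l n = c" using entry_gap_label[OF a] entry_gap_label[OF c] j n by auto
    have "gap_label t h n p p' a" using gap_label_down_even[of n t h p q a p'] a p' n j by simp
    then have "p \<le> a" "a < p'" unfolding gap_label_def by auto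
    moreover have "r \<le> c" "c < l" using c unfolding gap_label_def by auto
    moreover have "r \<noteq> p" using r p' l n nbr_unique_right by auto
    then have "p' \<le> r" using r p' n unfolding nbr_def by (metis diff_Suc_1 le_neq_implies_less not_le)
    ultimately have "(a, c) \<in> prec" using *[OF a, of c] lq by auto
    with e n show ?thesis by simp
  qed
  show ?thesis unfolding compatible_def order_relations_def using even odd by blast
qed

section \<open>Inserting a column\<close>

lemma min_propD:
  "min_prop t prec h \<Longrightarrow> stop t h a c \<Longrightarrow> a \<in> {1..t} \<Longrightarrow> b \<in> {1..t} \<Longrightarrow> a \<noteq> b \<Longrightarrow>
    \<forall>l. min a b < l \<and> l \<le> max a b \<longrightarrow> h l < h c \<Longrightarrow> (a, b) \<in> prec"
  unfolding min_prop_def by auto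

definition ins :: "nat \<Rightarrow> nat \<Rightarrow> diagram \<Rightarrow> diagram" where
  "ins x e g = (\<lambda>j. if j < x then g j else if j = x then e else g (j - 1))"

text \<open>Label \<open>s\<close> becomes the gap between the new column and the old column
  \<open>s\<close>, its partner. The parity makes the new column a candidate for \<open>s\<close>;
  the bound by the partner's height keeps it from being one for any other label.\<close>

definition ins_ok :: "nat \<Rightarrow> nat \<Rightarrow> nat \<Rightarrow> nat \<Rightarrow> diagram \<Rightarrow> bool" where
  "ins_ok t s x e g \<longleftrightarrow> 1 \<le> s \<and> s \<le> t + 1 \<and> e \<le> g s \<and> (x = s \<and> even e \<or> x = Suc s \<and> odd e)"

lemma ins_psi [simp]: "ins x e g (psi x b) = g b"
  unfolding ins_def psi_def by simp

lemma ins_at [simp]: "ins x e g x = e"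
  unfolding ins_def by simp

lemma psi_cases: obtains "j = x" | b where "j = psi x b"
proof (cases j x rule: linorder_cases)
  case less
  then show ?thesis using that(2)[of j] unfolding psi_def by simp
next
  case greater
  then show ?thesis using that(2)[of "j - 1"] unfolding psi_def by simp
qed (use that in simp)

lemma psi_neq [simp]: "psi x b \<noteq> x" "x \<noteq> psi x b"
  unfolding psi_def by auto

lemma psi_less_iff [simp]: "psi x a < psi x b \<longleftrightarrow> a < b"
  unfolding psi_def by auto

lemma psi_le_iff [simp]: "psi x a \<le> psi x b \<longleftrightarrow> a \<le> b"
  unfolding psi_def by auto

lemma psi_eq_iff [simp]: "psi x a = psi x b \<longleftrightarrow> a = b"
  unfolding psi_def by auto

lemma psi_less_self: "psi x b < x \<longleftrightarrow> b < x"
  unfolding psi_def by auto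

lemma self_less_psi: "x < psi x b \<longleftrightarrow> x \<le> b"
  unfolding psi_def by auto

lemma psi_side [simp]: "side n (psi x k) (psi x i) \<longleftrightarrow> side n k i"
  unfolding side_def by simp

lemma psi_strictly_between [simp]: "strictly_between (psi x l) (psi x i) (psi x k) \<longleftrightarrow> strictly_between l i k"
  unfolding strictly_between_def by simp

lemma psi_cols: "1 \<le> x \<Longrightarrow> x \<le> t + 2 \<Longrightarrow> psi x b \<in> cols (Suc t) \<longleftrightarrow> b \<in> cols t"
  unfolding psi_def by auto

lemma psi_labels: "1 \<le> s \<Longrightarrow> s \<le> t + 1 \<Longrightarrow> psi s a \<in> {1..Suc t} \<longleftrightarrow> a \<in> {1..t}"
  unfolding psi_def by auto

lemma ins_ok_x: "ins_ok t s x e g \<Longrightarrow> 1 \<le> x \<and> x \<le> t + 2"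
  unfolding ins_ok_def by auto

text \<open>Labels are gaps between columns: under insertion the labels other than \<open>s\<close> are shifted by
  \<open>psi s\<close>, the columns by \<open>psi x\<close>, and the relative position of gaps and columns is kept.\<close>

lemma psi_psi:
  assumes "x = s \<or> x = Suc s"
  shows "psi x b \<le> psi s a \<longleftrightarrow> b \<le> a" "psi s a < psi x b \<longleftrightarrow> a < b"
    "x \<le> psi s a \<longleftrightarrow> s \<le> a" "psi s a < x \<longleftrightarrow> a < s"
  using assms unfolding psi_def by auto

text \<open>For another label the partner, at least as high, stands in front of the new column,
  which is thus no candidate. Nor does the new column obstruct a candidate \<open>b\<close>: either
  the partner stands in front of \<open>b\<close> as well, or \<open>b\<close> is the partner, and
  then the parities of \<open>e\<close> and \<open>g s\<close> differ, so that
  \<open>e < g s\<close>.\<close>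

lemma candidate_ins:
  assumes ok: "ins_ok t s x e g"
  shows "candidate (Suc t) (ins x e g) (psi s a) b' \<longleftrightarrow> (\<exists>b. b' = psi x b \<and> candidate t g a b)"
proof -
  have xs: "x = s \<or> x = Suc s" and es: "e \<le> g s" and s: "1 \<le> s" using ok unfolding ins_ok_def by auto
  note pp = psi_psi[OF xs]
  note pc = psi_cols[of x t] 
  have x: "1 \<le> x" "x \<le> t + 2" using ins_ok_x[OF ok] by auto
  show ?thesis
  proof
    assume c: "candidate (Suc t) (ins x e g) (psi s a) b'"
    have "b' \<noteq> x"
    proof
      assume b: "b' = x"
      show False
      proof (cases "x = s")
        case True
        then have "even e" using ok unfolding ins_ok_def by auto
        then have "s \<le> psi s a" using c b True unfolding candidate_def by auto
        then have "s < psi s a" by (simp add: le_neq_implies_less)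
        then have "ins x e g (Suc s) < e" using c b True unfolding candidate_def by auto
        then show False using es True unfolding ins_def by simp
      next
        case False
        then have "odd e" and xx: "x = Suc s" using ok unfolding ins_ok_def by auto
        then have "psi s a < Suc s" using c b unfolding candidate_def by auto
        then have "psi s a < s" using less_Suc_eq by simp
        then have "ins x e g s < e" using c b xx unfolding candidate_def by auto
        then show False using es xx unfolding ins_def by simp
      qed
    qed
    then obtain b where b: "b' = psi x b" using psi_cases by blast
    have "candidate t g a b" unfolding candidate_def
    proof (intro conjI allI impI)
      show "b \<in> cols t" "if odd (g b) then a < b else b \<le> a"
        using c x pc unfolding candidate_def b by (auto simp: pp split: if_splits)
      fix l assume "b < l \<and> l \<le> a \<or> a < l \<and> l < b"
      then have "psi x b < psi x l \<and> psi x l \<le> psi s a \<or> psi s a < psi x l \<and> psi x l < psi x b"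
        by (simp add: pp)
      then have "ins x e g (psi x l) < ins x e g (psi x b)" using c unfolding candidate_def b by blast
      then show "g l < g b" by simp
    qed
    with b show "\<exists>b. b' = psi x b \<and> candidate t g a b" by blast
  next
    assume "\<exists>b. b' = psi x b \<and> candidate t g a b"
    then obtain b where b: "b' = psi x b" and c: "candidate t g a b" by blast
    show "candidate (Suc t) (ins x e g) (psi s a) b'" unfolding candidate_def b
    proof (intro conjI allI impI)
      show "psi x b \<in> cols (Suc t)"
        "if odd (ins x e g (psi x b)) then psi s a < psi x b else psi x b \<le> psi s a"
        using c x pc unfolding candidate_def b by (auto simp: pp split: if_splits)
      fix l' assume l': "psi x b < l' \<and> l' \<le> psi s a \<or> psi s a < l' \<and> l' < psi x b"
      show "ins x e g l' < ins x e g (psi x b)"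
      proof (cases rule: psi_cases[of l' x])
        case 1
        have "e < g b"
        proof (cases "b = s")
          case True
          then have "odd e \<noteq> odd (g b)" using l' ok c unfolding 1 candidate_def ins_ok_def
            by (auto simp: pp self_less_psi psi_less_self split: if_splits)
          with es True show ?thesis by (metis le_neq_implies_less)
        next
          case False
          then have "b < s \<and> s \<le> a \<or> a < s \<and> s < b"
            using l' xs unfolding 1 by (auto simp: pp self_less_psi psi_less_self)
          then have "g s < g b" using c unfolding candidate_def by blast
          with es show ?thesis by simp
        qed
        then show ?thesis using 1 by simp
      next
        case (2 l)
        then show ?thesis using l' c unfolding candidate_def by (auto simp: pp)
      qed
    qed
  qed
qed

lemma stop_ins:
  assumes ok: "ins_ok t s x e g"
  shows "stop (Suc t) (ins x e g) (psi s a) b' \<longleftrightarrow> (\<exists>b. b' = psi x b \<and> stop t g a b)"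
proof -
  have "(\<forall>b'. (\<exists>b. b' = psi x b \<and> candidate t g a b) \<longrightarrow> n \<le> ins x e g b') \<longleftrightarrow> (\<forall>b. candidate t g a b \<longrightarrow> n \<le> g b)" for n
    by (metis ins_psi)
  then show ?thesis unfolding stop_def candidate_ins[OF ok] by auto
qed

text \<open>The new column borders gap \<open>s\<close>, and both bordering columns have height at
  least \<open>e\<close>; a candidate further away has to exceed one of them.\<close>

lemma stop_ins_new:
  assumes ok: "ins_ok t s x e g"
  shows "stop (Suc t) (ins x e g) s x"
proof -
  have xs: "x = s \<and> even e \<or> x = Suc s \<and> odd e" and es: "e \<le> g s" and s: "1 \<le> s" "s \<le> t + 1"
    using ok unfolding ins_ok_def by auto
  have "candidate (Suc t) (ins x e g) s x" using xs s unfolding candidate_def by auto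
  moreover have "e \<le> ins x e g b" if b: "candidate (Suc t) (ins x e g) s b" for b
  proof -
    have v: "ins x e g s \<ge> e" "ins x e g (Suc s) \<ge> e" using xs es unfolding ins_def by auto
    consider "b < s" | "b = s" | "b = Suc s" | "Suc s < b" by linarith
    then show ?thesis
    proof cases
      case 1
      then have "ins x e g s < ins x e g b" using b unfolding candidate_def by blast
      with v show ?thesis by simp
    next
      case 4
      then have "ins x e g (Suc s) < ins x e g b" using b unfolding candidate_def by blast
      with v show ?thesis by simp
    qed (use v in auto)
  qed
  ultimately show ?thesis unfolding stop_def by simp
qed

text \<open>The partner stands on the decisive side of the new column, which is therefore never
  extremal. The extremality of other columns is unaffected for the same reasons as in
  \<open>candidate_ins\<close>.\<close>

lemma diagrams_ins_iff:
  assumes ok: "ins_ok t s x e g"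
  shows "ins x e g \<in> diagrams (Suc t) \<longleftrightarrow> g \<in> diagrams t"
proof -
  let ?h = "ins x e g"
  have xs: "x = s \<and> even e \<or> x = Suc s \<and> odd e" and es: "e \<le> g s" and s: "1 \<le> s" "s \<le> t + 1"
    using ok unfolding ins_ok_def by auto
  have x: "1 \<le> x" "x \<le> t + 2" using ins_ok_x[OF ok] by auto
  note pc = psi_cols[OF x]
  have sc: "s \<in> cols t" using s by simp
  have supp: "(\<forall>i. i \<notin> cols (Suc t) \<longrightarrow> ?h i = 0) \<longleftrightarrow> (\<forall>i. i \<notin> cols t \<longrightarrow> g i = 0)"
  proof
    assume *: "\<forall>i. i \<notin> cols (Suc t) \<longrightarrow> ?h i = 0"
    show "\<forall>i. i \<notin> cols t \<longrightarrow> g i = 0" using * pc ins_psi by metis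
  next
    assume *: "\<forall>i. i \<notin> cols t \<longrightarrow> g i = 0"
    show "\<forall>i. i \<notin> cols (Suc t) \<longrightarrow> ?h i = 0"
    proof (intro allI impI)
      fix i assume i: "i \<notin> cols (Suc t)"
      then show "?h i = 0"
      proof (cases rule: psi_cases[of i x])
        case 1
        then show ?thesis using i x by simp
      next
        case (2 b)
        then show ?thesis using i * pc by auto
      qed
    qed
  qed
  have ext: "(\<forall>k\<in>cols (Suc t). side (g b) k (psi x b) \<longrightarrow> ?h k < g b) \<longleftrightarrow>
      (\<forall>k\<in>cols t. side (g b) k b \<longrightarrow> g k < g b)" (is "?L \<longleftrightarrow> ?R") if "b \<in> cols t" for b
  proof
    assume L: ?L
    show ?R
    proof (intro ballI impI)
      fix k assume "k \<in> cols t" "side (g b) k b"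
      then show "g k < g b" using L pc[of k] by (metis ins_psi psi_side)
    qed
  next
    assume R: ?R
    show ?L
    proof (intro ballI impI)
      fix k assume k: "k \<in> cols (Suc t)" "side (g b) k (psi x b)"
      show "?h k < g b"
      proof (cases rule: psi_cases[of k x])
        case 1
        have "e < g b"
        proof (cases "b = s")
          case True
          then have "odd e \<noteq> odd (g b)" using k xs unfolding 1 side_def
            by (auto simp: self_less_psi psi_less_self split: if_splits)
          with es True show ?thesis by (metis le_neq_implies_less)
        next
          case False
          then have "side (g b) s b" using k xs unfolding 1 side_def
            by (auto simp: self_less_psi psi_less_self split: if_splits)
          then have "g s < g b" using R sc by blast
          with es show ?thesis by simp
        qed
        then show ?thesis using 1 by simp
      next
        case (2 l)
        then show ?thesis using k R pc by auto
      qed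
    qed
  qed
  have mx: "(\<forall>k\<in>cols (Suc t). ?h k \<le> g b) \<longleftrightarrow> (\<forall>k\<in>cols t. g k \<le> g b)" (is "?L \<longleftrightarrow> ?R") for b
  proof
    assume ?L then show ?R using pc by (metis ins_psi)
  next
    assume R: ?R
    show ?L
    proof
      fix k assume k: "k \<in> cols (Suc t)"
      show "?h k \<le> g b"
      proof (cases rule: psi_cases[of k x])
        case 1
        have "g s \<le> g b" using R sc by blast
        with es 1 show ?thesis by simp
      next
        case (2 l)
        then show ?thesis using k R pc by auto
      qed
    qed
  qed
  have new: "\<not> (\<forall>k\<in>cols (Suc t). side e k x \<longrightarrow> ?h k < e)"
  proof -
    have "side e (psi x s) x" using xs unfolding side_def psi_def by auto
    moreover have "psi x s \<in> cols (Suc t)" using pc sc by blast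
    moreover have "\<not> ?h (psi x s) < e" using es by simp
    ultimately show ?thesis by blast
  qed
  have all: "(\<forall>i\<in>cols (Suc t). P i) \<longleftrightarrow> P x \<and> (\<forall>b\<in>cols t. P (psi x b))" for P
  proof
    assume "\<forall>i\<in>cols (Suc t). P i"
    then show "P x \<and> (\<forall>b\<in>cols t. P (psi x b))" using pc x by auto
  next
    assume *: "P x \<and> (\<forall>b\<in>cols t. P (psi x b))"
    show "\<forall>i\<in>cols (Suc t). P i"
    proof
      fix i assume "i \<in> cols (Suc t)"
      then show "P i" using * pc by (cases rule: psi_cases[of i x]) auto
    qed
  qed
  let ?Q = "\<lambda>i. (\<forall>k\<in>cols (Suc t). side (?h i) k i \<longrightarrow> ?h k < ?h i) \<longrightarrow> (\<forall>k\<in>cols (Suc t). ?h k \<le> ?h i)"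
  have "(\<forall>i\<in>cols (Suc t). ?Q i) \<longleftrightarrow> (\<forall>b\<in>cols t. (\<forall>k\<in>cols t. side (g b) k b \<longrightarrow> g k < g b) \<longrightarrow> (\<forall>k\<in>cols t. g k \<le> g b))"
    unfolding all[of ?Q] ins_psi ins_at mx using new ext by blast
  with supp show ?thesis unfolding diagrams_iff by blast
qed

lemma is_se_ins:
  assumes ok: "ins_ok t s x e g" and se: "is_se t g j"
  shows "is_se (Suc t) (ins x e g) (psi x j)"
proof -
  have xs: "x = s \<and> even e \<or> x = Suc s \<and> odd e" and es: "e \<le> g s" and sc: "s \<in> cols t"
    using ok unfolding ins_ok_def by auto
  have x: "1 \<le> x" "x \<le> t + 2" using ins_ok_x[OF ok] by auto
  note pc = psi_cols[OF x]
  have se': "j \<in> cols t" "\<And>k. k \<in> cols t \<Longrightarrow> g k \<le> g j" "\<And>k. k \<in> cols t \<Longrightarrow> side (g j) k j \<Longrightarrow> g k < g j"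
    using se unfolding is_se_def by auto
  have lt: "e < g j" if "side (g j) x (psi x j)"
  proof (rule ccontr)
    assume "\<not> e < g j"
    then have e: "g s = g j" "e = g j" using es se'(2)[OF sc] by auto
    then have "side (g j) s j" using that xs unfolding side_def
      by (auto simp: self_less_psi psi_less_self split: if_splits)
    with se'(3)[OF sc] e show False by simp
  qed
  show ?thesis unfolding is_se_def
  proof (intro conjI ballI impI)
    show "psi x j \<in> cols (Suc t)" using pc se'(1) by blast
  next
    fix k assume k: "k \<in> cols (Suc t)"
    show "ins x e g k \<le> ins x e g (psi x j)"
    proof (cases rule: psi_cases[of k x])
      case 1
      then show ?thesis using es se'(2)[OF sc] by simp
    qed (use k pc se' in auto)
  next
    fix k assume k: "k \<in> cols (Suc t)" "side (ins x e g (psi x j)) k (psi x j)"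
    show "ins x e g k < ins x e g (psi x j)"
    proof (cases rule: psi_cases[of k x])
      case 1
      then show ?thesis using lt k by simp
    qed (use k pc se' in auto)
  qed
qed

lemma domino_ins_new:
  assumes ok: "ins_ok t s x (e + 2) g"
  shows "domino (Suc t) (ins x e g) x (psi x s)"
  using ok unfolding ins_ok_def domino_def side_def strictly_between_def by (auto simp: psi_def ins_def)

lemma ins_upd_new: "(ins x e g)(x := e') = ins x e' g"
  unfolding ins_def by auto

lemma ins_upd: "ins x e (g(i := v)) = (ins x e g)(psi x i := v)"
proof
  fix j show "ins x e (g(i := v)) j = ((ins x e g)(psi x i := v)) j"
    by (cases rule: psi_cases[of j x]) auto
qed

section \<open>Insertion on equivalence classes\<close>

lemma diagram_equiv_sym: "(g, h) \<in> diagram_equiv t \<Longrightarrow> (h, g) \<in> diagram_equiv t"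
  using equiv_diagram_equiv by (metis equivE symE)

lemma diagram_equiv_trans: "(f, g) \<in> diagram_equiv t \<Longrightarrow> (g, h) \<in> diagram_equiv t \<Longrightarrow> (f, h) \<in> diagram_equiv t"
  using equiv_diagram_equiv by (metis equivE transE)

lemma diagram_equiv_refl: "g \<in> diagrams t \<Longrightarrow> (g, g) \<in> diagram_equiv t"
  using equiv_diagram_equiv by (metis equivE refl_onD)

lemma move_domino:
  assumes "g \<in> diagrams t" "domino t g i k" shows "move t g (g(i := g i + 2))"
  using assms diagrams_domino[OF assms] domino_iff[of t g "g(i := g i + 2)"] unfolding move_def by blast

lemma move_cancel:
  assumes "g \<in> diagrams t" "\<forall>k\<in>cols t. g k \<noteq> i + 1" shows "move t g (cancel i g)"
  using assms diagrams_cancel[OF assms] unfolding move_def row_cancel_iff by blast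

text \<open>Raising the new column by two is a domino with the partner as the higher column, so only
  the parity of its height matters for the class.\<close>

lemma ins_equiv_add:
  assumes g: "g \<in> diagrams t"
  shows "ins_ok t s x (e + 2 * n) g \<Longrightarrow> (ins x e g, ins x (e + 2 * n) g) \<in> diagram_equiv (Suc t)"
proof (induction n)
  case 0
  then show ?case using g diagrams_ins_iff by (auto intro: diagram_equiv_refl)
next
  case (Suc n)
  then have ok: "ins_ok t s x (e + 2 * n + 2) g" by (simp add: algebra_simps)
  then have ok': "ins_ok t s x (e + 2 * n) g" unfolding ins_ok_def by auto
  have "move (Suc t) (ins x (e + 2 * n) g) (ins x (e + 2 * n + 2) g)"
    using move_domino[OF _ domino_ins_new[OF ok]] diagrams_ins_iff[OF ok'] g by (simp add: ins_upd_new)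
  then have "(ins x (e + 2 * n) g, ins x (e + 2 * Suc n) g) \<in> diagram_equiv (Suc t)"
    using move_equiv by (simp add: algebra_simps)
  with Suc.IH[OF ok'] show ?case by (rule diagram_equiv_trans)
qed

lemma ins_equiv_le:
  assumes "g \<in> diagrams t" "ins_ok t s x e g" "ins_ok t s x e' g" "e \<le> e'"
  shows "(ins x e g, ins x e' g) \<in> diagram_equiv (Suc t)"
proof -
  have "even (e' - e)" using assms unfolding ins_ok_def by auto
  then obtain n where "e' = e + 2 * n" using assms(4) by (metis evenE le_add_diff_inverse)
  then show ?thesis using ins_equiv_add assms by blast
qed

lemma ins_equiv:
  assumes "g \<in> diagrams t" "ins_ok t s x e g" "ins_ok t s x e' g"
  shows "(ins x e g, ins x e' g) \<in> diagram_equiv (Suc t)"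
  using ins_equiv_le[OF assms] ins_equiv_le[OF assms(1,3,2)] diagram_equiv_sym nat_le_linear by blast

definition pad :: "nat \<Rightarrow> diagram \<Rightarrow> diagram" where
  "pad t g = (\<lambda>i. if i \<in> cols t then g i + 2 else 0)"

lemma diagrams_pad:
  assumes "g \<in> diagrams t" shows "pad t g \<in> diagrams t"
  using assms unfolding diagrams_iff pad_def side_def by simp

lemma cancel_pad: "g \<in> diagrams t \<Longrightarrow> cancel 0 (pad t g) = g"
  unfolding cancel_def pad_def by (auto simp: diagrams_iff)

text \<open>A padded diagram has no column of height 1, so its two lowest rows cancel.\<close>

lemma move_pad:
  assumes "g \<in> diagrams t" shows "move t (pad t g) g"
  using move_cancel[OF diagrams_pad[OF assms], of 0] cancel_pad[OF assms] by (simp add: pad_def)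

lemma pad_ins:
  assumes "ins_ok t s x e g" shows "pad (Suc t) (ins x e g) = ins x (e + 2) (pad t g)"
proof
  have x: "1 \<le> x" "x \<le> t + 2" using ins_ok_x[OF assms] by auto
  fix j show "pad (Suc t) (ins x e g) j = ins x (e + 2) (pad t g) j"
    using x psi_cols[OF x] by (cases rule: psi_cases[of j x]) (auto simp: pad_def)
qed

text \<open>The two full rows added by \<open>pad\<close> leave room for a new column below all others, so that this
  insertion commutes with all moves.\<close>

definition ext :: "nat \<Rightarrow> nat \<Rightarrow> nat \<Rightarrow> diagram \<Rightarrow> diagram" where
  "ext t x e g = ins x e (pad t g)"

text \<open>Heights 2 and 1 have the parities required by \<open>ins_ok\<close> and fit below every
  padded column, whatever the diagram.\<close>

definition ext_ok :: "nat \<Rightarrow> nat \<Rightarrow> nat \<Rightarrow> nat \<Rightarrow> bool" where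
  "ext_ok t s x e \<longleftrightarrow> 1 \<le> s \<and> s \<le> t + 1 \<and> (x = s \<and> e = 2 \<or> x = Suc s \<and> e = 1)"

lemma ext_ins_ok: "ext_ok t s x e \<Longrightarrow> ins_ok t s x e (pad t g)"
  unfolding ext_ok_def ins_ok_def pad_def by auto

lemma diagrams_ext: "ext_ok t s x e \<Longrightarrow> g \<in> diagrams t \<Longrightarrow> ext t x e g \<in> diagrams (Suc t)"
  unfolding ext_def using diagrams_ins_iff[OF ext_ins_ok] diagrams_pad by blast

text \<open>Padding \<open>ins x e g\<close> lifts the new column as well, to \<open>e + 2\<close>;
  dominoes on that column alone adjust it to \<open>e'\<close>.\<close>

lemma ins_equiv_ext:
  assumes g: "g \<in> diagrams t" and ok: "ins_ok t s x e g" and ok': "ext_ok t s x e'"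
  shows "(ins x e g, ext t x e' g) \<in> diagram_equiv (Suc t)"
proof -
  have "ins x e g \<in> diagrams (Suc t)" using g diagrams_ins_iff[OF ok] by blast
  then have "(ins x e g, ins x (e + 2) (pad t g)) \<in> diagram_equiv (Suc t)"
    using move_pad pad_ins[OF ok] move_equiv diagram_equiv_sym by metis
  moreover have "ins_ok t s x (e + 2) (pad t g)" using ok unfolding ins_ok_def pad_def by auto
  then have "(ins x (e + 2) (pad t g), ext t x e' g) \<in> diagram_equiv (Suc t)"
    unfolding ext_def using ins_equiv[OF diagrams_pad[OF g]] ext_ins_ok[OF ok'] by blast
  ultimately show ?thesis by (rule diagram_equiv_trans)
qed

lemma is_se_pad: "is_se t g j \<Longrightarrow> is_se t (pad t g) j"
  unfolding is_se_def pad_def side_def by auto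

lemma is_se_ext: "ext_ok t s x e \<Longrightarrow> is_se t g j \<Longrightarrow> is_se (Suc t) (ext t x e g) (psi x j)"
  unfolding ext_def using is_se_ins[OF ext_ins_ok] is_se_pad by blast

lemma pad_upd: "i \<in> cols t \<Longrightarrow> pad t (g(i := v)) = (pad t g)(i := v + 2)"
  unfolding pad_def by auto

lemma ext_upd: "i \<in> cols t \<Longrightarrow> ext t x e (g(i := v)) = (ext t x e g)(psi x i := v + 2)"
  unfolding ext_def by (simp add: pad_upd ins_upd)

lemma ext_psi: "b \<in> cols t \<Longrightarrow> ext t x e g (psi x b) = g b + 2"
  unfolding ext_def by (simp add: pad_def)

lemma move_ext:
  assumes ok: "ext_ok t s x e" and m: "move t g h"
  shows "move (Suc t) (ext t x e g) (ext t x e h)"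
proof -
  have x: "1 \<le> x" "x \<le> t + 2" and e: "e \<le> 2" using ok unfolding ext_ok_def by auto
  note pc = psi_cols[OF x]
  have g: "g \<in> diagrams t" "h \<in> diagrams t" using m unfolding move_def by auto
  note d = diagrams_ext[OF ok g(1)] diagrams_ext[OF ok g(2)]
  show ?thesis using m
  proof (cases rule: move_cases)
    case (dom i k)
    then have ik: "i \<in> cols t" "k \<in> cols t" "side (g i) k i" "g i + 2 \<le> g k" "\<And>l. strictly_between l i k \<Longrightarrow> g l \<le> g i"
      unfolding domino_def by auto
    have "ext t x e g l' \<le> g i + 2" if l': "strictly_between l' (psi x i) (psi x k)" for l'
    proof (cases rule: psi_cases[of l' x])
      case 1
      then show ?thesis using e unfolding ext_def by simp
    next
      case (2 l)
      then have "strictly_between l i k" using l' by simp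
      then show ?thesis using ik(5)[of l] unfolding 2 ext_def by (simp add: pad_def)
    qed
    moreover have "side (g i + 2) (psi x k) (psi x i)" using ik(3) unfolding side_def by simp
    ultimately have "domino (Suc t) (ext t x e g) (psi x i) (psi x k)"
      unfolding domino_def using ik pc by (simp add: ext_psi)
    from move_domino[OF d(1) this] show ?thesis using dom ik(1) by (simp add: ext_upd ext_psi)
  next
    case (half j)
    then have "j \<in> cols t" unfolding is_se_def by blast
    then have "half_domino (Suc t) (ext t x e g) (ext t x e h)"
      unfolding half_domino_iff using is_se_ext[OF ok half(1)] half(2) by (auto simp: ext_upd ext_psi)
    with d show ?thesis unfolding move_def by blast
  next
    case (cancel i)
    \<comment> \<open>Padding moves the cancelled levels to \<open>i + 3\<close> and
      \<open>i + 4\<close>, above the new column.\<close>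
    have 1: "\<forall>k\<in>cols (Suc t). ext t x e g k \<noteq> i + 2 + 1"
    proof
      fix k assume k: "k \<in> cols (Suc t)"
      show "ext t x e g k \<noteq> i + 2 + 1"
      proof (cases rule: psi_cases[of k x])
        case 1
        then show ?thesis using e unfolding ext_def by simp
      next
        case (2 l)
        then show ?thesis using k pc cancel(1) by (simp add: ext_psi)
      qed
    qed
    have "ext t x e h = cancel (i + 2) (ext t x e g)"
    proof
      fix k show "ext t x e h k = cancel (i + 2) (ext t x e g) k"
        by (cases rule: psi_cases[of k x]) (use e cancel(2) in \<open>auto simp: ext_def pad_def cancel_def\<close>)
    qed
    with move_cancel[OF d(1) 1] show ?thesis by simp
  qed
qed

lemma ext_equiv:
  assumes ok: "ext_ok t s x e" and "(g, h) \<in> diagram_equiv t"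
  shows "(ext t x e g, ext t x e h) \<in> diagram_equiv (Suc t)"
proof -
  have g: "g \<in> diagrams t" "h \<in> diagrams t" and "equivclp (move t) g h"
    using assms(2) unfolding diagram_equiv_def by auto
  from this(3) have "equivclp (move (Suc t)) (ext t x e g) (ext t x e h)"
  proof (induction rule: equivclp_induct)
    case (step y z)
    then have "move (Suc t) (ext t x e y) (ext t x e z) \<or> move (Suc t) (ext t x e z) (ext t x e y)"
      using move_ext[OF ok] by blast
    then have "equivclp (move (Suc t)) (ext t x e y) (ext t x e z)"
      by (auto intro: r_into_equivclp equivclp_sym)
    with step.IH show ?case by (rule equivclp_trans)
  qed simp
  with g show ?thesis unfolding diagram_equiv_def using diagrams_ext[OF ok] by blast
qed

section \<open>Insertion, compatibility and completeness\<close>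

text \<open>Conditions with \<open>s\<close> as the greater label hold by \<open>top\<close>. Those
  with \<open>s\<close> as the smaller one never arise: columns \<open>s\<close> and
  \<open>Suc s\<close> are at least as high as its stop and separate \<open>s\<close> from all other
  labels. The rest correspond, since whenever the new column separates two old labels, its partner
  does so too and is at least as high.\<close>

lemma min_prop_ins:
  assumes ok: "ins_ok t s x e g" and top: "\<And>a. a \<in> {1..Suc t} \<Longrightarrow> a \<noteq> s \<Longrightarrow> (a, s) \<in> prec"
    and prec': "prec' = {(a, b). a \<in> {1..t} \<and> b \<in> {1..t} \<and> (psi s a, psi s b) \<in> prec}"
  shows "min_prop (Suc t) prec (ins x e g) \<longleftrightarrow> min_prop t prec' g"
proof -
  let ?h = "ins x e g"
  have xs: "x = s \<or> x = Suc s" and es: "e \<le> g s" and s: "1 \<le> s" "s \<le> t + 1" using ok unfolding ins_ok_def by auto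
  note pp = psi_psi[OF xs]
  note pl = psi_labels[OF s]
  have mm: "min (psi s a) (psi s b) = psi s (min a b)" "max (psi s a) (psi s b) = psi s (max a b)" for a b
    unfolding min_def max_def by auto
  have sep: "(\<forall>l. psi s m < l \<and> l \<le> psi s M \<longrightarrow> ?h l < n) \<longleftrightarrow> (\<forall>l. m < l \<and> l \<le> M \<longrightarrow> g l < n)" (is "?L \<longleftrightarrow> ?R") for m M n
  proof
    assume ?L then show ?R using pp by (metis ins_psi)
  next
    assume R: ?R
    show ?L
    proof (intro allI impI)
      fix l' assume l': "psi s m < l' \<and> l' \<le> psi s M"
      show "?h l' < n"
      proof (cases rule: psi_cases[of l' x])
        case 1
        then have "m < s \<and> s \<le> M" using l' by (simp add: pp)
        then have "g s < n" using R by blast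
        then show ?thesis using 1 es by simp
      qed (use R l' in \<open>auto simp: pp\<close>)
    qed
  qed
  show ?thesis
  proof
    assume M: "min_prop (Suc t) prec ?h"
    show "min_prop t prec' g" unfolding min_prop_def
    proof (intro allI impI, elim conjE)
      fix a b c assume a: "1 \<le> a" "a \<le> t" "1 \<le> b" "b \<le> t" "a \<noteq> b" and c: "stop t g a c"
        and l: "\<forall>l. min a b < l \<and> l \<le> max a b \<longrightarrow> g l < g c"
      have "stop (Suc t) ?h (psi s a) (psi x c)" using stop_ins[OF ok] c by blast
      moreover have "\<forall>l. min (psi s a) (psi s b) < l \<and> l \<le> max (psi s a) (psi s b) \<longrightarrow> ?h l < ?h (psi x c)"
        unfolding mm ins_psi sep by (rule l)
      moreover have "psi s a \<in> {1..Suc t}" "psi s b \<in> {1..Suc t}" unfolding pl using a by auto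
      moreover have "psi s a \<noteq> psi s b" using a(5) by simp
      ultimately have "(psi s a, psi s b) \<in> prec" using min_propD[OF M] by blast
      then show "(a, b) \<in> prec'" using a unfolding prec' by auto
    qed
  next
    assume M: "min_prop t prec' g"
    show "min_prop (Suc t) prec ?h" unfolding min_prop_def
    proof (intro allI impI, elim conjE)
      fix a' b' c' assume a: "1 \<le> a'" "a' \<le> Suc t" "1 \<le> b'" "b' \<le> Suc t" "a' \<noteq> b'" and c: "stop (Suc t) ?h a' c'"
        and l: "\<forall>l. min a' b' < l \<and> l \<le> max a' b' \<longrightarrow> ?h l < ?h c'"
      show "(a', b') \<in> prec"
      proof (cases rule: psi_cases[of a' s])
        case 1
        then have "c' = x" using c stop_ins_new[OF ok] stop_unique by blast
        then have l': "\<And>l. min a' b' < l \<and> l \<le> max a' b' \<Longrightarrow> ?h l < e" using l by simp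
        have "?h s \<ge> e" "?h (Suc s) \<ge> e" using es xs unfolding ins_def by auto
        with l'[of s] l'[of "Suc s"] a 1 show ?thesis by (cases "b' < s") auto
      next
        case a2: (2 a0)
        then obtain c0 where c0: "c' = psi x c0" "stop t g a0 c0" using c stop_ins[OF ok] by blast
        show ?thesis
        proof (cases rule: psi_cases[of b' s])
          case 1
          then show ?thesis using top[of a'] a by auto
        next
          case (2 b0)
          have "a0 \<in> {1..t}" "b0 \<in> {1..t}" using a pl a2 2 by auto
          moreover have "a0 \<noteq> b0" using a(5) a2 2 by simp
          moreover have "\<forall>l. min a0 b0 < l \<and> l \<le> max a0 b0 \<longrightarrow> g l < g c0"
            using l unfolding a2 2 c0 mm ins_psi sep .
          ultimately have "(a0, b0) \<in> prec'" using min_propD[OF M c0(2)] by blast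
          then show ?thesis unfolding prec' a2 2 by simp
        qed
      qed
    qed
  qed
qed

lemma complete_iff:
  assumes "h \<in> diagrams t" shows "complete t h \<longleftrightarrow> \<not> (\<exists>i k. domino t h i k)"
  unfolding complete_def domino_iff using diagrams_domino[OF assms] by blast

text \<open>As \<open>e\<close> is within one of the partner's height, the partner supports no
  domino on the new column. Any other domino involving the new column becomes a domino of
  \<open>g\<close> when the partner takes its place.\<close>

lemma complete_ins:
  assumes g: "g \<in> diagrams t" and ok: "ins_ok t s x e g" and e: "g s \<le> e + 1" and c: "complete t g"
  shows "complete (Suc t) (ins x e g)"
proof -
  let ?h = "ins x e g"
  have xs: "x = s \<and> even e \<or> x = Suc s \<and> odd e" and es: "e \<le> g s" and sc: "s \<in> cols t"
    using ok unfolding ins_ok_def by auto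
  have x: "1 \<le> x" "x \<le> t + 2" using ins_ok_x[OF ok] by auto
  note pc = psi_cols[OF x]
  have nd: "\<not> domino t g i k" for i k using c complete_iff[OF g] by blast
  have "\<not> domino (Suc t) ?h i' k'" for i' k'
  proof
    assume d: "domino (Suc t) ?h i' k'"
    then have d': "i' \<in> cols (Suc t)" "k' \<in> cols (Suc t)" "side (?h i') k' i'" "?h i' + 2 \<le> ?h k'"
      "\<And>l. strictly_between l i' k' \<Longrightarrow> ?h l \<le> ?h i'" unfolding domino_def by auto
    show False
    proof (cases rule: psi_cases[of i' x])
      case 1
      have "k' \<noteq> x" using d'(4) 1 by auto
      then obtain k where k: "k' = psi x k" using psi_cases by blast
      have ks: "k \<noteq> s" using d'(4) e unfolding 1 k by auto
      have kc: "k \<in> cols t" using d'(2) pc unfolding k by blast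
      have b: "strictly_between l s k \<or> l = s \<Longrightarrow> strictly_between (psi x l) x (psi x k)" and sd: "side e k s" for l
        using d'(3) xs ks unfolding 1 k side_def strictly_between_def
        by (auto simp: psi_def split: if_splits)
      have "g s \<le> e" using d'(5)[of "psi x s"] b[of s] unfolding 1 k by simp
      then have "g s = e" using es by simp
      moreover have "g l \<le> e" if "strictly_between l s k" for l using d'(5)[of "psi x l"] b[of l] that unfolding 1 k by simp
      ultimately have "domino t g s k" using sd d'(4) kc sc unfolding domino_def 1 k by simp
      with nd show False by blast
    next
      case (2 i)
      have ic: "i \<in> cols t" using d'(1) pc unfolding 2 by blast
      show False
      proof (cases rule: psi_cases[of k' x])
        case 1
        have si: "s \<noteq> i" "g i + 2 \<le> g s" using d'(4) es unfolding 1 2 by auto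
        have b: "strictly_between (psi x l) (psi x i) x" if "strictly_between l i s" for l
          using that xs si unfolding strictly_between_def by (auto simp: psi_def)
        have "side (g i) s i" using d'(3) xs si unfolding 1 2 side_def
          by (auto simp: self_less_psi psi_less_self split: if_splits)
        moreover have "g l \<le> g i" if "strictly_between l i s" for l using d'(5)[of "psi x l"] b[OF that] unfolding 1 2 by simp
        ultimately have "domino t g i s" using sc ic si unfolding domino_def by simp
        with nd show False by blast
      next
        case k: (2 k)
        have "g l \<le> g i" if "strictly_between l i k" for l using d'(5)[of "psi x l"] that unfolding 2 k by simp
        then have "domino t g i k" using d' ic pc unfolding domino_def 2 k by simp
        with nd show False by blast
      qed
    qed
  qed
  then show ?thesis using complete_iff[of ?h "Suc t"] diagrams_ins_iff[OF ok] g by blast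
qed

section \<open>Links\<close>

text \<open>The condition on heights puts the added block into the row of the old strongly extremal
  block.\<close>

definition link :: "nat \<Rightarrow> diagram \<Rightarrow> nat \<Rightarrow> bool" where
  "link t h k \<longleftrightarrow> h \<in> diagrams t \<and> h(k := h k + 1) \<in> diagrams t \<and>
     is_se t (h(k := h k + 1)) k \<and> (\<exists>j. is_se t h j \<and> h j = h k + 1)"

lemma link_cols: "link t h k \<Longrightarrow> k \<in> cols t"
  unfolding link_def is_se_def by blast

lemma entry_single:
  assumes "row t h n = {k}" "1 \<le> n"
  shows "entry t h k n = 0"
proof -
  have "extremal_block t h k n" unfolding extremal_block_def assms(1) by simp
  then show ?thesis using assms(2) by (cases "(t, h, k, n)" rule: entry.cases) (simp_all add: Let_def)
qed

text \<open>Extremality before and after leaves \<open>h j = h k\<close> or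
  \<open>h j = h k + 1\<close>. In the first case the new block is alone in its row, hence extremal
  and without entry.\<close>

lemma linkI:
  assumes h: "h \<in> diagrams t" and h': "h(k := h k + 1) \<in> diagrams t"
    and j: "is_se t h j" and k: "is_se t (h(k := h k + 1)) k" and jk: "j \<noteq> k"
    and en: "entry t (h(k := h k + 1)) k (h k + 1) \<noteq> 0"
  shows "link t h k"
proof -
  let ?h' = "h(k := h k + 1)"
  have c: "j \<in> cols t" "k \<in> cols t" using j k unfolding is_se_def by auto
  have le: "h k \<le> h j" using j c unfolding is_se_def by blast
  have "?h' j \<le> ?h' k" using k c unfolding is_se_def by blast
  then have le': "h j \<le> h k + 1" using jk by simp
  have "h j \<noteq> h k"
  proof
    assume e: "h j = h k"
    have "h l \<le> h k" if "l \<in> cols t" for l using j e that unfolding is_se_def by auto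
    then have "l = k" if "l \<in> cols t" "h k + 1 \<le> ?h' l" for l using that by (cases "l = k") force+
    then have "row t ?h' (h k + 1) = {k}" using c unfolding row_def by auto
    from entry_single[OF this] en show False by simp
  qed
  with le le' have "h j = h k + 1" by simp
  with assms show ?thesis unfolding link_def by blast
qed

text \<open>Column \<open>i\<close> lies at least two below the maximum and \<open>k\<close> exactly
  one. So \<open>i\<close> is neither \<open>k\<close> nor \<open>j\<close>, and \<open>k\<close> is
  too high to lie between \<open>i\<close> and \<open>m\<close>: the same domino fits with and
  without the new block.\<close>

lemma link_domino:
  assumes l: "link t h k" and d: "domino t h i m"
  shows "link t (h(i := h i + 2)) k"
    "(h, (h(i := h i + 2))) \<in> diagram_equiv t" "(h(k := h k + 1), (h(i := h i + 2))(k := (h(i := h i + 2)) k + 1)) \<in> diagram_equiv t"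
proof -
  let ?h' = "h(k := h k + 1)"
  obtain j where j: "is_se t h j" "h j = h k + 1" and h: "h \<in> diagrams t" "?h' \<in> diagrams t"
    and k: "is_se t ?h' k" using l unfolding link_def by blast
  have d': "i \<in> cols t" "m \<in> cols t" "side (h i) m i" "h i + 2 \<le> h m" "\<And>l. strictly_between l i m \<Longrightarrow> h l \<le> h i"
    using d unfolding domino_def by auto
  have hm: "h m \<le> h k + 1" using j d'(2) unfolding is_se_def by auto
  have ik: "i \<noteq> k" and ij: "i \<noteq> j" using hm j d' by auto
  have "\<not> strictly_between k i m" using d'(4,5) hm by force
  then have "domino t ?h' i m" using d' ik unfolding domino_def by auto
  from move_domino[OF h(2) this] have m2: "move t ?h' ((h(i := h i + 2))(k := (h(i := h i + 2)) k + 1))"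
    using ik by (simp add: fun_upd_twist)
  have m1: "move t h (h(i := h i + 2))" by (rule move_domino[OF h(1) d])
  show "(h, (h(i := h i + 2))) \<in> diagram_equiv t" "(?h', (h(i := h i + 2))(k := (h(i := h i + 2)) k + 1)) \<in> diagram_equiv t"
    using m1 m2 by (auto intro: move_equiv)
  have "is_se t (h(i := h i + 2)) j" "(h(i := h i + 2)) j = (h(i := h i + 2)) k + 1" using move_is_se[OF m1 j(1)] j(2) ij ik by auto
  moreover have "is_se t ((h(i := h i + 2))(k := (h(i := h i + 2)) k + 1)) k" by (rule move_is_se[OF m2 k])
  ultimately show "link t (h(i := h i + 2)) k" using m1 m2 unfolding link_def move_def by blast
qed

text \<open>The bound by the height excludes the empty rows above the diagram. It forces column
  \<open>k\<close> up to level \<open>i + 2\<close>, so the added block lies above the cancelled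
  rows.\<close>

lemma link_cancel:
  assumes l: "link t h k" and d: "\<forall>m\<in>cols t. h m \<noteq> i + 1" and i: "i + 2 \<le> height t h"
  shows "link t (cancel i h) k"
    "(h, (cancel i h)) \<in> diagram_equiv t" "(h(k := h k + 1), (cancel i h)(k := (cancel i h) k + 1)) \<in> diagram_equiv t"
proof -
  let ?h' = "h(k := h k + 1)"
  obtain j where j: "is_se t h j" "h j = h k + 1" and h: "h \<in> diagrams t" "?h' \<in> diagrams t"
    and k: "is_se t ?h' k" using l unfolding link_def by blast
  have "height t h = h j" using j(1) strongly_extremal_eq_iff height_strongly_extremal by metis
  then have "i + 1 \<le> h k" using i j by simp
  moreover have "h k \<noteq> i + 1" using d link_cols[OF l] by blast
  ultimately have ik: "i + 2 \<le> h k" by simp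
  have "\<forall>m\<in>cols t. ?h' m \<noteq> i + 1" using d ik by simp
  from move_cancel[OF h(2) this] have m2: "move t ?h' (cancel i ?h')" .
  have e: "cancel i ?h' = (cancel i h)(k := (cancel i h) k + 1)" using ik unfolding cancel_def by (auto simp: fun_eq_iff)
  note m2 = m2[unfolded e]
  have m1: "move t h (cancel i h)" by (rule move_cancel[OF h(1) d])
  show "(h, (cancel i h)) \<in> diagram_equiv t" "(?h', (cancel i h)(k := (cancel i h) k + 1)) \<in> diagram_equiv t"
    using m1 m2 by (auto intro: move_equiv)
  have "is_se t (cancel i h) j" "(cancel i h) j = (cancel i h) k + 1" using move_is_se[OF m1 j(1)] j(2) ik unfolding cancel_def by auto
  moreover have "is_se t ((cancel i h)(k := (cancel i h) k + 1)) k" by (rule move_is_se[OF m2 k])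
  ultimately show "link t (cancel i h) k" using m1 m2 unfolding link_def move_def by blast
qed

text \<open>Termination measure for normalizing a link: a domino keeps the height and lowers the
  sum, a cancellation lowers the height and does not increase the sum.\<close>

definition deficit :: "nat \<Rightarrow> diagram \<Rightarrow> nat" where
  "deficit t h = height t h + (\<Sum>i\<in>cols t. height t h - h i)"

lemma height_is_se: "is_se t h j \<Longrightarrow> height t h = h j"
  using strongly_extremal_eq_iff height_strongly_extremal by metis

lemma deficit_domino:
  assumes d: "domino t h i m" shows "deficit t (h(i := h i + 2)) < deficit t h"
proof -
  let ?g = "h(i := h i + 2)"
  obtain j where j: "is_se t h j" using is_se_strongly_extremal by blast
  have jg: "is_se t ?g j" using is_se_domino[OF j d] .
  have im: "i \<in> cols t" "m \<in> cols t" "h i + 2 \<le> h m" using d unfolding domino_def by auto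
  have hm: "h m \<le> h j" using j im unfolding is_se_def by blast
  then have ij: "i \<noteq> j" using im by auto
  have e: "height t ?g = h j" "height t h = h j" using height_is_se[OF j] height_is_se[OF jg] ij by auto
  have "(\<Sum>l\<in>cols t. h j - ?g l) < (\<Sum>l\<in>cols t. h j - h l)"
  proof (rule sum_strict_mono_ex1)
    show "\<exists>l\<in>cols t. h j - ?g l < h j - h l" using im hm by (intro bexI[of _ i]) auto
  qed auto
  then show ?thesis unfolding deficit_def e by simp
qed

lemma deficit_cancel:
  assumes h: "h \<in> diagrams t" and d: "\<forall>m\<in>cols t. h m \<noteq> i + 1" and i: "i + 2 \<le> height t h"
  shows "deficit t (cancel i h) < deficit t h"
proof -
  obtain j where j: "is_se t h j" using is_se_strongly_extremal by blast
  have e: "height t h = h j" "height t (cancel i h) = cancel i h j"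
    using height_is_se j is_se_cancel[OF h d j] by auto
  have "(\<Sum>l\<in>cols t. cancel i h j - cancel i h l) \<le> (\<Sum>l\<in>cols t. h j - h l)"
  proof (rule sum_mono)
    fix l assume "l \<in> cols t"
    then have "h l \<noteq> i + 1" using d by blast
    then show "cancel i h j - cancel i h l \<le> h j - h l" using i e(1) unfolding cancel_def by auto
  qed
  moreover have "cancel i h j < h j" using i e(1) unfolding cancel_def by auto
  ultimately show ?thesis unfolding deficit_def e by simp
qed

text \<open>Edges of the link graph ask for a complete reduced tableau at one end; the normalization
  has to carry both ends along.\<close>

lemma link_complete_reduced:
  assumes "link t h k"
  shows "\<exists>g. link t g k \<and> (h, g) \<in> diagram_equiv t \<and>
    (h(k := h k + 1), g(k := g k + 1)) \<in> diagram_equiv t \<and> complete t g \<and> reduced t g"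
  using assms
proof (induction "deficit t h" arbitrary: h rule: less_induct)
  case less
  have h: "h \<in> diagrams t" "h(k := h k + 1) \<in> diagrams t" using less.prems unfolding link_def by auto
  have step: ?case if g: "link t g k" "(h, g) \<in> diagram_equiv t"
      "(h(k := h k + 1), g(k := g k + 1)) \<in> diagram_equiv t" "deficit t g < deficit t h" for g
    using less.hyps[OF g(4,1)] g(2,3) diagram_equiv_trans by meson
  show ?case
  proof (cases "complete t h")
    case False
    then obtain i m where d: "domino t h i m" using complete_iff[OF h(1)] by blast
    show ?thesis by (rule step[OF link_domino[OF less.prems d] deficit_domino[OF d]])
  next
    case c: True
    show ?thesis
    proof (cases "reduced t h")
      case True
      with c less.prems h show ?thesis using diagram_equiv_refl by blast
    next
      case False
      then obtain j where "1 \<le> j" "j < height t h" "card (row t h j) = card (row t h (j + 1))"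
        unfolding reduced_def by blast
      moreover define i where "i = j - 1"
      ultimately have i: "i + 2 \<le> height t h" "card (row t h (i + 1)) = card (row t h (i + 2))" by auto
      have d: "\<forall>m\<in>cols t. h m \<noteq> i + 1" using row_eq_iff i(2) by blast
      show ?thesis by (rule step[OF link_cancel[OF less.prems d i(1)] deficit_cancel[OF h(1) d i(1)]])
    qed
  qed
qed

text \<open>At the level \<open>r\<close> of the new block, \<open>k\<close> and \<open>j\<close>
  are neighbours and the entry labels the gap between them. Before the addition \<open>k\<close>, of
  height \<open>r - 1\<close>, stops this label; afterwards \<open>j\<close> does. A second label
  stopped by \<open>k\<close> would be alive in the same gap at level \<open>r\<close>, against
  uniqueness.\<close>

lemma link_stop:
  assumes l: "link t h k" and j: "is_se t h j"
  defines "h' \<equiv> h(k := h k + 1)"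
  shows "\<exists>a\<in>{1..t}. entry t h' k (h' k) = a \<and> stop t h a k \<and> stop t h' a j \<and>
    (\<forall>b\<in>{1..t}. b \<noteq> a \<longrightarrow> (\<forall>c. stop t h b c \<longleftrightarrow> stop t h' b c))"
proof -
  define r where "r = h k + 1"
  have hj: "h j = r" and h: "h \<in> diagrams t" "h' \<in> diagrams t" and k: "is_se t h' k"
    using l j is_se_unique unfolding link_def h'_def r_def by metis+
  have hk: "h k < r" "r = Suc (h k)" "h' k = r" unfolding r_def h'_def by auto
  have jk: "j \<noteq> k" using hj hk by auto
  have h'l: "h' l = h l" if "l \<noteq> k" for l using that unfolding h'_def by simp
  have hle: "h l \<le> h' l" for l unfolding h'_def by simp
  have c: "j \<in> cols t" "k \<in> cols t" using j k unfolding is_se_def by auto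
  have sj: "h l < r" if "l \<in> cols t" "side r l j" for l using j that hj unfolding is_se_def by auto
  have sk: "h' l < r" if "l \<in> cols t" "side r l k" for l using k that hk unfolding is_se_def by auto
  have skj: "side r k j"
  proof (rule ccontr)
    assume "\<not> side r k j"
    then have "side r j k" using jk unfolding side_def by (auto split: if_splits)
    with sk[OF c(1)] h'l[OF jk] hj show False by simp
  qed
  have hmax: "h l \<le> r" if "l \<in> cols t" for l using j hj that unfolding is_se_def by auto
  \<comment> \<open>These are \<open>j\<close> and \<open>k\<close> in their order from left to
    right, since \<open>k\<close> lies on the decisive side of \<open>j\<close>.\<close>
  define p where "p = (if odd r then k else j)"
  define q where "q = (if odd r then j else k)"
  have pq: "p < q" using skj unfolding p_def q_def side_def by auto
  have strictly_between: "h l < r \<and> l \<noteq> k \<and> h' l = h l" if "p < l" "l < q" for l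
  proof -
    have "l \<in> cols t" using that c unfolding p_def q_def by (auto split: if_splits)
    moreover have "side r l j" "l \<noteq> k" using that unfolding p_def q_def side_def by (auto split: if_splits)
    ultimately show ?thesis using sj h'l by blast
  qed
  have n: "nbr t h' r p q" unfolding nbr_def using c pq strictly_between hk(3) hj h'l[OF jk]
    by (auto simp: p_def q_def)
  obtain a where a: "gap_label t h' r p q a" using gap_label_exists[OF n] by blast
  have a': "p \<le> a" "a < q" "alive t h' a r" using a unfolding gap_label_def by auto
  have at: "1 \<le> a" "a \<le> t" using gap_label_le[OF a] by auto
  have "(if odd r then p else q) = k" unfolding p_def q_def by simp
  then have entry: "entry t h' k (h' k) = a" using entry_gap_label[OF a] hk(3) by simp
  have candidate_h': "candidate t h b d" if "candidate t h' b d" "d \<noteq> k" for b d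
    using that(1) hle unfolding candidate_def h'l[OF that(2)] by (meson le_less_trans)
  have "candidate t h' a j" unfolding candidate_def h'l[OF jk] hj
  proof (intro conjI allI impI)
    show "j \<in> cols t" by (rule c)
    show "if odd r then a < j else j \<le> a" using a' unfolding p_def q_def by auto
    fix l assume "j < l \<and> l \<le> a \<or> a < l \<and> l < j"
    then have "p < l" "l < q" using a' unfolding p_def q_def by (auto split: if_splits)
    then show "h' l < r" using strictly_between by simp
  qed
  then have s1: "stop t h' a j" using a'(3) hj h'l[OF jk] unfolding stop_def alive_def by auto
  have "candidate t h a k" unfolding candidate_def
  proof (intro conjI allI impI)
    show "k \<in> cols t" by (rule c)
    show "if odd (h k) then a < k else k \<le> a" using a' hk(2) unfolding p_def q_def by auto
    fix l assume l: "k < l \<and> l \<le> a \<or> a < l \<and> l < k"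
    then have pl: "p < l" "l < q" using a' unfolding p_def q_def by (auto split: if_splits)
    show "h l < h k"
    proof (rule ccontr)
      assume "\<not> h l < h k"
      then have e: "h' l = h k" using strictly_between[OF pl] hk(2) by simp
      \<comment> \<open>A column of height \<open>h k\<close> in front of \<open>k\<close> would
        stop \<open>a\<close> below level \<open>r\<close> in \<open>h'\<close>.\<close>
      have "weak_candidate t h' a l" unfolding weak_candidate_def
      proof (intro conjI allI impI)
        show "l \<in> cols t" using pl n unfolding nbr_def by auto
        show "if odd (h' l) then a < l else l \<le> a" unfolding e using l a' hk(2) unfolding p_def q_def
          by (auto split: if_splits)
        fix m assume "l < m \<and> m \<le> a \<or> a < m \<and> m < l"
        then have "p < m" "m < q" using l a' pl by auto
        then show "h' m \<le> h' l" using strictly_between hk(2) e by fastforce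
      qed
      then show False using alive_weak_candidate[OF a'(3) at(2)] e hk by force
    qed
  qed
  moreover have "h k \<le> h b" if b: "candidate t h a b" for b
  proof (rule ccontr)
    assume nb: "\<not> h k \<le> h b"
    then have "b \<noteq> k" by auto
    have *: "h' m < h b" if "h m < h b" for m
      using that nb h'l[of m] by (cases "m = k") auto
    have "candidate t h' a b" using b * unfolding candidate_def h'l[OF \<open>b \<noteq> k\<close>] by blast
    then show False using a'(3) h'l[OF \<open>b \<noteq> k\<close>] nb hk unfolding alive_def by force
  qed
  ultimately have s2: "stop t h a k" unfolding stop_def by blast
  have other: "stop t h' b d" if b: "1 \<le> b" "b \<le> t" "b \<noteq> a" and s: "stop t h b d" for b d
  proof -
    have cd: "candidate t h b d" and min: "\<And>b'. candidate t h b b' \<Longrightarrow> h d \<le> h b'" using s unfolding stop_def by auto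
    have dc: "d \<in> cols t" using cd unfolding candidate_def by blast
    have dk: "d \<noteq> k"
    proof
      assume d: "d = k"
      have "r \<le> h' b'" if b': "candidate t h' b b'" for b'
      proof (cases "b' = k")
        case False
        have "h k \<le> h b'" "h b' \<noteq> h k"
          using min[OF candidate_h'[OF b' False]] candidate_same_height[OF candidate_h'[OF b' False] cd] d False by auto
        then show ?thesis using hk(2) h'l[OF False] by simp
      qed (use hk in simp)
      moreover have "p \<le> b \<and> b < q"
      proof -
        have "\<not> (k < j \<and> j \<le> b \<or> b < j \<and> j < k)" using cd d hj hk unfolding candidate_def by force
        then show ?thesis using cd d skj hk(2) unfolding candidate_def p_def q_def side_def
          by (auto split: if_splits)
      qed
      ultimately have "gap_label t h' r p q b" using n unfolding gap_label_def alive_def by blast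
      then show False using gap_label_unique[OF a] b by blast
    qed
    have "candidate t h' b d" unfolding candidate_def h'l[OF dk]
    proof (intro conjI allI impI)
      show "d \<in> cols t" "if odd (h d) then b < d else d \<le> b" using cd unfolding candidate_def by auto
      fix m assume m: "d < m \<and> m \<le> b \<or> b < m \<and> m < d"
      then have lt: "h m < h d" using cd unfolding candidate_def by blast
      show "h' m < h d"
      proof (cases "m = k")
        case True
        \<comment> \<open>If \<open>d\<close> had height \<open>r\<close>, its wall across the gap
          would have height \<open>r\<close> on the decisive side of \<open>j\<close>.\<close>
        have "h d \<noteq> r"
        proof
          assume dr: "h d = r"
          show False
          proof (cases "odd r")
            case o: True
            obtain p' where p': "1 \<le> p'" "p' \<le> b" "h d \<le> h p'" using stop_wall_left[OF h(1) b(1,2) s] by blast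
            have "side r p' j" using o p' m True skj cd dr unfolding side_def candidate_def by auto
            with sj[of p'] p' dr b(2) show False by auto
          next
            case o: False
            obtain p' where p': "b < p'" "p' \<le> t + 1" "h d \<le> h p'" using stop_wall_right[OF h(1) b(1,2) s] by blast
            have "side r p' j" using o p' m True skj cd dr unfolding side_def candidate_def by auto
            with sj[of p'] p' dr b(1) show False by auto
          qed
        qed
        with lt hmax[OF dc] True hk show ?thesis by simp
      qed (use lt h'l in simp)
    qed
    moreover have "h' d \<le> h' b'" if b': "candidate t h' b b'" for b'
    proof (cases "b' = k")
      case True
      then show ?thesis using hmax[OF dc] h'l[OF dk] hk by simp
    next
      case False
      then show ?thesis using min[OF candidate_h'[OF b' False]] h'l dk by simp
    qed
    ultimately show ?thesis unfolding stop_def by blast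
  qed
  have "stop t h b d \<longleftrightarrow> stop t h' b d" if b: "b \<in> {1..t}" "b \<noteq> a" for b d
  proof -
    have b': "1 \<le> b" "b \<le> t" using b by auto
    obtain d0 where "stop t h b d0" using stop_exists[OF h(1) b'] by blast
    then show ?thesis using other[OF b' b(2)] stop_unique by metis
  qed
  with entry s1 s2 at show ?thesis by (intro bexI[of _ a]) auto
qed

lemma link_ext:
  assumes ok: "ext_ok t s x e" and l: "link t h k"
  shows "link (Suc t) (ext t x e h) (psi x k)"
    "(ext t x e h)(psi x k := ext t x e h (psi x k) + 1) = ext t x e (h(k := h k + 1))"
proof -
  have k: "k \<in> cols t" by (rule link_cols[OF l])
  show e: "(ext t x e h)(psi x k := ext t x e h (psi x k) + 1) = ext t x e (h(k := h k + 1))"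
    using k by (simp add: ext_upd ext_psi)
  obtain j where j: "is_se t h j" "h j = h k + 1" and h: "h \<in> diagrams t" "h(k := h k + 1) \<in> diagrams t"
    and sk: "is_se t (h(k := h k + 1)) k" using l unfolding link_def by blast
  have "j \<in> cols t" using j unfolding is_se_def by blast
  then have "ext t x e h (psi x j) = ext t x e h (psi x k) + 1" using k j(2) by (simp add: ext_psi)
  moreover note is_se_ext[OF ok j(1)] is_se_ext[OF ok sk] diagrams_ext[OF ok h(1)] diagrams_ext[OF ok h(2)]
  ultimately show "link (Suc t) (ext t x e h) (psi x k)" unfolding link_def e by blast
qed

text \<open>Oddness gives both insertions the parity that \<open>ins_ok\<close> demands. At either
  end the partner is strongly extremal: it is column \<open>Suc s\<close> before the addition and
  column \<open>s\<close> after it.\<close>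

lemma link_new:
  assumes g: "g \<in> diagrams t" and s: "is_se t g s" and o: "odd (g s)"
  shows "ins_ok t s s (g s - 1) g" "ins_ok t s (Suc s) (g s) g"
    "link (Suc t) (ins s (g s - 1) g) s"
    "(ins s (g s - 1) g)(s := ins s (g s - 1) g s + 1) = ins (Suc s) (g s) g"
proof -
  have sc: "s \<in> cols t" using s unfolding is_se_def by blast
  show ok: "ins_ok t s s (g s - 1) g" and ok': "ins_ok t s (Suc s) (g s) g"
    using sc o unfolding ins_ok_def by auto
  have pos: "g s \<ge> 1" using o by (cases "g s") auto
  then show e: "(ins s (g s - 1) g)(s := ins s (g s - 1) g s + 1) = ins (Suc s) (g s) g"
    unfolding ins_def by (auto simp: fun_eq_iff)
  have "is_se (Suc t) (ins s (g s - 1) g) (psi s s)" "is_se (Suc t) (ins (Suc s) (g s) g) (psi (Suc s) s)"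
    using is_se_ins ok ok' s by blast+
  moreover have "psi (Suc s) s = s" unfolding psi_def by simp
  moreover have "ins s (g s - 1) g (psi s s) = ins s (g s - 1) g s + 1" using pos by simp
  moreover have "ins s (g s - 1) g \<in> diagrams (Suc t)" "ins (Suc s) (g s) g \<in> diagrams (Suc t)"
    using diagrams_ins_iff[OF ok] diagrams_ins_iff[OF ok'] g by auto
  ultimately show "link (Suc t) (ins s (g s - 1) g) s" unfolding link_def e by metis
qed

section \<open>The inductively constructed graph\<close>

definition down :: "nat \<Rightarrow> nat \<Rightarrow> nat rel \<Rightarrow> nat rel" where
  "down n s prec = {(a, b). a \<in> {1..n} \<and> b \<in> {1..n} \<and> (psi s a, psi s b) \<in> prec}"

lemma strict_linear_order_asym:
  assumes so: "strict_linear_order_on T prec" and ab: "(a, b) \<in> prec"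
  shows "(b, a) \<notin> prec"
proof
  assume "(b, a) \<in> prec"
  moreover have "trans prec" "irrefl prec" using so unfolding strict_linear_order_on_def by auto
  ultimately show False using ab transD[of prec a b a] irreflD[of prec a] by blast
qed

lemma largest_unique:
  assumes so: "strict_linear_order_on T prec" and s: "s \<in> T" "\<forall>a\<in>T. a \<noteq> s \<longrightarrow> (a, s) \<in> prec"
  shows "largest T prec = s"
  unfolding largest_def
proof (rule the_equality)
  fix s' assume "s' \<in> T \<and> (\<forall>a\<in>T. a \<noteq> s' \<longrightarrow> (a, s') \<in> prec)"
  then show "s' = s" using s strict_linear_order_asym[OF so, of s s'] by (cases "s' = s") auto
qed (use s in blast)

lemma greatest_exists:
  assumes "finite A" "A \<noteq> {}" "trans r" "total_on A r"
  shows "\<exists>s\<in>A. \<forall>a\<in>A. a \<noteq> s \<longrightarrow> (a, s) \<in> r"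
  using assms(1,2,4)
proof (induction rule: finite_ne_induct)
  case (insert x F)
  then have "total_on F r" unfolding total_on_def by blast
  then obtain s where s: "s \<in> F" "\<forall>a\<in>F. a \<noteq> s \<longrightarrow> (a, s) \<in> r" using insert.IH by blast
  have "x \<noteq> s" using insert.hyps(3) s(1) by blast
  then have "(x, s) \<in> r \<or> (s, x) \<in> r" using insert.prems s(1) unfolding total_on_def by blast
  then show ?case
  proof
    assume "(x, s) \<in> r"
    with s show ?thesis by (intro bexI[of _ s]) auto
  next
    assume sx: "(s, x) \<in> r"
    have "(a, x) \<in> r" if "a \<in> F" for a
      using s(2) that sx assms(3) by (cases "a = s") (auto dest: transD)
    then show ?thesis by (intro bexI[of _ x]) auto
  qed
qed simp

lemma largest_props:
  assumes so: "strict_linear_order_on {1..Suc n} prec"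
  defines "s \<equiv> largest {1..Suc n} prec"
  shows "1 \<le> s" "s \<le> n + 1" "\<And>a. a \<in> {1..Suc n} \<Longrightarrow> a \<noteq> s \<Longrightarrow> (a, s) \<in> prec" "(s, a) \<in> prec \<Longrightarrow> a \<notin> {1..Suc n}"
proof -
  have "finite {1..Suc n}" "{1..Suc n} \<noteq> {}" "trans prec" "total_on {1..Suc n} prec"
    using so unfolding strict_linear_order_on_def by auto
  then obtain s' where s': "s' \<in> {1..Suc n}" "\<forall>a\<in>{1..Suc n}. a \<noteq> s' \<longrightarrow> (a, s') \<in> prec"
    using greatest_exists by metis
  have e: "s = s'" unfolding s_def by (rule largest_unique[OF so s'])
  show "1 \<le> s" "s \<le> n + 1" "\<And>a. a \<in> {1..Suc n} \<Longrightarrow> a \<noteq> s \<Longrightarrow> (a, s) \<in> prec" using s' unfolding e by auto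
  show "(s, a) \<in> prec \<Longrightarrow> a \<notin> {1..Suc n}"
    using s'(2) strict_linear_order_asym[OF so, of s' a] unfolding e by (cases "a = s'") auto
qed

lemma strict_linear_order_down:
  assumes so: "strict_linear_order_on {1..Suc n} prec" and s: "1 \<le> s" "s \<le> n + 1"
  shows "strict_linear_order_on {1..n} (down n s prec)"
proof -
  have t: "trans prec" "irrefl prec" "total_on {1..Suc n} prec" using so unfolding strict_linear_order_on_def by auto
  have "trans (down n s prec)" using t(1) unfolding down_def trans_def by blast
  moreover have "irrefl (down n s prec)" using t(2) unfolding down_def irrefl_def by blast
  moreover have "total_on {1..n} (down n s prec)" unfolding total_on_def
  proof (intro ballI impI)
    fix a b assume ab: "a \<in> {1..n}" "b \<in> {1..n}" "a \<noteq> b"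
    then have "psi s a \<in> {1..Suc n}" "psi s b \<in> {1..Suc n}" "psi s a \<noteq> psi s b" using psi_labels[OF s] by auto
    then have "(psi s a, psi s b) \<in> prec \<or> (psi s b, psi s a) \<in> prec" using t(3) unfolding total_on_def by blast
    with ab show "(a, b) \<in> down n s prec \<or> (b, a) \<in> down n s prec" unfolding down_def by blast
  qed
  ultimately show ?thesis unfolding strict_linear_order_on_def by blast
qed

text \<open>The same recursion as \<open>ind_graph\<close>, but started from the one-vertex graph at \<open>t = 0\<close>, so that
  inductions need no separate treatment of \<open>t = 1\<close>.\<close>

fun cube :: "nat \<Rightarrow> nat rel \<Rightarrow> bool list lgraph" where
  "cube 0 prec = \<lparr>verts = {[]}, vlabel = (\<lambda>_. 1), edges = {}\<rparr>"
| "cube (Suc n) prec =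
     (let s = largest {1..Suc n} prec; G = cube n (down n s prec)
      in \<lparr>verts = Cons True ` verts G \<union> Cons False ` verts G,
          vlabel = (\<lambda>w. if hd w then psi s (vlabel G (tl w)) else psi (s + 1) (vlabel G (tl w))),
          edges = {(Cons True ` e, psi s a) | e a. (e, a) \<in> edges G} \<union>
                  {(Cons False ` e, psi s a) | e a. (e, a) \<in> edges G} \<union>
                  {({True # v, False # v}, s) | v. v \<in> verts G \<and> psi s (vlabel G v) = s + 1}\<rparr>)"

lemma ind_graph_cube:
  "verts (ind_graph (Suc n) prec) = verts (cube (Suc n) prec) \<and>
   edges (ind_graph (Suc n) prec) = edges (cube (Suc n) prec) \<and>
   (\<forall>v\<in>verts (cube (Suc n) prec). vlabel (ind_graph (Suc n) prec) v = vlabel (cube (Suc n) prec) v)"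
proof (induction n arbitrary: prec)
  case 0
  have "largest {1..Suc 0} prec = 1" unfolding largest_def by (rule the_equality) auto
  then show ?case by (auto simp: Let_def psi_def insert_commute)
next
  case (Suc n)
  define s where "s = largest {1..Suc (Suc n)} prec"
  have e: "{(a, b). a \<in> {1..Suc (Suc n) - 1} \<and> b \<in> {1..Suc (Suc n) - 1} \<and> (psi s a, psi s b) \<in> prec} = down (Suc n) s prec"
    unfolding down_def by simp
  note IH = Suc.IH[of "down (Suc n) s prec"]
  show ?case
    unfolding ind_graph.simps(3) cube.simps(2)[of "Suc n"] Let_def s_def[symmetric] e
    using IH by (auto simp del: cube.simps ind_graph.simps)
qed

section \<open>Representative diagrams of the vertices\<close>

text \<open>The position of the new column is chosen so that the shift of columns equals the
  relabelling of vertices in each copy; the strongly extremal column is then the vertex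
  label.\<close>

fun cube_diagram :: "nat \<Rightarrow> nat rel \<Rightarrow> bool list \<Rightarrow> diagram" where
  "cube_diagram 0 prec v = (\<lambda>_. 0)"
| "cube_diagram (Suc n) prec v =
     (let s = largest {1..Suc n} prec; g = cube_diagram n (down n s prec) (tl v)
      in if hd v then ext n s 2 g else ext n (Suc s) 1 g)"

lemma diagrams_cube_diagram:
  "strict_linear_order_on {1..n} prec \<Longrightarrow> cube_diagram n prec v \<in> diagrams n"
proof (induction n arbitrary: prec v)
  case 0
  then show ?case by (auto simp: diagrams_iff)
next
  case (Suc n)
  define s where "s = largest {1..Suc n} prec"
  note s = largest_props[OF Suc.prems, folded s_def]
  have "cube_diagram n (down n s prec) (tl v) \<in> diagrams n"
    by (rule Suc.IH[OF strict_linear_order_down[OF Suc.prems s(1,2)]])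
  moreover have "ext_ok n s s 2" "ext_ok n s (Suc s) 1" using s unfolding ext_ok_def by auto
  ultimately show ?case using diagrams_ext unfolding cube_diagram.simps Let_def s_def[symmetric] by simp
qed

lemma cube_diagram_Suc:
  assumes so: "strict_linear_order_on {1..Suc n} prec"
  defines "s \<equiv> largest {1..Suc n} prec"
  obtains x e g where "ext_ok n s x e" "g = cube_diagram n (down n s prec) (tl v)" "g \<in> diagrams n"
    "cube_diagram (Suc n) prec v = ext n x e g" "x = (if hd v then s else Suc s)" "e = (if hd v then 2 else 1)"
    "vlabel (cube (Suc n) prec) v = psi x (vlabel (cube n (down n s prec)) (tl v))"
proof -
  note s = largest_props[OF so, folded s_def]
  show ?thesis
  proof (rule that[of "if hd v then s else Suc s" "if hd v then 2 else 1" "cube_diagram n (down n s prec) (tl v)"])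
    show "ext_ok n s (if hd v then s else Suc s) (if hd v then 2 else 1)" using s unfolding ext_ok_def by auto
    show "cube_diagram n (down n s prec) (tl v) \<in> diagrams n" by (rule diagrams_cube_diagram[OF strict_linear_order_down[OF so s(1,2)]])
    show "cube_diagram (Suc n) prec v =
        ext n (if hd v then s else Suc s) (if hd v then 2 else 1) (cube_diagram n (down n s prec) (tl v))"
      unfolding cube_diagram.simps Let_def s_def[symmetric] by simp
    show "vlabel (cube (Suc n) prec) v =
        psi (if hd v then s else Suc s) (vlabel (cube n (down n s prec)) (tl v))"
      unfolding cube.simps Let_def s_def[symmetric] by simp
  qed auto
qed

lemma verts_cube: "verts (cube n prec) = {v. length v = n}"
proof (induction n arbitrary: prec)
  case (Suc n)
  show ?case by (auto simp: Let_def Suc.IH length_Suc_conv)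
qed simp

lemma is_se_cube_diagram:
  "strict_linear_order_on {1..n} prec \<Longrightarrow> length v = n \<Longrightarrow> is_se n (cube_diagram n prec v) (vlabel (cube n prec) v)"
proof (induction n arbitrary: prec v)
  case 0
  then show ?case by (auto simp: is_se_def side_def)
next
  case (Suc n)
  define s where "s = largest {1..Suc n} prec"
  note s = largest_props[OF Suc.prems(1), folded s_def]
  obtain x e g where d: "ext_ok n s x e" "g = cube_diagram n (down n s prec) (tl v)"
    "cube_diagram (Suc n) prec v = ext n x e g"
    "vlabel (cube (Suc n) prec) v = psi x (vlabel (cube n (down n s prec)) (tl v))"
    using cube_diagram_Suc[OF Suc.prems(1), of v, folded s_def] by blast
  have "is_se n g (vlabel (cube n (down n s prec)) (tl v))"
    unfolding d(2) by (rule Suc.IH[OF strict_linear_order_down[OF Suc.prems(1) s(1,2)]]) (use Suc.prems in simp)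
  then show ?case unfolding d(3,4) by (rule is_se_ext[OF d(1)])
qed

lemma stop_pad:
  assumes "g \<in> diagrams t" "1 \<le> a" "a \<le> t"
  shows "stop t (pad t g) a c \<longleftrightarrow> stop t g a c"
  using stop_move[OF move_pad] assms by blast

lemma stop_ext:
  assumes "ext_ok t s x e" "g \<in> diagrams t" "1 \<le> a" "a \<le> t"
  shows "stop (Suc t) (ext t x e g) (psi s a) c' \<longleftrightarrow> (\<exists>c. c' = psi x c \<and> stop t g a c)"
  unfolding ext_def stop_ins[OF ext_ins_ok[OF assms(1)]] stop_pad[OF assms(2-4)] ..

lemma stop_ext_new:
  assumes "ext_ok t s x e"
  shows "stop (Suc t) (ext t x e g) s c \<longleftrightarrow> c = x"
  unfolding ext_def using stop_ins_new[OF ext_ins_ok[OF assms]] stop_unique by blast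

text \<open>The stop of the largest label reveals the head of the list; the stops of the other
  labels are shifted stops of the tail.\<close>

lemma cube_diagram_inj:
  assumes "strict_linear_order_on {1..n} prec" "length v = n" "length w = n"
    "\<And>a c. a \<in> {1..n} \<Longrightarrow> stop n (cube_diagram n prec v) a c \<longleftrightarrow> stop n (cube_diagram n prec w) a c"
  shows "v = w"
  using assms
proof (induction n arbitrary: prec v w)
  case (Suc n)
  define s where "s = largest {1..Suc n} prec"
  note s = largest_props[OF Suc.prems(1), folded s_def]
  obtain x e g where d: "ext_ok n s x e" "g = cube_diagram n (down n s prec) (tl v)" "g \<in> diagrams n"
    "cube_diagram (Suc n) prec v = ext n x e g" "x = (if hd v then s else Suc s)"
    using cube_diagram_Suc[OF Suc.prems(1), of v, folded s_def] by blast
  obtain x' e' g' where d': "ext_ok n s x' e'" "g' = cube_diagram n (down n s prec) (tl w)" "g' \<in> diagrams n"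
    "cube_diagram (Suc n) prec w = ext n x' e' g'" "x' = (if hd w then s else Suc s)"
    using cube_diagram_Suc[OF Suc.prems(1), of w, folded s_def] by blast
  note same = Suc.prems(4)[unfolded d(4) d'(4)]
  have "s \<in> {1..Suc n}" using s by simp
  then have x: "x = x'" using same[of s x] stop_ext_new[OF d(1)] stop_ext_new[OF d'(1)] by blast
  then have hd: "hd v = hd w" unfolding d(5) d'(5) by (auto split: if_splits)
  have "stop n g a c \<longleftrightarrow> stop n g' a c" if a: "a \<in> {1..n}" for a c
  proof -
    have a': "1 \<le> a" "a \<le> n" "psi s a \<in> {1..Suc n}" using a psi_labels[OF s(1,2)] by auto
    have "(\<exists>d. psi x c = psi x d \<and> stop n g a d) \<longleftrightarrow> (\<exists>d. psi x c = psi x' d \<and> stop n g' a d)"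
      using same[OF a'(3), of "psi x c"] stop_ext[OF d(1,3) a'(1,2)] stop_ext[OF d'(1,3) a'(1,2)] by simp
    then show ?thesis by (simp add: x)
  qed
  then have "tl v = tl w" unfolding d(2) d'(2)
    using Suc.IH[OF strict_linear_order_down[OF Suc.prems(1) s(1,2)]] Suc.prems(2,3) by simp
  with hd Suc.prems(2,3) show ?case by (cases v; cases w) auto
qed simp

section \<open>Edges of the cube and links\<close>

text \<open>The two shifts differ only at \<open>s\<close>, and the value of each there is the one
  that the other omits.\<close>

lemma psi_psi_Suc_eq: "psi s d = psi (Suc s) d' \<Longrightarrow> d = d'"
  unfolding psi_def by (auto split: if_splits)

text \<open>Different heads give \<open>s\<close> different stops, so the exceptional label is
  \<open>s\<close>. Its stop at \<open>w\<close> is \<open>Suc s\<close>, which is the condition on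
  the label of \<open>v\<close>; agreement of all other stops makes the tails equal.\<close>

lemma cube_edge_across:
  assumes so: "strict_linear_order_on {1..Suc n} prec" and len: "length v = Suc n" "length w = Suc n"
    and hd: "hd v" "\<not> hd w"
    and same: "\<And>b c. b \<in> {1..Suc n} \<Longrightarrow> b \<noteq> a \<Longrightarrow> stop (Suc n) (cube_diagram (Suc n) prec v) b c \<longleftrightarrow> stop (Suc n) (cube_diagram (Suc n) prec w) b c"
    and a: "stop (Suc n) (cube_diagram (Suc n) prec w) a (vlabel (cube (Suc n) prec) v)"
  shows "({v, w}, a) \<in> edges (cube (Suc n) prec)"
proof -
  define s where "s = largest {1..Suc n} prec"
  note s = largest_props[OF so, folded s_def]
  obtain e g where d: "ext_ok n s s e" "g = cube_diagram n (down n s prec) (tl v)" "g \<in> diagrams n"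
    "cube_diagram (Suc n) prec v = ext n s e g"
    "vlabel (cube (Suc n) prec) v = psi s (vlabel (cube n (down n s prec)) (tl v))"
    using cube_diagram_Suc[OF so, of v, folded s_def] hd by metis
  obtain e' g' where d': "ext_ok n s (Suc s) e'" "g' = cube_diagram n (down n s prec) (tl w)" "g' \<in> diagrams n"
    "cube_diagram (Suc n) prec w = ext n (Suc s) e' g'"
    using cube_diagram_Suc[OF so, of w, folded s_def] hd by metis
  have as: "a = s"
  proof (rule ccontr)
    assume "a \<noteq> s"
    then have "s = Suc s" using same[of s s] s stop_ext_new[OF d(1)] stop_ext_new[OF d'(1)] unfolding d(4) d'(4) by auto
    then show False by simp
  qed
  have gap_label: "psi s (vlabel (cube n (down n s prec)) (tl v)) = s + 1"
    using a unfolding as d'(4) stop_ext_new[OF d'(1)] d(5) by simp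
  have "stop n g b c \<longleftrightarrow> stop n g' b c" if b: "b \<in> {1..n}" for b c
  proof -
    have b': "1 \<le> b" "b \<le> n" "psi s b \<in> {1..Suc n}" using b psi_labels[OF s(1,2)] by auto
    have q: "stop (Suc n) (ext n s e g) (psi s b) y \<longleftrightarrow> stop (Suc n) (ext n (Suc s) e' g') (psi s b) y" for y
      using same[OF b'(3), of y] unfolding as d(4) d'(4) by simp
    note st = stop_ext[OF d(1,3) b'(1,2)] stop_ext[OF d'(1,3) b'(1,2)]
    have f: "stop n g' b c" if "stop n g b c" for c
      using q[of "psi s c"] that unfolding st by (metis psi_psi_Suc_eq)
    obtain c0 where c0: "stop n g b c0" using stop_exists[OF d(3) b'(1,2)] by blast
    show ?thesis using f c0 stop_unique by metis
  qed
  then have tl: "tl v = tl w" unfolding d(2) d'(2)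
    using cube_diagram_inj[OF strict_linear_order_down[OF so s(1,2)]] len by simp
  have "v = True # tl v" "w = False # tl v" using len hd tl by (cases v; cases w; auto)+
  moreover have "tl v \<in> verts (cube n (down n s prec))" unfolding verts_cube using len by simp
  ultimately show ?thesis using gap_label unfolding cube.simps Let_def s_def[symmetric] as by auto
qed

text \<open>The hypotheses have the form in which \<open>link_stop\<close> describes a link, so this
  brings edges of the link graph back to the cube.\<close>

lemma cube_edge_of_stop:
  assumes "strict_linear_order_on {1..n} prec" "length v = n" "length w = n" "a \<in> {1..n}"
    "\<And>b c. b \<in> {1..n} \<Longrightarrow> b \<noteq> a \<Longrightarrow> stop n (cube_diagram n prec v) b c \<longleftrightarrow> stop n (cube_diagram n prec w) b c"
    "stop n (cube_diagram n prec v) a (vlabel (cube n prec) w)" "stop n (cube_diagram n prec w) a (vlabel (cube n prec) v)"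
  shows "({v, w}, a) \<in> edges (cube n prec)"
  using assms
proof (induction n arbitrary: prec v w a)
  case (Suc n)
  define s where "s = largest {1..Suc n} prec"
  note s = largest_props[OF Suc.prems(1), folded s_def]
  show ?case
  proof (cases "hd v = hd w")
    case False
    then consider "hd v" "\<not> hd w" | "hd w" "\<not> hd v" by blast
    then show ?thesis
    proof cases
      case 1
      then show ?thesis using cube_edge_across[OF Suc.prems(1,2,3) 1, of a] Suc.prems(5,7) by blast
    next
      case 2
      then have "({w, v}, a) \<in> edges (cube (Suc n) prec)"
        using cube_edge_across[OF Suc.prems(1,3,2) 2, of a] Suc.prems(5,6) by blast
      then show ?thesis by (simp add: insert_commute)
    qed
  next
    case hd: True
    obtain x e g where d: "ext_ok n s x e" "g = cube_diagram n (down n s prec) (tl v)" "g \<in> diagrams n"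
      "cube_diagram (Suc n) prec v = ext n x e g" "x = (if hd v then s else Suc s)" "e = (if hd v then 2 else 1)"
      "vlabel (cube (Suc n) prec) v = psi x (vlabel (cube n (down n s prec)) (tl v))"
      using cube_diagram_Suc[OF Suc.prems(1), of v, folded s_def] by blast
    obtain g' where d': "g' = cube_diagram n (down n s prec) (tl w)" "g' \<in> diagrams n"
      "cube_diagram (Suc n) prec w = ext n x e g'"
      "vlabel (cube (Suc n) prec) w = psi x (vlabel (cube n (down n s prec)) (tl w))"
      using cube_diagram_Suc[OF Suc.prems(1), of w, folded s_def] d(5,6) hd by metis
    \<comment> \<open>The stop of \<open>s\<close> is \<open>x\<close>, whereas the vertex labels of
      this copy are values of \<open>psi x\<close>.\<close>
    have "a \<noteq> s" using Suc.prems(6) unfolding d(4) d'(4) using stop_ext_new[OF d(1)] by auto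
    then obtain a0 where a0: "a = psi s a0" using psi_cases by blast
    have ab: "a0 \<in> {1..n}" using Suc.prems(4) psi_labels[OF s(1,2)] unfolding a0 by blast
    then have a1: "1 \<le> a0" "a0 \<le> n" by auto
    have so': "strict_linear_order_on {1..n} (down n s prec)" by (rule strict_linear_order_down[OF Suc.prems(1) s(1,2)])
    have "({tl v, tl w}, a0) \<in> edges (cube n (down n s prec))"
    proof (rule Suc.IH[OF so' _ _ ab])
      show "length (tl v) = n" "length (tl w) = n" using Suc.prems(2,3) by auto
      show "stop n (cube_diagram n (down n s prec) (tl v)) a0 (vlabel (cube n (down n s prec)) (tl w))"
        using Suc.prems(6) stop_ext[OF d(1,3) a1] unfolding d(4) d'(4) a0 d(2) by auto
      show "stop n (cube_diagram n (down n s prec) (tl w)) a0 (vlabel (cube n (down n s prec)) (tl v))"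
        using Suc.prems(7) stop_ext[OF d(1) d'(2) a1] unfolding d(7) d'(3) a0 d'(1) by auto
      fix b c assume b: "b \<in> {1..n}" "b \<noteq> a0"
      then have b': "1 \<le> b" "b \<le> n" "psi s b \<in> {1..Suc n}" "psi s b \<noteq> a" using psi_labels[OF s(1,2)] a0 by auto
      show "stop n (cube_diagram n (down n s prec) (tl v)) b c \<longleftrightarrow> stop n (cube_diagram n (down n s prec) (tl w)) b c"
        using Suc.prems(5)[OF b'(3,4), of "psi x c"] stop_ext[OF d(1,3) b'(1,2)] stop_ext[OF d(1) d'(2) b'(1,2)]
        unfolding d(4) d'(3) d(2) d'(1) by simp
    qed
    then have e: "(Cons (hd v) ` {tl v, tl w}, a) \<in> edges (cube (Suc n) prec)"
      unfolding cube.simps Let_def s_def[symmetric] a0 by (cases "hd v") auto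
    have "v = hd v # tl v" "w = hd v # tl w" using Suc.prems(2,3) hd by (cases v; cases w; auto)+
    then have "Cons (hd v) ` {tl v, tl w} = {v, w}" by (metis image_empty image_insert)
    with e show ?thesis by simp
  qed
qed simp

text \<open>An extremal column other than \<open>j\<close> would be tied with \<open>j\<close> in
  \<open>g\<close>; then \<open>j\<close> lies on its decisive side and, once raised, destroys its
  extremality.\<close>

lemma diagrams_half:
  assumes g: "g \<in> diagrams t" and se: "is_se t g j"
  shows "g(j := g j + 1) \<in> diagrams t" (is "?h \<in> _")
  unfolding diagrams_iff
proof (intro conjI ballI allI impI)
  fix l assume "l \<notin> cols t" then show "?h l = 0" using g se by (auto simp: diagrams_iff is_se_def)
next
  fix l m assume l: "l \<in> cols t" and ex: "\<forall>k\<in>cols t. side (?h l) k l \<longrightarrow> ?h k < ?h l" and m: "m \<in> cols t"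
  have jc: "j \<in> cols t" and max: "\<And>k. k \<in> cols t \<Longrightarrow> g k \<le> g j" and sd: "\<And>k. k \<in> cols t \<Longrightarrow> side (g j) k j \<Longrightarrow> g k < g j"
    using se unfolding is_se_def by auto
  show "?h m \<le> ?h l"
  proof (cases "l = j")
    case True
    then show ?thesis using max[OF m] by auto
  next
    case False
    have "g k < g l" if "k \<in> cols t" "side (g l) k l" for k
      using ex that False by (cases "k = j") auto
    then have "g j \<le> g l" using diagrams_extremal[OF g l] jc by blast
    then have e: "g l = g j" using max[OF l] by simp
    then have "\<not> side (g j) l j" using sd[OF l] by auto
    then have "side (g l) j l" using False e unfolding side_def by (auto split: if_splits)
    then have "?h j < ?h l" using ex jc False by auto
    with e False show ?thesis by simp
  qed
qed

text \<open>The last conjunct identifies the edge label: along a link only the entry of the added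
  block can change its stop.\<close>

lemma cube_edge_link:
  assumes "strict_linear_order_on {1..n} prec" "(E, a) \<in> edges (cube n prec)"
  shows "\<exists>v w h k. E = {v, w} \<and> length v = n \<and> length w = n \<and> link n h k \<and>
    (cube_diagram n prec v, h) \<in> diagram_equiv n \<and> (cube_diagram n prec w, h(k := h k + 1)) \<in> diagram_equiv n \<and>
    a \<in> {1..n} \<and> (\<exists>c. stop n (cube_diagram n prec v) a c \<and> \<not> stop n (cube_diagram n prec w) a c)"
  using assms
proof (induction n arbitrary: prec E a)
  case (Suc n)
  define s where "s = largest {1..Suc n} prec"
  note s = largest_props[OF Suc.prems(1), folded s_def]
  let ?G = "cube n (down n s prec)"
  have so': "strict_linear_order_on {1..n} (down n s prec)" by (rule strict_linear_order_down[OF Suc.prems(1) s(1,2)])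
  have cube_diagram_Cons: "cube_diagram (Suc n) prec (b # v) = ext n (if b then s else Suc s) (if b then 2 else 1) (cube_diagram n (down n s prec) v)" for b v
    unfolding cube_diagram.simps Let_def s_def[symmetric] by simp
  have eok: "ext_ok n s (if b then s else Suc s) (if b then 2 else 1)" for b
    using s unfolding ext_ok_def by auto
  from Suc.prems(2) consider (copy) b E0 a0 where "E = Cons b ` E0" "a = psi s a0" "(E0, a0) \<in> edges ?G"
    | (across) v where "E = {True # v, False # v}" "a = s" "v \<in> verts ?G" "psi s (vlabel ?G v) = s + 1"
    unfolding cube.simps Let_def s_def[symmetric] by auto
  then show ?case
  proof cases
    case copy
    obtain v w h k c where IH: "E0 = {v, w}" "length v = n" "length w = n" "link n h k"
      "(cube_diagram n (down n s prec) v, h) \<in> diagram_equiv n"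
      "(cube_diagram n (down n s prec) w, h(k := h k + 1)) \<in> diagram_equiv n" "a0 \<in> {1..n}"
      "stop n (cube_diagram n (down n s prec) v) a0 c" "\<not> stop n (cube_diagram n (down n s prec) w) a0 c"
      using Suc.IH[OF so' copy(3)] by blast
    define x e where "x = (if b then s else Suc s)" and "e = (if b then 2 else 1::nat)"
    have ok: "ext_ok n s x e" unfolding x_def e_def by (rule eok)
    note dC = cube_diagram_Cons[of b, folded x_def e_def]
    note l = link_ext[OF ok IH(4)]
    have a1: "1 \<le> a0" "a0 \<le> n" using IH(7) by auto
    have E: "E = {b # v, b # w}" using copy(1) IH(1) by simp
    have "(cube_diagram (Suc n) prec (b # v), ext n x e h) \<in> diagram_equiv (Suc n)"
      unfolding dC by (rule ext_equiv[OF ok IH(5)])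
    moreover have "(cube_diagram (Suc n) prec (b # w), (ext n x e h)(psi x k := ext n x e h (psi x k) + 1)) \<in> diagram_equiv (Suc n)"
      unfolding dC l(2) by (rule ext_equiv[OF ok IH(6)])
    moreover have "a \<in> {1..Suc n}" unfolding copy(2) using psi_labels[OF s(1,2)] IH(7) by blast
    moreover have "stop (Suc n) (cube_diagram (Suc n) prec (b # v)) a (psi x c)" "\<not> stop (Suc n) (cube_diagram (Suc n) prec (b # w)) a (psi x c)"
      unfolding dC copy(2) stop_ext[OF ok diagrams_cube_diagram[OF so'] a1] using IH(8,9) by auto
    moreover have "length (b # v) = Suc n" "length (b # w) = Suc n" using IH by auto
    ultimately show ?thesis using E l(1) by blast
  next
    case across
    have lv: "length v = n" using across(3) unfolding verts_cube by simp
    have "vlabel ?G v = s" using across(4) unfolding psi_def by (auto split: if_splits)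
    then have se: "is_se n (cube_diagram n (down n s prec) v) s" using is_se_cube_diagram[OF so' lv] by simp
    define g where "g = cube_diagram n (down n s prec) v"
    have gd: "g \<in> diagrams n" unfolding g_def by (rule diagrams_cube_diagram[OF so'])
    \<comment> \<open>\<open>link_new\<close> asks for odd height at \<open>s\<close>; an even
      height is corrected by a half-domino, which stays in the class.\<close>
    obtain g' where g': "(g, g') \<in> diagram_equiv n" "is_se n g' s" "odd (g' s)" "g' \<in> diagrams n"
    proof (cases "odd (g s)")
      case True
      then show ?thesis using that[of g] gd se g_def diagram_equiv_refl by blast
    next
      case False
      have d: "g(s := g s + 1) \<in> diagrams n" using diagrams_half[OF gd] se g_def by blast
      have "half_domino n g (g(s := g s + 1))" unfolding half_domino_iff using se g_def by blast
      then have "move n g (g(s := g s + 1))" using gd d unfolding move_def by blast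
      then show ?thesis using that[of "g(s := g s + 1)"] False d is_se_half se g_def move_equiv by auto
    qed
    note L = link_new[OF g'(4,2,3)]
    have ok: "ext_ok n s s 2" "ext_ok n s (Suc s) 1" using eok[of True] eok[of False] by auto
    have dT: "cube_diagram (Suc n) prec (True # v) = ext n s 2 g" "cube_diagram (Suc n) prec (False # v) = ext n (Suc s) 1 g"
      using cube_diagram_Cons[of True v] cube_diagram_Cons[of False v] unfolding g_def by (simp_all del: cube_diagram.simps)
    have "(ext n s 2 g, ins s (g' s - 1) g') \<in> diagram_equiv (Suc n)"
      "(ext n (Suc s) 1 g, ins (Suc s) (g' s) g') \<in> diagram_equiv (Suc n)"
      using diagram_equiv_trans[OF ext_equiv[OF ok(1) g'(1)] diagram_equiv_sym[OF ins_equiv_ext[OF g'(4) L(1) ok(1)]]]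
        diagram_equiv_trans[OF ext_equiv[OF ok(2) g'(1)] diagram_equiv_sym[OF ins_equiv_ext[OF g'(4) L(2) ok(2)]]]
      by blast+
    then have "(cube_diagram (Suc n) prec (True # v), ins s (g' s - 1) g') \<in> diagram_equiv (Suc n)"
      "(cube_diagram (Suc n) prec (False # v), (ins s (g' s - 1) g')(s := ins s (g' s - 1) g' s + 1)) \<in> diagram_equiv (Suc n)"
      unfolding dT L(4) by auto
    moreover have "stop (Suc n) (cube_diagram (Suc n) prec (True # v)) a s" "\<not> stop (Suc n) (cube_diagram (Suc n) prec (False # v)) a s"
      unfolding dT across(2) stop_ext_new[OF ok(1)] stop_ext_new[OF ok(2)] by auto
    moreover have "a \<in> {1..Suc n}" using s across(2) by simp
    moreover have "length (True # v) = Suc n" "length (False # v) = Suc n" using lv by auto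
    ultimately show ?thesis using across(1) L(3) by blast
  qed
qed simp

section \<open>Surjectivity and complete representatives\<close>

lemma diagram_equiv_0:
  assumes "h \<in> diagrams 0" shows "(\<lambda>_. 0, h) \<in> diagram_equiv 0"
  using assms
proof (induction "h 1" arbitrary: h)
  case 0
  then have "h = (\<lambda>_. 0)" by (auto simp: diagrams_iff fun_eq_iff) (metis One_nat_def le_antisym not_less_eq_eq)
  with 0 show ?case by (simp add: diagram_equiv_refl)
next
  case (Suc m)
  let ?g = "h(1 := m)"
  have g: "?g \<in> diagrams 0" using Suc.prems by (auto simp: diagrams_iff)
  have "is_se 0 ?g 1" by (auto simp: is_se_def side_def)
  moreover have "h = ?g(1 := ?g 1 + 1)" using Suc.hyps(2) by auto
  ultimately have "half_domino 0 ?g h" unfolding half_domino_iff by blast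
  then have "move 0 ?g h" using g Suc.prems unfolding move_def by blast
  moreover have "(\<lambda>_. 0, ?g) \<in> diagram_equiv 0" using Suc.hyps(1)[of ?g] g by simp
  ultimately show ?case using move_equiv diagram_equiv_trans by blast
qed

lemma min_prop_cube_diagram:
  assumes "strict_linear_order_on {1..n} prec" "h \<in> diagrams n" "min_prop n prec h"
  shows "\<exists>v. length v = n \<and> (cube_diagram n prec v, h) \<in> diagram_equiv n"
  using assms
proof (induction n arbitrary: prec h)
  case 0
  then show ?case using diagram_equiv_0 by simp
next
  case (Suc n)
  define s where "s = largest {1..Suc n} prec"
  note s = largest_props[OF Suc.prems(1), folded s_def]
  have s': "1 \<le> s" "s \<le> Suc n" "s \<in> {1..Suc n}" using s by auto
  have so': "strict_linear_order_on {1..n} (down n s prec)" by (rule strict_linear_order_down[OF Suc.prems(1) s(1,2)])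
  obtain x where x: "stop (Suc n) h s x" using stop_exists[OF Suc.prems(2) s'(1,2)] by blast
  \<comment> \<open>Applied to the labels \<open>s - 1\<close> and \<open>s + 1\<close>, this makes
    columns \<open>s\<close> and \<open>Suc s\<close> at least as high as the stop, which must then
    be one of them. At the two borders, where such a label is missing, the walls replace it.\<close>
  have sep: "\<exists>l. min s b < l \<and> l \<le> max s b \<and> h x \<le> h l" if "b \<in> {1..Suc n}" "b \<noteq> s" for b
    using min_propD[OF Suc.prems(3) x s'(3) that(1)] s(4)[of b] that by (metis not_le)
  have hs: "h x \<le> h s"
  proof (cases "s = 1")
    case True
    then show ?thesis using stop_wall_left[OF Suc.prems(2) s'(1,2) x] by (metis le_antisym)
  next
    case False
    then have "s - 1 \<in> {1..Suc n}" "s - 1 \<noteq> s" using s'(1,2) by auto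
    then obtain l where l: "min s (s - 1) < l" "l \<le> max s (s - 1)" "h x \<le> h l" using sep by blast
    then have "l = s" using s'(1) by auto
    with l show ?thesis by simp
  qed
  have hs1: "h x \<le> h (Suc s)"
  proof (cases "s = Suc n")
    case True
    then show ?thesis using stop_wall_right[OF Suc.prems(2) s'(1,2) x]
      by (metis Suc_eq_plus1 Suc_leI le_antisym)
  next
    case False
    then have "Suc s \<in> {1..Suc n}" "Suc s \<noteq> s" using s' by auto
    then obtain l where l: "min s (Suc s) < l" "l \<le> max s (Suc s)" "h x \<le> h l" using sep by blast
    then have "l = Suc s" by auto
    with l show ?thesis by simp
  qed
  have xs: "x = s \<and> even (h x) \<or> x = Suc s \<and> odd (h x)"
  proof (cases "odd (h x)")
    case True
    then have "s < x" "\<not> (s < Suc s \<and> Suc s < x)" using x hs1 unfolding stop_def candidate_def by (auto simp: not_le)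
    with True show ?thesis by auto
  next
    case False
    then have "x \<le> s" "\<not> (x < s \<and> s \<le> s)" using x hs unfolding stop_def candidate_def by (auto simp: not_le)
    with False show ?thesis by auto
  qed
  define g where "g = (\<lambda>j. h (psi x j))"
  have hg: "h = ins x (h x) g"
  proof
    fix j show "h j = ins x (h x) g j" by (cases rule: psi_cases[of j x]) (auto simp: g_def)
  qed
  have "h x \<le> g s" using hs hs1 xs unfolding g_def psi_def by auto
  then have ok: "ins_ok n s x (h x) g" using s' xs unfolding ins_ok_def by auto
  have gd: "g \<in> diagrams n" using Suc.prems(2) diagrams_ins_iff[OF ok] hg by metis
  have "min_prop n (down n s prec) g"
    using min_prop_ins[OF ok s(3) down_def] Suc.prems(3) hg by metis
  then obtain v where v: "length v = n" "(cube_diagram n (down n s prec) v, g) \<in> diagram_equiv n"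
    using Suc.IH[OF so' gd] by blast
  obtain b e where b: "ext_ok n s x e" "cube_diagram (Suc n) prec (b # v) = ext n x e (cube_diagram n (down n s prec) v)"
  proof (cases "x = s")
    case True
    show ?thesis
      by (rule that[of 2 True]) (use True s in \<open>simp_all only: ext_ok_def cube_diagram.simps Let_def s_def[symmetric] list.sel if_True simp_thms\<close>)
  next
    case False
    then have "x = Suc s" using xs by blast
    then show ?thesis
      by (intro that[of 1 False]) (use s in \<open>simp_all only: ext_ok_def cube_diagram.simps Let_def s_def[symmetric] list.sel if_False simp_thms\<close>)
  qed
  have "(cube_diagram (Suc n) prec (b # v), ext n x e g) \<in> diagram_equiv (Suc n)" unfolding b(2) by (rule ext_equiv[OF b(1) v(2)])
  moreover have "(ext n x e g, h) \<in> diagram_equiv (Suc n)"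
    using diagram_equiv_sym[OF ins_equiv_ext[OF gd ok b(1)]] hg by simp
  ultimately have "(cube_diagram (Suc n) prec (b # v), h) \<in> diagram_equiv (Suc n)" by (rule diagram_equiv_trans)
  then show ?case using v(1) by (intro exI[of _ "b # v"]) simp
qed

text \<open>A new column one below its partner needs a partner of positive height. Hence the lower
  bound \<open>N\<close>: each step of the induction asks the smaller diagram for one more
  row.\<close>

lemma cube_diagram_complete:
  assumes "strict_linear_order_on {1..n} prec" "length v = n"
  shows "\<exists>h. (cube_diagram n prec v, h) \<in> diagram_equiv n \<and> complete n h \<and> min_prop n prec h \<and> (\<forall>i\<in>cols n. N \<le> h i)"
  using assms
proof (induction n arbitrary: prec v N)
  case 0
  let ?h = "\<lambda>i. if i = 1 then N else 0"
  have h: "?h \<in> diagrams 0" by (auto simp: diagrams_iff)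
  have "\<not> domino 0 ?h i k" for i k unfolding domino_def side_def by auto
  then have "complete 0 ?h" using complete_iff[OF h] by blast
  then show ?case using diagram_equiv_0[OF h] by (intro exI[of _ ?h]) (auto simp: min_prop_def)
next
  case (Suc n)
  define s where "s = largest {1..Suc n} prec"
  note s = largest_props[OF Suc.prems(1), folded s_def]
  have so': "strict_linear_order_on {1..n} (down n s prec)" by (rule strict_linear_order_down[OF Suc.prems(1) s(1,2)])
  obtain x e where d: "ext_ok n s x e" "cube_diagram (Suc n) prec v = ext n x e (cube_diagram n (down n s prec) (tl v))"
    using cube_diagram_Suc[OF Suc.prems(1), of v, folded s_def] by metis
  obtain g where g: "(cube_diagram n (down n s prec) (tl v), g) \<in> diagram_equiv n" "complete n g"
    "min_prop n (down n s prec) g" "\<forall>i\<in>cols n. N + 1 \<le> g i"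
    using Suc.IH[OF so', of "tl v" "N + 1"] Suc.prems(2) by auto
  have gd: "g \<in> diagrams n" using g(1) unfolding diagram_equiv_def by blast
  have gs: "N + 1 \<le> g s" using g(4) s by simp
  \<comment> \<open>The greatest height of the parity prescribed by \<open>x\<close> that does not
    exceed the partner, as \<open>complete_ins\<close> requires.\<close>
  define e' where "e' = (if even (g s) = (x = s) then g s else g s - 1)"
  have ok: "ins_ok n s x e' g" using d(1) s gs unfolding ins_ok_def ext_ok_def e'_def by auto
  have e': "g s \<le> e' + 1" "N \<le> e'" unfolding e'_def using gs by auto
  let ?h = "ins x e' g"
  have "(cube_diagram (Suc n) prec v, ?h) \<in> diagram_equiv (Suc n)"
    using ext_equiv[OF d(1) g(1)] ins_equiv_ext[OF gd ok d(1)] diagram_equiv_sym diagram_equiv_trans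
    unfolding d(2) by blast
  moreover have "complete (Suc n) ?h" by (rule complete_ins[OF gd ok e'(1) g(2)])
  moreover have "min_prop (Suc n) prec ?h" using min_prop_ins[OF ok s(3) down_def] g(3) by blast
  moreover have "N \<le> ?h i" if i: "i \<in> cols (Suc n)" for i
  proof (cases rule: psi_cases[of i x])
    case 1
    then show ?thesis using e' by simp
  next
    case (2 b)
    have "b \<in> cols n" using i psi_cols ins_ok_x[OF ok] unfolding 2 by blast
    then show ?thesis using g(4) 2 by fastforce
  qed
  ultimately show ?case by blast
qed

section \<open>The isomorphism of labelled graphs\<close>

lemma H_col_iff:
  assumes "x \<in> H t" "h \<in> x"
  shows "x \<in> H_col t j \<longleftrightarrow> is_se t h j"
proof -
  have "(h, g) \<in> diagram_equiv t" if "g \<in> x" for g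
    using assms that equiv_diagram_equiv unfolding H_def by (meson quotient_eq_iff equivE)
  then have "strongly_extremal t g = strongly_extremal t h" if "g \<in> x" for g
    using diagram_equiv_strongly_extremal that by metis
  then show ?thesis using assms unfolding H_col_def strongly_extremal_eq_iff[symmetric] by blast
qed

lemma link_graph_of_edge_iff:
  "z \<in> edges (link_graph_of t prec) \<longleftrightarrow> (\<exists>x y a j k h. z = ({x, y}, a) \<and> x \<in> H_of t prec \<and> y \<in> H_of t prec \<and>
      j \<in> cols t \<and> k \<in> cols t \<and> j \<noteq> k \<and> x \<in> H_col t j \<and> y \<in> H_col t k \<and>
      h \<in> x \<and> complete t h \<and> reduced t h \<and> h(k := h k + 1) \<in> y \<and>
      a = entry t (h(k := h k + 1)) k (h k + 1) \<and> a \<in> {1..t})" (is "_ \<longleftrightarrow> ?R")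
proof -
  have e: "z \<in> edges (link_graph_of t prec) \<longleftrightarrow> z \<in> edges (link_graph t) \<and> fst z \<subseteq> H_of t prec"
    unfolding link_graph_of_def induced_def by (cases z) simp
  show ?thesis unfolding e
  proof
    assume *: "z \<in> edges (link_graph t) \<and> fst z \<subseteq> H_of t prec"
    then obtain x y a where z: "z = ({x, y}, a)" and r: "\<exists>j\<in>cols t. \<exists>k\<in>cols t. j \<noteq> k \<and> x \<in> H_col t j \<and> y \<in> H_col t k \<and>
         (\<exists>h\<in>x. complete t h \<and> reduced t h \<and> (let h' = h(k := h k + 1) in
               h' \<in> y \<and> a = entry t h' k (h' k) \<and> a \<in> {1..t}))"
      unfolding link_graph_def lgraph.simps mem_Collect_eq by blast
    from r[unfolded Let_def fun_upd_same] obtain j k h where "j \<in> cols t" "k \<in> cols t" "j \<noteq> k" "x \<in> H_col t j" "y \<in> H_col t k"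
      "h \<in> x" "complete t h" "reduced t h" "h(k := h k + 1) \<in> y"
      "a = entry t (h(k := h k + 1)) k (h k + 1)" "a \<in> {1..t}" by blast
    moreover have "x \<in> H_of t prec" "y \<in> H_of t prec" using * z by auto
    ultimately show ?R using z by blast
  next
    assume ?R
    then obtain x y a j k h where z: "z = ({x, y}, a)" "x \<in> H_of t prec" "y \<in> H_of t prec"
      and r: "j \<in> cols t" "k \<in> cols t" "j \<noteq> k" "x \<in> H_col t j" "y \<in> H_col t k"
      "h \<in> x" "complete t h" "reduced t h" "h(k := h k + 1) \<in> y"
      "a = entry t (h(k := h k + 1)) k (h k + 1)" "a \<in> {1..t}" by blast
    have "z \<in> edges (link_graph t)"
      unfolding link_graph_def lgraph.simps mem_Collect_eq Let_def fun_upd_same z(1) using r by blast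
    with z show "z \<in> edges (link_graph t) \<and> fst z \<subseteq> H_of t prec" by simp
  qed
qed

theorem theorem8p5:
  fixes t :: nat and prec :: "nat rel"
  assumes "t \<ge> 1"
    and "prec \<subseteq> {1..t} \<times> {1..t}"
    and "strict_linear_order_on {1..t} prec"
  shows "\<exists>\<theta> :: bool list \<Rightarrow> diagram set.
     bij_betw \<theta> (verts (ind_graph t prec)) (verts (link_graph_of t prec)) \<and>
     (\<forall>v\<in>verts (ind_graph t prec).
        vlabel (link_graph_of t prec) (\<theta> v) = vlabel (ind_graph t prec) v) \<and>
     bij_betw (\<lambda>(e, a). (\<theta> ` e, a)) (edges (ind_graph t prec)) (edges (link_graph_of t prec))"
proof -
  note so = assms(3)
  have tr: "trans prec" using so unfolding strict_linear_order_on_def by blast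
  let ?G = "cube t prec" and ?d = "cube_diagram t prec" and ?E = "diagram_equiv t"
  have V: "verts (ind_graph t prec) = {v. length v = t}"
    and Ed: "edges (ind_graph t prec) = edges ?G"
    and L: "\<And>v. length v = t \<Longrightarrow> vlabel (ind_graph t prec) v = vlabel ?G v"
    using ind_graph_cube[of "t - 1" prec] assms(1) verts_cube[of t prec] by auto
  define \<theta> where "\<theta> v = ?E `` {?d v}" for v
  have d: "?d v \<in> diagrams t" for v by (rule diagrams_cube_diagram[OF so])
  have mem: "h \<in> \<theta> v \<longleftrightarrow> (?d v, h) \<in> ?E" for h v unfolding \<theta>_def by blast
  have dv: "?d v \<in> \<theta> v" for v unfolding mem by (rule diagram_equiv_refl[OF d])
  have H: "\<theta> v \<in> H t" for v unfolding H_def \<theta>_def by (rule quotientI[OF d])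
  have col: "\<theta> v \<in> H_col t j \<longleftrightarrow> j = vlabel ?G v" if "length v = t" for v j
    unfolding H_col_iff[OF H dv] using is_se_cube_diagram[OF so that] is_se_unique by blast
  have inj: "inj_on \<theta> {v. length v = t}"
  proof (rule inj_onI)
    fix v w assume len: "v \<in> {v. length v = t}" "w \<in> {v. length v = t}" and e: "\<theta> v = \<theta> w"
    then have "(?d v, ?d w) \<in> ?E" using dv[of w] mem by blast
    then show "v = w" using cube_diagram_inj[OF so, of v w] stop_equiv len by simp
  qed
  have surj: "\<theta> ` {v. length v = t} = H_of t prec"
  proof (intro equalityI subsetI)
    fix x assume "x \<in> \<theta> ` {v. length v = t}"
    then obtain v where v: "length v = t" "x = \<theta> v" by blast
    obtain h where h: "(?d v, h) \<in> ?E" "complete t h" "min_prop t prec h"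
      using cube_diagram_complete[OF so v(1)] by blast
    have "h \<in> diagrams t" using h(1) unfolding diagram_equiv_def by blast
    then have "compatible t prec h" using min_prop_compatible h(3) by blast
    with h H show "x \<in> H_of t prec" unfolding H_of_def v(2) using mem by blast
  next
    fix x assume x: "x \<in> H_of t prec"
    then obtain h where h: "x \<in> H t" "h \<in> x" "compatible t prec h" unfolding H_of_def by blast
    obtain g where g: "x = ?E `` {g}" using h(1) unfolding H_def by (rule quotientE)
    then have hd: "h \<in> diagrams t" using h(2) unfolding diagram_equiv_def by blast
    obtain v where v: "length v = t" "(?d v, h) \<in> ?E"
      using min_prop_cube_diagram[OF so hd compatible_min_prop[OF hd tr h(3)]] by blast
    have "(g, h) \<in> ?E" using g h(2) by blast
    then have "(g, ?d v) \<in> ?E" using v(2) diagram_equiv_sym diagram_equiv_trans by blast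
    then have "x = \<theta> v" unfolding g \<theta>_def by (rule equiv_class_eq[OF equiv_diagram_equiv])
    with v show "x \<in> \<theta> ` {v. length v = t}" by blast
  qed
  have VL: "verts (link_graph_of t prec) = H_of t prec"
    unfolding link_graph_of_def induced_def link_graph_def H_of_def by auto
  have gap_label: "vlabel (link_graph_of t prec) (\<theta> v) = vlabel ?G v" if "length v = t" for v
    unfolding link_graph_of_def induced_def link_graph_def using col[OF that] by simp
  have edge_verts: "e \<subseteq> {v. length v = t}" if "(e, a) \<in> edges ?G" for e a
    using cube_edge_link[OF so that] by auto
  have "inj_on (\<lambda>(e, a). (\<theta> ` e, a)) (edges ?G)"
  proof (rule inj_onI)
    fix p q assume pq: "p \<in> edges ?G" "q \<in> edges ?G"
      "(\<lambda>(e, a). (\<theta> ` e, a)) p = (\<lambda>(e, a). (\<theta> ` e, a)) q"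
    obtain e a e' a' where p: "p = (e, a)" and q: "q = (e', a')" by (cases p, cases q)
    have "\<theta> ` e = \<theta> ` e'" and a: "a = a'" using pq(3) unfolding p q by auto
    then have "e = e'" using inj_on_image_eq_iff[OF inj] edge_verts pq(1,2) unfolding p q by metis
    then show "p = q" unfolding p q using a by simp
  qed
  moreover have "(\<lambda>(e, a). (\<theta> ` e, a)) ` edges ?G = edges (link_graph_of t prec)"
  proof (intro equalityI subsetI)
    fix z assume "z \<in> (\<lambda>(e, a). (\<theta> ` e, a)) ` edges ?G"
    then obtain e a where e: "(e, a) \<in> edges ?G" and z: "z = (\<theta> ` e, a)" by auto
    obtain v w h k c where E: "e = {v, w}" "length v = t" "length w = t" "link t h k"
      "(?d v, h) \<in> ?E" "(?d w, h(k := h k + 1)) \<in> ?E" "a \<in> {1..t}"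
      "stop t (?d v) a c" "\<not> stop t (?d w) a c" using cube_edge_link[OF so e] by blast
    \<comment> \<open>The link obtained from a cube edge need not start at a complete reduced
      tableau.\<close>
    obtain g where g: "link t g k" "(h, g) \<in> ?E" "(h(k := h k + 1), g(k := g k + 1)) \<in> ?E"
      "complete t g" "reduced t g" using link_complete_reduced[OF E(4)] by blast
    let ?g' = "g(k := g k + 1)"
    have eq: "(?d v, g) \<in> ?E" "(?d w, ?g') \<in> ?E" using E(5,6) g(2,3) diagram_equiv_trans by blast+
    obtain j where j: "is_se t g j" "g j = g k + 1" and k: "is_se t ?g' k" using g(1) unfolding link_def by blast
    obtain b where b: "b \<in> {1..t}" "entry t ?g' k (?g' k) = b"
      "\<forall>y\<in>{1..t}. y \<noteq> b \<longrightarrow> (\<forall>c. stop t g y c \<longleftrightarrow> stop t ?g' y c)" using link_stop[OF g(1) j(1)] by blast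
    have a: "1 \<le> a" "a \<le> t" using E(7) by auto
    have "stop t g a c" "\<not> stop t ?g' a c" using E(8,9) stop_equiv[OF eq(1) a] stop_equiv[OF eq(2) a] by auto
    \<comment> \<open>The stop of \<open>a\<close> differs between the two ends, and
      \<open>b\<close> is the only label for which it can.\<close>
    then have ab: "a = b" using b(3) E(7) by blast
    have mg: "g \<in> \<theta> v" "?g' \<in> \<theta> w" using eq mem by auto
    have "\<theta> v \<in> H_col t j" "\<theta> w \<in> H_col t k" using H_col_iff[OF H mg(1)] H_col_iff[OF H mg(2)] j k by auto
    moreover have "j \<in> cols t" "k \<in> cols t" "j \<noteq> k" using j k unfolding is_se_def by auto
    moreover have "\<theta> v \<in> H_of t prec" "\<theta> w \<in> H_of t prec" using surj E(2,3) by auto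
    moreover have "a = entry t ?g' k (g k + 1)" using b(2) ab by simp
    moreover have "z = ({\<theta> v, \<theta> w}, a)" using z E(1) by simp
    ultimately show "z \<in> edges (link_graph_of t prec)" unfolding link_graph_of_edge_iff using mg g(4,5) E(7) by blast
  next
    fix z assume "z \<in> edges (link_graph_of t prec)"
    then obtain x y a j k h where z: "z = ({x, y}, a)" and xy: "x \<in> H_of t prec" "y \<in> H_of t prec"
      and jk: "j \<noteq> k" "x \<in> H_col t j" "y \<in> H_col t k" and h: "h \<in> x" "h(k := h k + 1) \<in> y"
      and a: "a = entry t (h(k := h k + 1)) k (h k + 1)" "a \<in> {1..t}" unfolding link_graph_of_edge_iff by blast
    let ?h' = "h(k := h k + 1)"
    obtain v where v: "length v = t" "x = \<theta> v" using xy(1) unfolding surj[symmetric] by blast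
    obtain w where w: "length w = t" "y = \<theta> w" using xy(2) unfolding surj[symmetric] by blast
    have eq: "(?d v, h) \<in> ?E" "(?d w, ?h') \<in> ?E" using h v w mem by auto
    have se: "is_se t h j" "is_se t ?h' k"
      using H_col_iff[OF H h(1)[unfolded v(2)]] H_col_iff[OF H h(2)[unfolded w(2)]] jk(2,3) unfolding v(2) w(2) by blast+
    have "h \<in> diagrams t" "?h' \<in> diagrams t" using eq unfolding diagram_equiv_def by auto
    \<comment> \<open>Membership of \<open>a\<close> in \<open>{1..t}\<close> excludes the value 0
      that \<open>entry\<close> gives to an extremal block.\<close>
    then have l: "link t h k" using linkI[of h t k j] se jk(1) a by auto
    obtain b where b: "b \<in> {1..t}" "entry t ?h' k (?h' k) = b" "stop t h b k" "stop t ?h' b j"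
      "\<forall>y\<in>{1..t}. y \<noteq> b \<longrightarrow> (\<forall>c. stop t h y c \<longleftrightarrow> stop t ?h' y c)" using link_stop[OF l se(1)] by blast
    have ab: "a = b" using a(1) b(2) by simp
    have st: "stop t (?d v) y c \<longleftrightarrow> stop t h y c" "stop t (?d w) y c \<longleftrightarrow> stop t ?h' y c" if "y \<in> {1..t}" for y c
      using stop_equiv[OF eq(1)] stop_equiv[OF eq(2)] that by auto
    have lj: "j = vlabel ?G v" "k = vlabel ?G w" using col jk v w by auto
    have "({v, w}, a) \<in> edges ?G"
    proof (rule cube_edge_of_stop[OF so v(1) w(1) a(2)])
      show "stop t (?d v) a (vlabel ?G w)" "stop t (?d w) a (vlabel ?G v)"
        using st[OF a(2)] b(3,4) lj ab by auto
      fix y c assume "y \<in> {1..t}" "y \<noteq> a"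
      then show "stop t (?d v) y c \<longleftrightarrow> stop t (?d w) y c" using st b(5) ab by simp
    qed
    moreover have "z = (\<lambda>(e, a). (\<theta> ` e, a)) ({v, w}, a)" using z v w by simp
    ultimately show "z \<in> (\<lambda>(e, a). (\<theta> ` e, a)) ` edges ?G" by blast
  qed
  ultimately have "bij_betw (\<lambda>(e, a). (\<theta> ` e, a)) (edges ?G) (edges (link_graph_of t prec))"
    unfolding bij_betw_def by blast
  moreover have "bij_betw \<theta> {v. length v = t} (H_of t prec)" using inj surj unfolding bij_betw_def by blast
  ultimately show ?thesis unfolding V Ed VL using gap_label L by (intro exI[of _ \<theta>]) auto
qed

end
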